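(* Let $K$ be a commutative unital ring, $A$ a commutative associative unital $K$-algebra, $\star=\sum_{i\ge0}\lambda^iC_i$ a differential star product on $R=A[[\lambda]]$, and $S_0\subset A$ a multiplicative subset. Suppose that $S_0$ satisfies the $\sigma CM$ property: for every sequence $(s_n)_{n\in\mathbb{N}}$ in $S_0$ there are a sequence $(b_n)_{n\in\mathbb{N}}$ in $A$ and an element $s\in S_0$ such that $s_nb_n=s$ for all $n\in\mathbb{N}$. Let $S=S_0+\lambda A[[\lambda]]$. Then the canonical morphism $$\Phi:\big((A[[\lambda]])_S,\star_S\big)\to\big(A_{S_0}[[\lambda]],\star_{S_0}\big)$$ is an isomorphism, and $S$ is a right and left denominator subset of the algebra $(R,\star)$.
   Context: All algebras are associative and unital (the zero algebra is allowed). A multiplicative subset of an algebra is a subset containing $1$ and closed under multiplication. Tensor products are over $K$. Differential operators: for $A$-modules $M,N$, $a\in A$ and $\phi\in\mathrm{Hom}_K(M,N)$ put $(\mathrm{ad}_a\phi)(m)=a\phi(m)-\phi(am)$; $\phi$ is a differential operator of order $k\in\mathbb{N}$ if $\mathrm{ad}_{a_1}\cdots\mathrm{ad}_{a_{k+1}}\phi=0$ for all $a_1,\dots,a_{k+1}\in A$. A $K$-bilinear map $C:A\times A\to A$ is a bidifferential operator of order $(k_1,k_2)$ if for each fixed value of one argument it is a differential operator in the other argument, of order $k_1$ in the first and $k_2$ in the second. A differential star product on $A[[\lambda]]$ is an associative $K[[\lambda]]$-bilinear multiplication $f\star g=\sum_{k\ge0}\lambda^kC_k(f,g)$ for $f,g\in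 A$ (so $(f\star g)_k=\sum_{l+p+q=k}C_l(f_p,g_q)$ for formal series), where all $C_k:A\times A\to A$ are bidifferential operators, $C_0(f,g)=fg$, and $1\star f=f\star1=f$. $A_{S_0}$ is the usual commutative localization of $A$ at $S_0$ and $\eta:A\to A_{S_0}$, $a\mapsto\frac a1$, the numerator map, extended $K[[\lambda]]$-linearly (coefficientwise) to $\eta:A[[\lambda]]\to A_{S_0}[[\lambda]]$. Each $C_i$ localizes to a unique bidifferential operator $(C_i)_{S_0}$ on $A_{S_0}$ with $\eta\circ C_i=(C_i)_{S_0}\circ(\eta\otimes\eta)$, and $\star_{S_0}=\sum_i\lambda^i(C_i)_{S_0}$ is a star product on $A_{S_0}[[\lambda]]$ making $\eta$ a morphism of unital $K[[\lambda]]$-algebras. The set $S$ is a multiplicative subset of $(R,\star)$ and $\eta(S)$ consists of $\star_{S_0}$-invertible elements. $((A[[\lambda]])_S,\star_S)$ denotes the general noncommutative localization of $(R,\star)$ at $S$: a unital $K[[\lambda]]$-algebra with a morphism $\eta_{(R,S)}:R\to R_S$ sending $S$ to invertible elements and universal with this property (every morphism of unital $K[[\lambda]]$-algebras $R\to R'$ mapping $S$ to invertible elements factors uniquely through $\eta_{(R,S)}$). The canonical morphism $\Phi$ is the unique morphism of unital $K[[\lambda]]$-algebras with $\Phi\circ\eta_{(R,S)}=\eta$. A multiplicative subset $S$ of an algebra $R$ is a right denominator set if (a) for all $r\in R,s\in S$ there are $r'\in R,s'\in S$ with $rs'=sr'$, and (b) for all $r\in R,s'\in S$ with $s'r=0$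 there is $s\in S$ with $rs=0$. A left denominator set is defined by the same conditions with the order of all products reversed. *)

theory Defs
  imports "HOL-Algebra.Module"
begin

text \<open>
  Algebras are records with explicit carriers, so that the zero ring and the zero algebra are
  allowed. The library locale \<^locale>\<open>algebra\<close> describes commutative algebras; the following
  one describes associative unital algebras that need not be commutative.
\<close>

locale nc_algebra = module + ring M +
  assumes smult_mult_left:
      "\<lbrakk>a \<in> carrier R; x \<in> carrier M; y \<in> carrier M\<rbrakk> \<Longrightarrow>
        (a \<odot>\<^bsub>M\<^esub> x) \<otimes>\<^bsub>M\<^esub> y = a \<odot>\<^bsub>M\<^esub> (x \<otimes>\<^bsub>M\<^esub> y)"
    and smult_mult_right:
      "\<lbrakk>a \<in> carrier R; x \<in> carrier M; y \<in> carrier M\<rbrakk> \<Longrightarrow>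
        x \<otimes>\<^bsub>M\<^esub> (a \<odot>\<^bsub>M\<^esub> y) = a \<odot>\<^bsub>M\<^esub> (x \<otimes>\<^bsub>M\<^esub> y)"

definition alg_hom ::
    "('k, 'm) ring_scheme \<Rightarrow> ('k, 'a, 'n) module_scheme \<Rightarrow> ('k, 'b, 'p) module_scheme \<Rightarrow> ('a \<Rightarrow> 'b) set"
  where "alg_hom K R T =
    {h \<in> ring_hom R T. \<forall>c\<in>carrier K. \<forall>x\<in>carrier R. h (c \<odot>\<^bsub>R\<^esub> x) = c \<odot>\<^bsub>T\<^esub> h x}"

definition alg_iso ::
    "('k, 'm) ring_scheme \<Rightarrow> ('k, 'a, 'n) module_scheme \<Rightarrow> ('k, 'b, 'p) module_scheme \<Rightarrow> ('a \<Rightarrow> 'b) set"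
  where "alg_iso K R T = {h \<in> alg_hom K R T. bij_betw h (carrier R) (carrier T)}"


section \<open>Denominator sets\<close>

definition right_denominator_set :: "('a, 'm) ring_scheme \<Rightarrow> 'a set \<Rightarrow> bool"
  where "right_denominator_set R S \<longleftrightarrow> submonoid S R \<and>
    (\<forall>r\<in>carrier R. \<forall>s\<in>S. \<exists>r'\<in>carrier R. \<exists>s'\<in>S. r \<otimes>\<^bsub>R\<^esub> s' = s \<otimes>\<^bsub>R\<^esub> r') \<and>
    (\<forall>r\<in>carrier R. \<forall>s'\<in>S. s' \<otimes>\<^bsub>R\<^esub> r = \<zero>\<^bsub>R\<^esub> \<longrightarrow> (\<exists>s\<in>S. r \<otimes>\<^bsub>R\<^esub> s = \<zero>\<^bsub>R\<^esub>))"

definition left_denominator_set :: "('a, 'm) ring_scheme \<Rightarrow> 'a set \<Rightarrow> bool"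
  where "left_denominator_set R S \<longleftrightarrow> submonoid S R \<and>
    (\<forall>r\<in>carrier R. \<forall>s\<in>S. \<exists>r'\<in>carrier R. \<exists>s'\<in>S. s' \<otimes>\<^bsub>R\<^esub> r = r' \<otimes>\<^bsub>R\<^esub> s) \<and>
    (\<forall>r\<in>carrier R. \<forall>s'\<in>S. r \<otimes>\<^bsub>R\<^esub> s' = \<zero>\<^bsub>R\<^esub> \<longrightarrow> (\<exists>s\<in>S. s \<otimes>\<^bsub>R\<^esub> r = \<zero>\<^bsub>R\<^esub>))"

definition sigma_CM :: "('a, 'm) ring_scheme \<Rightarrow> 'a set \<Rightarrow> bool"
  where "sigma_CM A S\<^sub>0 \<longleftrightarrow>
    (\<forall>s :: nat \<Rightarrow> 'a. (\<forall>n. s n \<in> S\<^sub>0) \<longrightarrow>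
      (\<exists>b. \<exists>t\<in>S\<^sub>0. (\<forall>n. b n \<in> carrier A) \<and> (\<forall>n. s n \<otimes>\<^bsub>A\<^esub> b n = t)))"


section \<open>Commutative localization\<close>

definition frac_rel :: "('a, 'm) ring_scheme \<Rightarrow> 'a set \<Rightarrow> (('a \<times> 'a) \<times> ('a \<times> 'a)) set"
  where "frac_rel A S\<^sub>0 =
    {((a, s), (b, t)). a \<in> carrier A \<and> b \<in> carrier A \<and> s \<in> S\<^sub>0 \<and> t \<in> S\<^sub>0 \<and>
      (\<exists>u\<in>S\<^sub>0. u \<otimes>\<^bsub>A\<^esub> (t \<otimes>\<^bsub>A\<^esub> a) = u \<otimes>\<^bsub>A\<^esub> (s \<otimes>\<^bsub>A\<^esub> b))}"

definition frac :: "('a, 'm) ring_scheme \<Rightarrow> 'a set \<Rightarrow> 'a \<Rightarrow> 'a \<Rightarrow> ('a \<times> 'a) set"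
  where "frac A S\<^sub>0 a s = frac_rel A S\<^sub>0 `` {(a, s)}"

definition comm_loc ::
    "('k, 'a, 'm) module_scheme \<Rightarrow> 'a set \<Rightarrow> ('k, ('a \<times> 'a) set) module"
  where "comm_loc A S\<^sub>0 =
    \<lparr>carrier = (carrier A \<times> S\<^sub>0) // frac_rel A S\<^sub>0,
     mult = (\<lambda>X Y. \<Union>(a, s)\<in>X. \<Union>(b, t)\<in>Y. frac A S\<^sub>0 (a \<otimes>\<^bsub>A\<^esub> b) (s \<otimes>\<^bsub>A\<^esub> t)),
     one = frac A S\<^sub>0 \<one>\<^bsub>A\<^esub> \<one>\<^bsub>A\<^esub>,
     zero = frac A S\<^sub>0 \<zero>\<^bsub>A\<^esub> \<one>\<^bsub>A\<^esub>,
     add = (\<lambda>X Y. \<Union>(a, s)\<in>X. \<Union>(b, t)\<in>Y.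
        frac A S\<^sub>0 (a \<otimes>\<^bsub>A\<^esub> t \<oplus>\<^bsub>A\<^esub> b \<otimes>\<^bsub>A\<^esub> s) (s \<otimes>\<^bsub>A\<^esub> t)),
     smult = (\<lambda>c X. \<Union>(a, s)\<in>X. frac A S\<^sub>0 (c \<odot>\<^bsub>A\<^esub> a) s)\<rparr>"

definition numer :: "('a, 'm) ring_scheme \<Rightarrow> 'a set \<Rightarrow> 'a \<Rightarrow> ('a \<times> 'a) set"
  where "numer A S\<^sub>0 a = frac A S\<^sub>0 a \<one>\<^bsub>A\<^esub>"


section \<open>Differential and bidifferential operators\<close>

definition linear_endo ::
    "('k, 'm) ring_scheme \<Rightarrow> ('k, 'a, 'n) module_scheme \<Rightarrow> ('a \<Rightarrow> 'a) \<Rightarrow> bool"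
  where "linear_endo K A \<phi> \<longleftrightarrow> \<phi> \<in> carrier A \<rightarrow> carrier A \<and>
    (\<forall>x\<in>carrier A. \<forall>y\<in>carrier A. \<phi> (x \<oplus>\<^bsub>A\<^esub> y) = \<phi> x \<oplus>\<^bsub>A\<^esub> \<phi> y) \<and>
    (\<forall>c\<in>carrier K. \<forall>x\<in>carrier A. \<phi> (c \<odot>\<^bsub>A\<^esub> x) = c \<odot>\<^bsub>A\<^esub> \<phi> x)"

definition ad :: "('a, 'm) ring_scheme \<Rightarrow> 'a \<Rightarrow> ('a \<Rightarrow> 'a) \<Rightarrow> 'a \<Rightarrow> 'a"
  where "ad A a \<phi> = (\<lambda>m. a \<otimes>\<^bsub>A\<^esub> \<phi> m \<ominus>\<^bsub>A\<^esub> \<phi> (a \<otimes>\<^bsub>A\<^esub> m))"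

definition diff_op ::
    "('k, 'm) ring_scheme \<Rightarrow> ('k, 'a, 'n) module_scheme \<Rightarrow> nat \<Rightarrow> ('a \<Rightarrow> 'a) \<Rightarrow> bool"
  where "diff_op K A k \<phi> \<longleftrightarrow> linear_endo K A \<phi> \<and>
    (\<forall>as. length as = k + 1 \<and> set as \<subseteq> carrier A \<longrightarrow>
      (\<forall>m\<in>carrier A. foldr (ad A) as \<phi> m = \<zero>\<^bsub>A\<^esub>))"

text \<open>\<open>K\<close>-bilinearity is part of this definition, by way of \<^const>\<open>linear_endo\<close>.\<close>

definition bidiff_op ::
    "('k, 'm) ring_scheme \<Rightarrow> ('k, 'a, 'n) module_scheme \<Rightarrow> nat \<Rightarrow> nat \<Rightarrow> ('a \<Rightarrow> 'a \<Rightarrow> 'a) \<Rightarrow> bool"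
  where "bidiff_op K A k\<^sub>1 k\<^sub>2 D \<longleftrightarrow>
    (\<forall>b\<in>carrier A. diff_op K A k\<^sub>1 (\<lambda>a. D a b)) \<and>
    (\<forall>a\<in>carrier A. diff_op K A k\<^sub>2 (\<lambda>b. D a b))"

text \<open>The localized operator is unique on the carrier of \<^term>\<open>comm_loc A S\<^sub>0\<close>; the choice operator
  only fixes irrelevant values outside of it.\<close>

definition loc_bidiff ::
    "('k, 'm) ring_scheme \<Rightarrow> ('k, 'a, 'n) module_scheme \<Rightarrow> 'a set \<Rightarrow> ('a \<Rightarrow> 'a \<Rightarrow> 'a)
      \<Rightarrow> ('a \<times> 'a) set \<Rightarrow> ('a \<times> 'a) set \<Rightarrow> ('a \<times> 'a) set"
  where "loc_bidiff K A S\<^sub>0 D =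
    (SOME E. (\<exists>k\<^sub>1 k\<^sub>2. bidiff_op K (comm_loc A S\<^sub>0) k\<^sub>1 k\<^sub>2 E) \<and>
      (\<forall>a\<in>carrier A. \<forall>b\<in>carrier A. numer A S\<^sub>0 (D a b) = E (numer A S\<^sub>0 a) (numer A S\<^sub>0 b)))"


section \<open>Formal power series and star products\<close>

text \<open>A formal series is the sequence of its coefficients.\<close>

definition ps_ring :: "('k, 'm) ring_scheme \<Rightarrow> (nat \<Rightarrow> 'k) ring"
  where "ps_ring K =
    \<lparr>carrier = UNIV \<rightarrow> carrier K,
     mult = (\<lambda>f g n. \<Oplus>\<^bsub>K\<^esub>i\<in>{..n}. f i \<otimes>\<^bsub>K\<^esub> g (n - i)),
     one = (\<lambda>n. if n = 0 then \<one>\<^bsub>K\<^esub> else \<zero>\<^bsub>K\<^esub>),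
     zero = (\<lambda>n. \<zero>\<^bsub>K\<^esub>),
     add = (\<lambda>f g n. f n \<oplus>\<^bsub>K\<^esub> g n)\<rparr>"

definition star ::
    "('a, 'm) ring_scheme \<Rightarrow> (nat \<Rightarrow> 'a \<Rightarrow> 'a \<Rightarrow> 'a) \<Rightarrow> (nat \<Rightarrow> 'a) \<Rightarrow> (nat \<Rightarrow> 'a) \<Rightarrow> nat \<Rightarrow> 'a"
  where "star A C f g =
    (\<lambda>n. finsum A (\<lambda>(l, p, q). C l (f p) (g q)) {(l, p, q). l + p + q = n})"

definition star_algebra ::
    "('k, 'a, 'm) module_scheme \<Rightarrow> (nat \<Rightarrow> 'a \<Rightarrow> 'a \<Rightarrow> 'a) \<Rightarrow> (nat \<Rightarrow> 'k, nat \<Rightarrow> 'a) module"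
  where "star_algebra A C =
    \<lparr>carrier = UNIV \<rightarrow> carrier A,
     mult = star A C,
     one = (\<lambda>n. if n = 0 then \<one>\<^bsub>A\<^esub> else \<zero>\<^bsub>A\<^esub>),
     zero = (\<lambda>n. \<zero>\<^bsub>A\<^esub>),
     add = (\<lambda>f g n. f n \<oplus>\<^bsub>A\<^esub> g n),
     smult = (\<lambda>c f n. \<Oplus>\<^bsub>A\<^esub>i\<in>{..n}. c i \<odot>\<^bsub>A\<^esub> f (n - i))\<rparr>"

text \<open>Bilinearity of the star product over the power series ring is not a separate condition: it
  follows from the formula defining \<^const>\<open>star\<close> and the \<open>K\<close>-bilinearity of the \<open>C k\<close>.\<close>

definition diff_star_product ::
    "('k, 'm) ring_scheme \<Rightarrow> ('k, 'a, 'n) module_scheme \<Rightarrow> (nat \<Rightarrow> 'a \<Rightarrow> 'a \<Rightarrow> 'a) \<Rightarrow> bool"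
  where "diff_star_product K A C \<longleftrightarrow>
    (\<forall>k. \<exists>k\<^sub>1 k\<^sub>2. bidiff_op K A k\<^sub>1 k\<^sub>2 (C k)) \<and>
    (\<forall>a\<in>carrier A. \<forall>b\<in>carrier A. C 0 a b = a \<otimes>\<^bsub>A\<^esub> b) \<and>
    (let R = star_algebra A C in
      (\<forall>f\<in>carrier R. \<forall>g\<in>carrier R. \<forall>h\<in>carrier R.
        (f \<otimes>\<^bsub>R\<^esub> g) \<otimes>\<^bsub>R\<^esub> h = f \<otimes>\<^bsub>R\<^esub> (g \<otimes>\<^bsub>R\<^esub> h)) \<and>
      (\<forall>f\<in>carrier R. \<one>\<^bsub>R\<^esub> \<otimes>\<^bsub>R\<^esub> f = f \<and> f \<otimes>\<^bsub>R\<^esub> \<one>\<^bsub>R\<^esub> = f))"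

text \<open>\<open>S\<^sub>0 + \<lambda>A[[\<lambda>]]\<close>, the series with constant term in \<open>S\<^sub>0\<close>\<close>

definition ps_lift_set :: "('a, 'm) ring_scheme \<Rightarrow> 'a set \<Rightarrow> (nat \<Rightarrow> 'a) set"
  where "ps_lift_set A S\<^sub>0 = {f \<in> UNIV \<rightarrow> carrier A. f 0 \<in> S\<^sub>0}"

definition ps_numer :: "('a, 'm) ring_scheme \<Rightarrow> 'a set \<Rightarrow> (nat \<Rightarrow> 'a) \<Rightarrow> nat \<Rightarrow> ('a \<times> 'a) set"
  where "ps_numer A S\<^sub>0 f = (\<lambda>n. numer A S\<^sub>0 (f n))"


section \<open>Noncommutative localization\<close>

text \<open>
  The universal property quantifies over algebras of arbitrary carrier type, so it cannot be stated
  as one definition. The localization of \<open>R\<close> at \<open>S\<close> is therefore given by generators and relations: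
  terms over \<open>R\<close> and formal inverses of the elements of \<open>S\<close>, modulo the least congruence for which
  the quotient is an algebra, \<open>Emb\<close> is a morphism of algebras and \<open>Inv s\<close> is inverse to \<open>Emb s\<close>.
  The universal property, with targets of any type, is proved below as \<open>nc_loc_universal\<close>.
\<close>

datatype ('k, 'r) loc_term =
    Emb 'r
  | Inv 'r
  | Add "('k, 'r) loc_term" "('k, 'r) loc_term"
  | Mul "('k, 'r) loc_term" "('k, 'r) loc_term"
  | Smul 'k "('k, 'r) loc_term"

inductive_set loc_terms ::
    "('k, 'm) ring_scheme \<Rightarrow> ('k, 'r, 'n) module_scheme \<Rightarrow> 'r set \<Rightarrow> ('k, 'r) loc_term set"
  for K R S where
  Emb: "r \<in> carrier R \<Longrightarrow> Emb r \<in> loc_terms K R S"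
| Inv: "s \<in> S \<Longrightarrow> Inv s \<in> loc_terms K R S"
| Add: "\<lbrakk>t \<in> loc_terms K R S; u \<in> loc_terms K R S\<rbrakk> \<Longrightarrow> Add t u \<in> loc_terms K R S"
| Mul: "\<lbrakk>t \<in> loc_terms K R S; u \<in> loc_terms K R S\<rbrakk> \<Longrightarrow> Mul t u \<in> loc_terms K R S"
| Smul: "\<lbrakk>c \<in> carrier K; t \<in> loc_terms K R S\<rbrakk> \<Longrightarrow> Smul c t \<in> loc_terms K R S"

inductive loc_eq ::
    "('k, 'm) ring_scheme \<Rightarrow> ('k, 'r, 'n) module_scheme \<Rightarrow> 'r set
      \<Rightarrow> ('k, 'r) loc_term \<Rightarrow> ('k, 'r) loc_term \<Rightarrow> bool"
  for K R S where
  refl: "t \<in> loc_terms K R S \<Longrightarrow> loc_eq K R S t t"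
| sym: "loc_eq K R S t u \<Longrightarrow> loc_eq K R S u t"
| trans: "\<lbrakk>loc_eq K R S t u; loc_eq K R S u v\<rbrakk> \<Longrightarrow> loc_eq K R S t v"
| Add_cong: "\<lbrakk>loc_eq K R S t t'; loc_eq K R S u u'\<rbrakk> \<Longrightarrow> loc_eq K R S (Add t u) (Add t' u')"
| Mul_cong: "\<lbrakk>loc_eq K R S t t'; loc_eq K R S u u'\<rbrakk> \<Longrightarrow> loc_eq K R S (Mul t u) (Mul t' u')"
| Smul_cong: "\<lbrakk>c \<in> carrier K; loc_eq K R S t t'\<rbrakk> \<Longrightarrow> loc_eq K R S (Smul c t) (Smul c t')"
| Add_assoc: "\<lbrakk>t \<in> loc_terms K R S; u \<in> loc_terms K R S; v \<in> loc_terms K R S\<rbrakk> \<Longrightarrow>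
    loc_eq K R S (Add (Add t u) v) (Add t (Add u v))"
| Add_comm: "\<lbrakk>t \<in> loc_terms K R S; u \<in> loc_terms K R S\<rbrakk> \<Longrightarrow>
    loc_eq K R S (Add t u) (Add u t)"
| Add_zero: "t \<in> loc_terms K R S \<Longrightarrow> loc_eq K R S (Add (Emb \<zero>\<^bsub>R\<^esub>) t) t"
| Add_neg: "t \<in> loc_terms K R S \<Longrightarrow>
    loc_eq K R S (Add (Smul (\<ominus>\<^bsub>K\<^esub> \<one>\<^bsub>K\<^esub>) t) t) (Emb \<zero>\<^bsub>R\<^esub>)"
| Mul_assoc: "\<lbrakk>t \<in> loc_terms K R S; u \<in> loc_terms K R S; v \<in> loc_terms K R S\<rbrakk> \<Longrightarrow>
    loc_eq K R S (Mul (Mul t u) v) (Mul t (Mul u v))"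
| one_Mul: "t \<in> loc_terms K R S \<Longrightarrow> loc_eq K R S (Mul (Emb \<one>\<^bsub>R\<^esub>) t) t"
| Mul_one: "t \<in> loc_terms K R S \<Longrightarrow> loc_eq K R S (Mul t (Emb \<one>\<^bsub>R\<^esub>)) t"
| Mul_Add: "\<lbrakk>t \<in> loc_terms K R S; u \<in> loc_terms K R S; v \<in> loc_terms K R S\<rbrakk> \<Longrightarrow>
    loc_eq K R S (Mul t (Add u v)) (Add (Mul t u) (Mul t v))"
| Add_Mul: "\<lbrakk>t \<in> loc_terms K R S; u \<in> loc_terms K R S; v \<in> loc_terms K R S\<rbrakk> \<Longrightarrow>
    loc_eq K R S (Mul (Add t u) v) (Add (Mul t v) (Mul u v))"
| add_Smul: "\<lbrakk>c \<in> carrier K; d \<in> carrier K; t \<in> loc_terms K R S\<rbrakk> \<Longrightarrow>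
    loc_eq K R S (Smul (c \<oplus>\<^bsub>K\<^esub> d) t) (Add (Smul c t) (Smul d t))"
| Smul_Add: "\<lbrakk>c \<in> carrier K; t \<in> loc_terms K R S; u \<in> loc_terms K R S\<rbrakk> \<Longrightarrow>
    loc_eq K R S (Smul c (Add t u)) (Add (Smul c t) (Smul c u))"
| Smul_Smul: "\<lbrakk>c \<in> carrier K; d \<in> carrier K; t \<in> loc_terms K R S\<rbrakk> \<Longrightarrow>
    loc_eq K R S (Smul (c \<otimes>\<^bsub>K\<^esub> d) t) (Smul c (Smul d t))"
| one_Smul: "t \<in> loc_terms K R S \<Longrightarrow> loc_eq K R S (Smul \<one>\<^bsub>K\<^esub> t) t"
| Smul_Mul: "\<lbrakk>c \<in> carrier K; t \<in> loc_terms K R S; u \<in> loc_terms K R S\<rbrakk> \<Longrightarrow>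
    loc_eq K R S (Mul (Smul c t) u) (Smul c (Mul t u))"
| Mul_Smul: "\<lbrakk>c \<in> carrier K; t \<in> loc_terms K R S; u \<in> loc_terms K R S\<rbrakk> \<Longrightarrow>
    loc_eq K R S (Mul t (Smul c u)) (Smul c (Mul t u))"
| Emb_add: "\<lbrakk>x \<in> carrier R; y \<in> carrier R\<rbrakk> \<Longrightarrow>
    loc_eq K R S (Emb (x \<oplus>\<^bsub>R\<^esub> y)) (Add (Emb x) (Emb y))"
| Emb_mult: "\<lbrakk>x \<in> carrier R; y \<in> carrier R\<rbrakk> \<Longrightarrow>
    loc_eq K R S (Emb (x \<otimes>\<^bsub>R\<^esub> y)) (Mul (Emb x) (Emb y))"
| Emb_smult: "\<lbrakk>c \<in> carrier K; x \<in> carrier R\<rbrakk> \<Longrightarrow>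
    loc_eq K R S (Emb (c \<odot>\<^bsub>R\<^esub> x)) (Smul c (Emb x))"
| Inv_left: "s \<in> S \<Longrightarrow> loc_eq K R S (Mul (Inv s) (Emb s)) (Emb \<one>\<^bsub>R\<^esub>)"
| Inv_right: "s \<in> S \<Longrightarrow> loc_eq K R S (Mul (Emb s) (Inv s)) (Emb \<one>\<^bsub>R\<^esub>)"

definition loc_class ::
    "('k, 'm) ring_scheme \<Rightarrow> ('k, 'r, 'n) module_scheme \<Rightarrow> 'r set
      \<Rightarrow> ('k, 'r) loc_term \<Rightarrow> ('k, 'r) loc_term set"
  where "loc_class K R S t = {u. loc_eq K R S t u}"

definition nc_loc ::
    "('k, 'm) ring_scheme \<Rightarrow> ('k, 'r, 'n) module_scheme \<Rightarrow> 'r set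
      \<Rightarrow> ('k, ('k, 'r) loc_term set) module"
  where "nc_loc K R S =
    \<lparr>carrier = loc_class K R S ` loc_terms K R S,
     mult = (\<lambda>X Y. \<Union>t\<in>X. \<Union>u\<in>Y. loc_class K R S (Mul t u)),
     one = loc_class K R S (Emb \<one>\<^bsub>R\<^esub>),
     zero = loc_class K R S (Emb \<zero>\<^bsub>R\<^esub>),
     add = (\<lambda>X Y. \<Union>t\<in>X. \<Union>u\<in>Y. loc_class K R S (Add t u)),
     smult = (\<lambda>c X. \<Union>t\<in>X. loc_class K R S (Smul c t))\<rparr>"

definition nc_loc_map ::
    "('k, 'm) ring_scheme \<Rightarrow> ('k, 'r, 'n) module_scheme \<Rightarrow> 'r set \<Rightarrow> 'r \<Rightarrow> ('k, 'r) loc_term set"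
  where "nc_loc_map K R S r = loc_class K R S (Emb r)"

text \<open>The morphism induced by \<open>g\<close> via the universal property; extensionality makes uniqueness on
  the carrier the same as equality of functions.\<close>

definition induced_morphism ::
    "('k, 'm) ring_scheme \<Rightarrow> ('k, 'r, 'n) module_scheme \<Rightarrow> 'r set \<Rightarrow> ('k, 'b, 'p) module_scheme
      \<Rightarrow> ('r \<Rightarrow> 'b) \<Rightarrow> (('k, 'r) loc_term set \<Rightarrow> 'b) \<Rightarrow> bool"
  where "induced_morphism K R S T g \<Phi> \<longleftrightarrow>
    \<Phi> \<in> alg_hom K (nc_loc K R S) T \<and> \<Phi> \<in> extensional (carrier (nc_loc K R S)) \<and>
    (\<forall>r\<in>carrier R. \<Phi> (nc_loc_map K R S r) = g r)"


subsection \<open>The universal property\<close>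

lemma loc_class_eq_iff:
  assumes "t \<in> loc_terms K R S"
  shows "loc_class K R S t = loc_class K R S u \<longleftrightarrow> loc_eq K R S t u"
proof
  assume "loc_class K R S t = loc_class K R S u"
  moreover have "t \<in> loc_class K R S t" using assms by (simp add: loc_class_def loc_eq.refl)
  ultimately show "loc_eq K R S t u" by (auto simp: loc_class_def intro: loc_eq.sym)
next
  assume "loc_eq K R S t u"
  then show "loc_class K R S t = loc_class K R S u"
    by (auto simp: loc_class_def intro: loc_eq.sym loc_eq.trans)
qed

lemma loc_class_cong: "loc_eq K R S t u \<Longrightarrow> loc_class K R S t = loc_class K R S u"
  by (auto simp: loc_class_def intro: loc_eq.sym loc_eq.trans)

lemma nc_loc_simps:
  fixes K R S
  defines "T \<equiv> loc_terms K R S" and "L \<equiv> nc_loc K R S" and "c \<equiv> loc_class K R S"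
  shows "\<lbrakk>t \<in> T; u \<in> T\<rbrakk> \<Longrightarrow> c t \<otimes>\<^bsub>L\<^esub> c u = c (Mul t u)"
    and "\<lbrakk>t \<in> T; u \<in> T\<rbrakk> \<Longrightarrow> c t \<oplus>\<^bsub>L\<^esub> c u = c (Add t u)"
    and "\<lbrakk>k \<in> carrier K; t \<in> T\<rbrakk> \<Longrightarrow> k \<odot>\<^bsub>L\<^esub> c t = c (Smul k t)"
proof -
  have self: "t \<in> c t" if "t \<in> T" for t
    using that by (simp add: c_def T_def loc_class_def loc_eq.refl)
  have mem: "v \<in> c t \<Longrightarrow> loc_eq K R S v t" for v t
    by (auto simp: c_def loc_class_def intro: loc_eq.sym)
  show "c t \<otimes>\<^bsub>L\<^esub> c u = c (Mul t u)" if tu: "t \<in> T" "u \<in> T"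
  proof -
    have "c (Mul t' u') = c (Mul t u)" if "t' \<in> c t" "u' \<in> c u" for t' u'
      unfolding c_def using that by (intro loc_class_cong loc_eq.Mul_cong mem)
    then have "(\<Union>t'\<in>c t. \<Union>u'\<in>c u. c (Mul t' u')) = (\<Union>t'\<in>c t. \<Union>u'\<in>c u. c (Mul t u))"
      by simp
    also have "\<dots> = c (Mul t u)" using self[OF tu(1)] self[OF tu(2)] by blast
    finally show ?thesis by (simp add: L_def nc_loc_def c_def)
  qed
  show "c t \<oplus>\<^bsub>L\<^esub> c u = c (Add t u)" if tu: "t \<in> T" "u \<in> T"
  proof -
    have "c (Add t' u') = c (Add t u)" if "t' \<in> c t" "u' \<in> c u" for t' u'
      unfolding c_def using that by (intro loc_class_cong loc_eq.Add_cong mem)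
    then have "(\<Union>t'\<in>c t. \<Union>u'\<in>c u. c (Add t' u')) = (\<Union>t'\<in>c t. \<Union>u'\<in>c u. c (Add t u))"
      by simp
    also have "\<dots> = c (Add t u)" using self[OF tu(1)] self[OF tu(2)] by blast
    finally show ?thesis by (simp add: L_def nc_loc_def c_def)
  qed
  show "k \<odot>\<^bsub>L\<^esub> c t = c (Smul k t)" if t: "k \<in> carrier K" "t \<in> T"
  proof -
    have "c (Smul k t') = c (Smul k t)" if "t' \<in> c t" for t'
      unfolding c_def using that t by (intro loc_class_cong loc_eq.Smul_cong mem)
    then have "(\<Union>t'\<in>c t. c (Smul k t')) = (\<Union>t'\<in>c t. c (Smul k t))"
      by simp
    also have "\<dots> = c (Smul k t)" using self[OF t(2)] by blast
    finally show ?thesis by (simp add: L_def nc_loc_def c_def)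
  qed
qed

lemma nc_loc_carrier: "carrier (nc_loc K R S) = loc_class K R S ` loc_terms K R S"
  and nc_loc_one: "\<one>\<^bsub>nc_loc K R S\<^esub> = loc_class K R S (Emb \<one>\<^bsub>R\<^esub>)"
  and nc_loc_zero: "\<zero>\<^bsub>nc_loc K R S\<^esub> = loc_class K R S (Emb \<zero>\<^bsub>R\<^esub>)"
  by (simp_all add: nc_loc_def)

lemma nc_loc_nc_algebra:
  assumes R: "nc_algebra K R"
  shows "nc_algebra K (nc_loc K R S)"
proof -
  interpret nc_algebra K R by (rule R)
  have z: "Emb \<zero>\<^bsub>R\<^esub> \<in> loc_terms K R S" and o: "Emb \<one>\<^bsub>R\<^esub> \<in> loc_terms K R S"
    by (auto intro!: loc_terms.intros)
  note simps = nc_loc_carrier nc_loc_one nc_loc_zero nc_loc_simps z o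
    loc_terms.Add loc_terms.Mul loc_terms.Smul
  have ab: "abelian_group (nc_loc K R S)"
  proof (rule abelian_groupI)
    fix x y z
    assume "x \<in> carrier (nc_loc K R S)" "y \<in> carrier (nc_loc K R S)" "z \<in> carrier (nc_loc K R S)"
    then show "x \<oplus>\<^bsub>nc_loc K R S\<^esub> y \<oplus>\<^bsub>nc_loc K R S\<^esub> z = x \<oplus>\<^bsub>nc_loc K R S\<^esub> (y \<oplus>\<^bsub>nc_loc K R S\<^esub> z)"
      by (auto simp: simps loc_class_eq_iff del: equalityI intro!: imageI loc_eq.Add_assoc)
  next
    fix x y
    assume "x \<in> carrier (nc_loc K R S)" "y \<in> carrier (nc_loc K R S)"
    then show "x \<oplus>\<^bsub>nc_loc K R S\<^esub> y = y \<oplus>\<^bsub>nc_loc K R S\<^esub> x"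
      by (auto simp: simps loc_class_eq_iff del: equalityI intro!: imageI loc_eq.Add_comm)
  next
    fix x
    assume "x \<in> carrier (nc_loc K R S)"
    then obtain t where t: "x = loc_class K R S t" "t \<in> loc_terms K R S" by (auto simp: simps)
    show "\<exists>y\<in>carrier (nc_loc K R S). y \<oplus>\<^bsub>nc_loc K R S\<^esub> x = \<zero>\<^bsub>nc_loc K R S\<^esub>"
      by (rule bexI[of _ "loc_class K R S (Smul (\<ominus>\<^bsub>K\<^esub> \<one>\<^bsub>K\<^esub>) t)"])
         (use t in \<open>auto simp: simps loc_class_eq_iff del: equalityI intro!: imageI loc_eq.Add_neg\<close>)
  qed (auto simp: simps loc_class_eq_iff del: equalityI intro!: imageI loc_eq.Add_zero)
  have mon: "monoid (nc_loc K R S)"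
    by (rule monoidI)
       (auto simp: simps loc_class_eq_iff del: equalityI intro!: imageI loc_eq.Mul_assoc loc_eq.one_Mul loc_eq.Mul_one)
  have rng: "ring (nc_loc K R S)"
    by (rule ringI[OF ab mon])
       (auto simp: simps loc_class_eq_iff del: equalityI intro!: imageI loc_eq.Mul_Add loc_eq.Add_Mul)
  have md: "module K (nc_loc K R S)"
    by (rule moduleI[OF R.is_cring ab])
       (auto simp: simps loc_class_eq_iff del: equalityI intro!: imageI loc_eq.add_Smul loc_eq.Smul_Add loc_eq.Smul_Smul
         loc_eq.one_Smul)
  show ?thesis
    by (intro nc_algebra.intro md rng nc_algebra_axioms.intro)
       (auto simp: simps loc_class_eq_iff del: equalityI intro!: imageI loc_eq.Smul_Mul loc_eq.Mul_Smul)
qed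

lemma nc_loc_map_hom:
  assumes R: "nc_algebra K R"
  shows "nc_loc_map K R S \<in> alg_hom K R (nc_loc K R S)"
proof -
  interpret nc_algebra K R by (rule R)
  show ?thesis
    by (auto simp: alg_hom_def ring_hom_def nc_loc_map_def nc_loc_carrier nc_loc_one nc_loc_simps
        loc_terms.Emb loc_terms.Add loc_terms.Mul loc_terms.Smul loc_class_eq_iff
        del: equalityI intro!: imageI loc_eq.Emb_add loc_eq.Emb_mult loc_eq.Emb_smult)
qed

lemma nc_loc_map_Units:
  assumes R: "nc_algebra K R" and S: "S \<subseteq> carrier R" and s: "s \<in> S"
  shows "nc_loc_map K R S s \<in> Units (nc_loc K R S)"
proof -
  have t: "Emb s \<in> loc_terms K R S" "Inv s \<in> loc_terms K R S"
    using s S by (auto intro!: loc_terms.intros)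
  then show ?thesis
    unfolding Units_def nc_loc_map_def nc_loc_carrier nc_loc_one
    by (auto del: equalityI intro!: imageI bexI[of _ "loc_class K R S (Inv s)"]
        loc_eq.Inv_left[OF s] loc_eq.Inv_right[OF s] simp: nc_loc_simps loc_terms.Mul loc_class_eq_iff)
qed

primrec loc_eval :: "('k, 'b, 'p) module_scheme \<Rightarrow> ('r \<Rightarrow> 'b) \<Rightarrow> ('k, 'r) loc_term \<Rightarrow> 'b" where
  "loc_eval T g (Emb r) = g r"
| "loc_eval T g (Inv s) = inv\<^bsub>T\<^esub> (g s)"
| "loc_eval T g (Add t u) = loc_eval T g t \<oplus>\<^bsub>T\<^esub> loc_eval T g u"
| "loc_eval T g (Mul t u) = loc_eval T g t \<otimes>\<^bsub>T\<^esub> loc_eval T g u"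
| "loc_eval T g (Smul c t) = c \<odot>\<^bsub>T\<^esub> loc_eval T g t"

theorem nc_loc_universal:
  assumes R: "nc_algebra K R" and S: "S \<subseteq> carrier R" and T: "nc_algebra K T"
    and g: "g \<in> alg_hom K R T" and gS: "g ` S \<subseteq> Units T"
  shows "\<exists>!\<Phi>. induced_morphism K R S T g \<Phi>"
proof -
  interpret K: cring K
    using R by (simp add: nc_algebra_def module_def)
  interpret R: nc_algebra K R by (rule R)
  interpret T: nc_algebra K T by (rule T)
  have gh: "g \<in> ring_hom R T"
    and gc: "\<And>c x. c \<in> carrier K \<Longrightarrow> x \<in> carrier R \<Longrightarrow> g (c \<odot>\<^bsub>R\<^esub> x) = c \<odot>\<^bsub>T\<^esub> g x"
    using g by (auto simp: alg_hom_def)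
  note gsimps = ring_hom_closed[OF gh] ring_hom_add[OF gh] ring_hom_mult[OF gh] ring_hom_one[OF gh]
    ring_hom_zero[OF gh R.ring_axioms T.ring_axioms] gc
  have cl: "loc_eval T g t \<in> carrier T" if "t \<in> loc_terms K R S" for t
    using that by induction (use gS in \<open>auto simp: gsimps\<close>)
  have neg: "(\<ominus>\<^bsub>K\<^esub> \<one>\<^bsub>K\<^esub>) \<odot>\<^bsub>T\<^esub> x \<oplus>\<^bsub>T\<^esub> x = \<zero>\<^bsub>T\<^esub>" if x: "x \<in> carrier T" for x
    using T.smult_l_distr[of "\<ominus>\<^bsub>K\<^esub> \<one>\<^bsub>K\<^esub>" "\<one>\<^bsub>K\<^esub>" x] x
    by (simp add: K.l_neg)
  have ev: "loc_eval T g t = loc_eval T g u" if "loc_eq K R S t u" for t u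
    using that
  proof induction
    case (Add_comm t u)
    then show ?case by (simp add: cl T.M.a_comm)
  next
    case (Inv_left s)
    then show ?case using gS by (auto simp: gsimps)
  next
    case (Inv_right s)
    then show ?case using gS by (auto simp: gsimps)
  qed (auto simp: gsimps cl neg T.M.a_assoc T.m_assoc T.l_distr T.r_distr
      T.smult_l_distr T.smult_r_distr T.smult_assoc1 T.smult_mult_left T.smult_mult_right)
  define \<Phi> where "\<Phi> = restrict (\<lambda>X. loc_eval T g (SOME t. t \<in> X)) (carrier (nc_loc K R S))"
  have \<Phi>: "\<Phi> (loc_class K R S t) = loc_eval T g t" if t: "t \<in> loc_terms K R S" for t
  proof -
    have "t \<in> loc_class K R S t" using t by (simp add: loc_class_def loc_eq.refl)
    then have "(SOME u. u \<in> loc_class K R S t) \<in> loc_class K R S t" by (rule someI)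
    then have "loc_eval T g (SOME u. u \<in> loc_class K R S t) = loc_eval T g t"
      using ev by (auto simp: loc_class_def)
    then show ?thesis using t by (auto simp: \<Phi>_def nc_loc_carrier)
  qed
  have ind: "induced_morphism K R S T g \<Phi>"
    unfolding induced_morphism_def
  proof (intro conjI)
    show "\<Phi> \<in> alg_hom K (nc_loc K R S) T"
      by (auto simp: alg_hom_def ring_hom_def nc_loc_carrier nc_loc_one nc_loc_simps \<Phi> cl gsimps
          loc_terms.intros)
    show "\<Phi> \<in> extensional (carrier (nc_loc K R S))" by (simp add: \<Phi>_def)
    show "\<forall>r\<in>carrier R. \<Phi> (nc_loc_map K R S r) = g r"
      by (simp add: nc_loc_map_def \<Phi> loc_terms.Emb)
  qed
  have uniq: "\<Psi> = \<Phi>" if \<Psi>: "induced_morphism K R S T g \<Psi>" for \<Psi>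
  proof -
    have hom: "\<Psi> \<in> ring_hom (nc_loc K R S) T"
      and sm: "\<And>c x. c \<in> carrier K \<Longrightarrow> x \<in> carrier (nc_loc K R S) \<Longrightarrow>
        \<Psi> (c \<odot>\<^bsub>nc_loc K R S\<^esub> x) = c \<odot>\<^bsub>T\<^esub> \<Psi> x"
      and emb: "\<And>r. r \<in> carrier R \<Longrightarrow> \<Psi> (loc_class K R S (Emb r)) = g r"
      and ext: "\<Psi> \<in> extensional (carrier (nc_loc K R S))"
      using \<Psi> by (auto simp: induced_morphism_def alg_hom_def nc_loc_map_def)
    have "\<Psi> (loc_class K R S t) = loc_eval T g t" if "t \<in> loc_terms K R S" for t
      using that
    proof induction
      case (Emb r)
      then show ?case by (simp add: emb)
    next
      case (Inv s)
      then have sR: "s \<in> carrier R" and gs: "g s \<in> Units T" using S gS by auto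
      have t: "Emb s \<in> loc_terms K R S" "loc_term.Inv s \<in> loc_terms K R S"
        using Inv sR by (auto intro: loc_terms.intros)
      let ?i = "loc_class K R S (loc_term.Inv s)"
      have i: "?i \<in> carrier (nc_loc K R S)" using t by (simp add: nc_loc_carrier)
      have "?i \<otimes>\<^bsub>nc_loc K R S\<^esub> loc_class K R S (Emb s) = \<one>\<^bsub>nc_loc K R S\<^esub>"
        using t Inv by (auto simp: nc_loc_simps nc_loc_one loc_terms.Mul loc_class_eq_iff intro!: loc_eq.Inv_left)
      then have "\<Psi> ?i \<otimes>\<^bsub>T\<^esub> g s = \<one>\<^bsub>T\<^esub>"
        using ring_hom_mult[OF hom i, of "loc_class K R S (Emb s)"] t
        by (simp add: emb[OF sR] ring_hom_one[OF hom] nc_loc_carrier)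
      then have "inv\<^bsub>T\<^esub> (g s) = \<Psi> ?i"
        using gs T.inv_unique[of "\<Psi> ?i" "g s" "inv\<^bsub>T\<^esub> (g s)"] ring_hom_closed[OF hom i] by auto
      then show ?case by simp
    next
      case (Add t u)
      then show ?case
        using ring_hom_add[OF hom, of "loc_class K R S t" "loc_class K R S u"]
        by (simp add: nc_loc_carrier nc_loc_simps)
    next
      case (Mul t u)
      then show ?case
        using ring_hom_mult[OF hom, of "loc_class K R S t" "loc_class K R S u"]
        by (simp add: nc_loc_carrier nc_loc_simps)
    next
      case (Smul c t)
      then show ?case
        using sm[of c "loc_class K R S t"] by (simp add: nc_loc_carrier nc_loc_simps)
    qed
    then have "\<And>X. X \<in> carrier (nc_loc K R S) \<Longrightarrow> \<Psi> X = \<Phi> X"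
      by (auto simp: nc_loc_carrier \<Phi>)
    then show ?thesis
      using extensionalityI[OF ext, of \<Phi>] by (auto simp: \<Phi>_def)
  qed
  show ?thesis using ind uniq by blast
qed

end

theory Submission
  imports Defs "HOL-Algebra.RingHom"
begin

text \<open>
  Let \<open>\<phi> : A \<rightarrow> A\<^sub>S\<close> be a differential operator. On such operators precomposition with \<open>s \<in> S\<^sub>0\<close> differs
  from multiplication by \<open>s\<close> by the nilpotent \<open>ad\<close>, hence is invertible; so \<open>\<phi>\<close> extends to fractions,
  and a differential operator on \<open>A\<^sub>S\<close> is determined by its values on numerators. Applied in each
  argument, this gives the localized star product.

  By \<open>\<sigma>CM\<close> the coefficients of a series over \<open>A\<^sub>S\<close> have a common denominator \<open>s\<close>. For each \<open>l\<close> a power of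
  \<open>s\<close> absorbs the denominators that the differential operator \<open>C\<^sub>l\<close> produces, and \<open>\<sigma>CM\<close> yields one common
  multiple \<open>w \<in> S\<^sub>0\<close> of these powers: right multiplication by the constant series \<open>w\<close> makes every series
  over \<open>A\<^sub>S\<close> a numerator, and likewise annihilates every series in the kernel of the numerator map.
  These two facts give the right denominator set and the isomorphism; the left version follows by
  exchanging the arguments of the \<open>C\<^sub>l\<close>.
\<close>

section \<open>Differential operators along an algebra morphism\<close>

text \<open>The obstacle is that a denominator cannot simply be moved through the star product:
  every \<open>C l\<close> takes part, the power of s needed for \<open>C l\<close> depends on its
  order, and these orders have no common bound. What saves the argument is that the exponent depends
  on the order of \<open>C l\<close> alone and not on the coefficients of the series, which leaves
  one requirement for each l, and such a countable family is within reach of the sigma CM property.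
  A second obstacle is that the localized operators are given only by existence and compatibility on
  numerators, so associativity and the unit laws have to be transferred to fractions. A differential
  operator that vanishes on numerators is zero, and this rigidity replaces explicit formulas. The
  Ore condition is not verified by computing with series. Invertibility of the images of S,
  annihilators for the kernel and fractional form of every series over the localization imply it,
  and also imply that the canonical morphism is bijective.\<close>

lemma (in abelian_group) minus_eq_zero_iff [simp]:
  "\<lbrakk>a \<in> carrier G; b \<in> carrier G\<rbrakk> \<Longrightarrow> a \<ominus> b = \<zero> \<longleftrightarrow> a = b"
  by (metis a_minus_def add.inv_closed minus_equality r_neg minus_minus)


text \<open>The analogue of \<open>linear_endo\<close> with separate source and target: the
  extension to fractions starts from maps into the localization, which are not
  endomorphisms.\<close>

definition linear_map ::
    "('k, 'm) ring_scheme \<Rightarrow> ('k, 'a, 'n) module_scheme \<Rightarrow> ('k, 'b, 'p) module_scheme \<Rightarrow> ('a \<Rightarrow> 'b) \<Rightarrow> bool"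
  where "linear_map K A B \<phi> \<longleftrightarrow> \<phi> \<in> carrier A \<rightarrow> carrier B \<and>
    (\<forall>x\<in>carrier A. \<forall>y\<in>carrier A. \<phi> (x \<oplus>\<^bsub>A\<^esub> y) = \<phi> x \<oplus>\<^bsub>B\<^esub> \<phi> y) \<and>
    (\<forall>c\<in>carrier K. \<forall>x\<in>carrier A. \<phi> (c \<odot>\<^bsub>A\<^esub> x) = c \<odot>\<^bsub>B\<^esub> \<phi> x)"

definition ad_along ::
    "('a, 'm) ring_scheme \<Rightarrow> ('b, 'n) ring_scheme \<Rightarrow> ('a \<Rightarrow> 'b) \<Rightarrow> 'a \<Rightarrow> ('a \<Rightarrow> 'b) \<Rightarrow> 'a \<Rightarrow> 'b"
  where "ad_along A B g a \<phi> = (\<lambda>m. g a \<otimes>\<^bsub>B\<^esub> \<phi> m \<ominus>\<^bsub>B\<^esub> \<phi> (a \<otimes>\<^bsub>A\<^esub> m))"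

text \<open>The differential operators of order strictly less than \<open>n\<close> from \<open>A\<close> to the \<open>A\<close>-module
  obtained from \<open>B\<close> by restriction of scalars along \<open>g\<close>; the shift makes the zero map the base case.\<close>

primrec diff_along ::
    "('a, 'm) ring_scheme \<Rightarrow> ('b, 'n) ring_scheme \<Rightarrow> ('a \<Rightarrow> 'b) \<Rightarrow> nat \<Rightarrow> ('a \<Rightarrow> 'b) \<Rightarrow> bool"
  where
    "diff_along A B g 0 \<phi> \<longleftrightarrow> (\<forall>m\<in>carrier A. \<phi> m = \<zero>\<^bsub>B\<^esub>)"
  | "diff_along A B g (Suc n) \<phi> \<longleftrightarrow> (\<forall>a\<in>carrier A. diff_along A B g n (ad_along A B g a \<phi>))"

lemma linear_mapD:
  assumes "linear_map K A B \<phi>"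
  shows linear_map_closed: "x \<in> carrier A \<Longrightarrow> \<phi> x \<in> carrier B"
    and linear_map_add: "\<lbrakk>x \<in> carrier A; y \<in> carrier A\<rbrakk> \<Longrightarrow> \<phi> (x \<oplus>\<^bsub>A\<^esub> y) = \<phi> x \<oplus>\<^bsub>B\<^esub> \<phi> y"
    and linear_map_smult: "\<lbrakk>c \<in> carrier K; x \<in> carrier A\<rbrakk> \<Longrightarrow> \<phi> (c \<odot>\<^bsub>A\<^esub> x) = c \<odot>\<^bsub>B\<^esub> \<phi> x"
  using assms by (auto simp: linear_map_def)

lemma linear_mapI:
  assumes "\<And>x. x \<in> carrier A \<Longrightarrow> \<phi> x \<in> carrier B"
    and "\<And>x y. \<lbrakk>x \<in> carrier A; y \<in> carrier A\<rbrakk> \<Longrightarrow> \<phi> (x \<oplus>\<^bsub>A\<^esub> y) = \<phi> x \<oplus>\<^bsub>B\<^esub> \<phi> y"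
    and "\<And>c x. \<lbrakk>c \<in> carrier K; x \<in> carrier A\<rbrakk> \<Longrightarrow> \<phi> (c \<odot>\<^bsub>A\<^esub> x) = c \<odot>\<^bsub>B\<^esub> \<phi> x"
  shows "linear_map K A B \<phi>"
  using assms by (auto simp: linear_map_def)

lemma linear_map_endo: "linear_map K A A = linear_endo K A"
  by (simp add: fun_eq_iff linear_map_def linear_endo_def)

lemma linear_map_comp:
  "\<lbrakk>linear_map K A B \<phi>; linear_map K B D \<psi>\<rbrakk> \<Longrightarrow> linear_map K A D (\<lambda>m. \<psi> (\<phi> m))"
  by (auto simp: linear_map_def Pi_def)

text \<open>Functions have arbitrary values outside the carrier. A commutator evaluates at carrier
  elements and their products, so by induction only values on the carrier count.\<close>

lemma diff_along_cong:
  assumes "\<And>m. m \<in> carrier A \<Longrightarrow> \<phi> m = \<psi> m" and "monoid A"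
  shows "diff_along A B g n \<phi> \<longleftrightarrow> diff_along A B g n \<psi>"
  using assms
proof (induction n arbitrary: \<phi> \<psi>)
  case (Suc n)
  interpret monoid A by fact
  have "ad_along A B g a \<phi> m = ad_along A B g a \<psi> m" if "a \<in> carrier A" "m \<in> carrier A" for a m
    using that Suc.prems by (simp add: ad_along_def)
  then show ?case
    unfolding diff_along.simps by (intro ball_cong refl Suc.IH) (auto intro: Suc.prems(2))
qed simp

lemma foldr_ad_zero_iff:
  "(\<forall>as. length as = n \<and> set as \<subseteq> carrier A \<longrightarrow> (\<forall>m\<in>carrier A. foldr (ad A) as \<phi> m = \<zero>\<^bsub>A\<^esub>)) \<longleftrightarrow>
    diff_along A A (\<lambda>x. x) n \<phi>"
proof (induction n arbitrary: \<phi>)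
  case (Suc n)
  have ad: "ad_along A A (\<lambda>x. x) = ad A" by (simp add: fun_eq_iff ad_along_def ad_def)
  \<comment> \<open>\<open>foldr\<close> applies the last entry of the list first, and
    \<open>diff_along\<close> peels off the innermost commutator first; lists are therefore split at
    their end.\<close>
  have *: "(\<forall>bs. length bs = Suc n \<and> set bs \<subseteq> carrier A \<longrightarrow> P bs) \<longleftrightarrow>
      (\<forall>a\<in>carrier A. \<forall>as. length as = n \<and> set as \<subseteq> carrier A \<longrightarrow> P (as @ [a]))"
    (is "?l = ?r") for P
  proof
    assume r: ?r
    show ?l
    proof (intro allI impI)
      fix bs assume "length bs = Suc n \<and> set bs \<subseteq> carrier A"
      then show "P bs" using r by (cases bs rule: rev_cases) auto
    qed
  qed auto
  show ?case by (simp add: * ad Suc.IH[symmetric])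
qed simp

text \<open>Order k means that k + 1 commutators give zero, and \<open>diff_along\<close> counts
  commutators; hence the index \<open>Suc k\<close>.\<close>

lemma diff_op_iff:
  "diff_op K A k \<phi> \<longleftrightarrow> linear_map K A A \<phi> \<and> diff_along A A (\<lambda>x. x) (Suc k) \<phi>"
  using foldr_ad_zero_iff[of "Suc k" A \<phi>] by (simp add: diff_op_def linear_map_endo)

section \<open>Ring identities behind the commutator calculus\<close>

context cring
begin

lemma ad_add_eq:
  "\<lbrakk>c \<in> carrier R; x \<in> carrier R; y \<in> carrier R; x' \<in> carrier R; y' \<in> carrier R\<rbrakk> \<Longrightarrow>
    c \<otimes> (x \<oplus> y) \<ominus> (x' \<oplus> y') = (c \<otimes> x \<ominus> x') \<oplus> (c \<otimes> y \<ominus> y')"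
  by algebra

lemma ad_mult_eq:
  "\<lbrakk>c \<in> carrier R; b \<in> carrier R; x \<in> carrier R; x' \<in> carrier R\<rbrakk> \<Longrightarrow>
    c \<otimes> (b \<otimes> x) \<ominus> b \<otimes> x' = b \<otimes> (c \<otimes> x \<ominus> x')"
  by algebra

lemma minus_eq_mult: "\<lbrakk>x \<in> carrier R; y \<in> carrier R\<rbrakk> \<Longrightarrow> x \<ominus> y = x \<oplus> (\<ominus> \<one>) \<otimes> y"
  by algebra

lemma minus_telescope:
  "\<lbrakk>x \<in> carrier R; y \<in> carrier R; z \<in> carrier R\<rbrakk> \<Longrightarrow> x \<ominus> z = (x \<ominus> y) \<oplus> (y \<ominus> z)"
  by algebra

lemma add_minus_cancel: "\<lbrakk>x \<in> carrier R; y \<in> carrier R\<rbrakk> \<Longrightarrow> x \<oplus> (y \<ominus> x) = y"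
  by algebra

lemma minus_minus_cancel: "\<lbrakk>x \<in> carrier R; y \<in> carrier R\<rbrakk> \<Longrightarrow> y = x \<ominus> (x \<ominus> y)"
  by algebra

text \<open>The quotient rule for commutators. If p is a fraction c / t, the commutator with p is
  the one with c = t p minus p times the one with t. Here u is the value at the argument, q the
  value at p times the argument, and w the value at the argument divided by t.\<close>

lemma commutator_eq:
  "\<lbrakk>p \<in> carrier R; u \<in> carrier R; q \<in> carrier R; t \<in> carrier R; w \<in> carrier R\<rbrakk> \<Longrightarrow>
    p \<otimes> u \<ominus> q = (t \<otimes> p \<otimes> w \<ominus> q) \<ominus> p \<otimes> (t \<otimes> w \<ominus> u)"
  by algebra

end

lemma (in algebra) smult_mult_right:
  "\<lbrakk>c \<in> carrier R; x \<in> carrier M; y \<in> carrier M\<rbrakk> \<Longrightarrow> x \<otimes>\<^bsub>M\<^esub> (c \<odot>\<^bsub>M\<^esub> y) = c \<odot>\<^bsub>M\<^esub> (x \<otimes>\<^bsub>M\<^esub> y)"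
  by (metis m_comm smult_assoc2 smult_closed)

section \<open>Linear maps and differential operators from A to an A-algebra B\<close>

locale algebra_map = A: algebra K A + B: algebra K B for K A B +
  fixes g assumes g_hom: "g \<in> alg_hom K A B"
begin

lemma g_ring_hom: "g \<in> ring_hom A B" using g_hom by (simp add: alg_hom_def)

lemmas g_closed = ring_hom_closed[OF g_ring_hom]
  and g_add = ring_hom_add[OF g_ring_hom]
  and g_mult = ring_hom_mult[OF g_ring_hom]
  and g_one = ring_hom_one[OF g_ring_hom]
  and g_zero = ring_hom_zero[OF g_ring_hom A.ring_axioms B.ring_axioms]

context
  notes [simp] = g_closed g_one g_zero
begin

lemma g_smult: "\<lbrakk>c \<in> carrier K; x \<in> carrier A\<rbrakk> \<Longrightarrow> g (c \<odot>\<^bsub>A\<^esub> x) = c \<odot>\<^bsub>B\<^esub> g x"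
  using g_hom by (simp add: alg_hom_def)

lemma g_linear: "linear_map K A B g"
  by (rule linear_mapI) (simp_all add: g_add g_smult)

abbreviation "lin \<equiv> linear_map K A B"
abbreviation "D \<equiv> diff_along A B g"
abbreviation "adg \<equiv> ad_along A B g"

lemma lin_zero: "lin \<phi> \<Longrightarrow> \<phi> \<zero>\<^bsub>A\<^esub> = \<zero>\<^bsub>B\<^esub>"
  by (metis A.M.l_zero A.M.zero_closed B.M.add.r_cancel_one' linear_mapD(1,2))

lemma lin_minus: "\<lbrakk>lin \<phi>; x \<in> carrier A\<rbrakk> \<Longrightarrow> \<phi> (\<ominus>\<^bsub>A\<^esub> x) = \<ominus>\<^bsub>B\<^esub> \<phi> x"
  using linear_map_add[of K A B \<phi> "\<ominus>\<^bsub>A\<^esub> x" x]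
  by (intro B.M.minus_equality[symmetric]) (simp_all add: lin_zero linear_map_closed A.M.l_neg)

lemma lin_diff:
  "\<lbrakk>lin \<phi>; x \<in> carrier A; y \<in> carrier A\<rbrakk> \<Longrightarrow> \<phi> (x \<ominus>\<^bsub>A\<^esub> y) = \<phi> x \<ominus>\<^bsub>B\<^esub> \<phi> y"
  by (simp add: A.M.minus_eq B.M.minus_eq lin_minus linear_mapD(2))

lemma lin_add: "\<lbrakk>lin \<phi>; lin \<psi>\<rbrakk> \<Longrightarrow> lin (\<lambda>m. \<phi> m \<oplus>\<^bsub>B\<^esub> \<psi> m)"
  by (rule linear_mapI) (simp_all add: linear_mapD B.M.a_ac B.smult_r_distr)

lemma lin_mult: "\<lbrakk>lin \<phi>; b \<in> carrier B\<rbrakk> \<Longrightarrow> lin (\<lambda>m. b \<otimes>\<^bsub>B\<^esub> \<phi> m)"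
  by (rule linear_mapI) (simp_all add: linear_mapD B.r_distr B.smult_mult_right)

lemma lin_uminus: "lin \<phi> \<Longrightarrow> lin (\<lambda>m. \<ominus>\<^bsub>B\<^esub> \<phi> m)"
  by (rule linear_mapI) (simp_all add: linear_mapD B.M.minus_add B.smult_r_minus)

lemma lin_minus_map: "\<lbrakk>lin \<phi>; lin \<psi>\<rbrakk> \<Longrightarrow> lin (\<lambda>m. \<phi> m \<ominus>\<^bsub>B\<^esub> \<psi> m)"
  unfolding B.M.minus_eq by (intro lin_add lin_uminus)

lemma lin_shift: "\<lbrakk>lin \<phi>; a \<in> carrier A\<rbrakk> \<Longrightarrow> lin (\<lambda>m. \<phi> (a \<otimes>\<^bsub>A\<^esub> m))"
  by (rule linear_mapI)
    (auto simp: linear_mapD A.r_distr A.smult_assoc2 A.m_comm[of a])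

lemma lin_ad: "\<lbrakk>lin \<phi>; a \<in> carrier A\<rbrakk> \<Longrightarrow> lin (adg a \<phi>)"
  unfolding ad_along_def by (intro lin_minus_map lin_mult lin_shift g_closed)

lemma ad_closed: "\<lbrakk>\<phi> \<in> carrier A \<rightarrow> carrier B; a \<in> carrier A\<rbrakk> \<Longrightarrow> adg a \<phi> \<in> carrier A \<rightarrow> carrier B"
  by (auto simp: ad_along_def Pi_def)

lemma D_cong: "(\<And>m. m \<in> carrier A \<Longrightarrow> \<phi> m = \<psi> m) \<Longrightarrow> D n \<phi> \<longleftrightarrow> D n \<psi>"
  by (rule diff_along_cong) (auto intro: A.monoid_axioms)

lemma D_eqI: "\<lbrakk>D n \<psi>; \<And>m. m \<in> carrier A \<Longrightarrow> \<phi> m = \<psi> m\<rbrakk> \<Longrightarrow> D n \<phi>"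
  using D_cong[of \<phi> \<psi>] by blast

lemma D_zero: "(\<And>m. m \<in> carrier A \<Longrightarrow> \<phi> m = \<zero>\<^bsub>B\<^esub>) \<Longrightarrow> D n \<phi>"
proof (induction n arbitrary: \<phi>)
  case (Suc n)
  have "adg a \<phi> m = \<zero>\<^bsub>B\<^esub>" if "a \<in> carrier A" "m \<in> carrier A" for a m
    using that by (simp add: ad_along_def Suc.prems B.M.minus_eq)
  then show ?case by (auto intro: Suc.IH)
qed simp

lemma D_Suc: "D n \<phi> \<Longrightarrow> D (Suc n) \<phi>"
proof (induction n arbitrary: \<phi>)
  case 0
  then have "adg a \<phi> m = \<zero>\<^bsub>B\<^esub>" if "a \<in> carrier A" "m \<in> carrier A" for a m
    using that by (simp add: ad_along_def B.M.minus_eq)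
  then show ?case by simp
next
  case (Suc n)
  have "D (Suc n) (adg a \<phi>)" if "a \<in> carrier A" for a
    by (rule Suc.IH) (use Suc.prems that in simp)
  then show ?case by (simp del: diff_along.simps(2) add: diff_along.simps(2)[of _ _ _ "Suc n"])
qed

lemma D_mono: "D n \<phi> \<Longrightarrow> n \<le> k \<Longrightarrow> D k \<phi>"
  by (induction k) (auto simp: le_Suc_eq simp del: diff_along.simps intro: D_Suc)

lemma D_add:
  "\<lbrakk>D n \<phi>; D n \<psi>; \<phi> \<in> carrier A \<rightarrow> carrier B; \<psi> \<in> carrier A \<rightarrow> carrier B\<rbrakk> \<Longrightarrow> D n (\<lambda>m. \<phi> m \<oplus>\<^bsub>B\<^esub> \<psi> m)"
proof (induction n arbitrary: \<phi> \<psi>)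
  case (Suc n)
  have "D n (adg a (\<lambda>m. \<phi> m \<oplus>\<^bsub>B\<^esub> \<psi> m))" if a: "a \<in> carrier A" for a
  proof -
    have "D n (\<lambda>m. adg a \<phi> m \<oplus>\<^bsub>B\<^esub> adg a \<psi> m)"
      by (rule Suc.IH) (use Suc.prems a in \<open>auto simp: ad_along_def Pi_def\<close>)
    moreover have "adg a (\<lambda>m. \<phi> m \<oplus>\<^bsub>B\<^esub> \<psi> m) m = adg a \<phi> m \<oplus>\<^bsub>B\<^esub> adg a \<psi> m" if "m \<in> carrier A" for m
    proof -
      have "g a \<in> carrier B" "\<phi> m \<in> carrier B" "\<psi> m \<in> carrier B"
        "\<phi> (a \<otimes>\<^bsub>A\<^esub> m) \<in> carrier B" "\<psi> (a \<otimes>\<^bsub>A\<^esub> m) \<in> carrier B"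
        using Suc.prems a that by auto
      then show ?thesis unfolding ad_along_def by (simp add: B.ad_add_eq)
    qed
    ultimately show ?thesis by (rule D_eqI)
  qed
  then show ?case by simp
qed (auto)

text \<open>Since B is commutative, multiplication by b can be pulled out of every
  commutator.\<close>

lemma D_mult:
  "\<lbrakk>D n \<phi>; \<phi> \<in> carrier A \<rightarrow> carrier B; b \<in> carrier B\<rbrakk> \<Longrightarrow> D n (\<lambda>m. b \<otimes>\<^bsub>B\<^esub> \<phi> m)"
proof (induction n arbitrary: \<phi>)
  case (Suc n)
  have "D n (adg a (\<lambda>m. b \<otimes>\<^bsub>B\<^esub> \<phi> m))" if a: "a \<in> carrier A" for a
  proof -
    have "D n (\<lambda>m. b \<otimes>\<^bsub>B\<^esub> adg a \<phi> m)"
      by (rule Suc.IH) (use Suc.prems a in \<open>auto simp: ad_along_def Pi_def\<close>)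
    moreover have "adg a (\<lambda>m. b \<otimes>\<^bsub>B\<^esub> \<phi> m) m = b \<otimes>\<^bsub>B\<^esub> adg a \<phi> m" if "m \<in> carrier A" for m
    proof -
      have "g a \<in> carrier B" "\<phi> m \<in> carrier B" "b \<in> carrier B" "\<phi> (a \<otimes>\<^bsub>A\<^esub> m) \<in> carrier B"
        using Suc.prems a that by auto
      then show ?thesis unfolding ad_along_def by (simp add: B.ad_mult_eq)
    qed
    ultimately show ?thesis by (rule D_eqI)
  qed
  then show ?case by simp
qed auto

lemma D_minus:
  assumes "D n \<phi>" "D n \<psi>" "\<phi> \<in> carrier A \<rightarrow> carrier B" "\<psi> \<in> carrier A \<rightarrow> carrier B"
  shows "D n (\<lambda>m. \<phi> m \<ominus>\<^bsub>B\<^esub> \<psi> m)"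
proof -
  have "D n (\<lambda>m. \<phi> m \<oplus>\<^bsub>B\<^esub> (\<ominus>\<^bsub>B\<^esub> \<one>\<^bsub>B\<^esub>) \<otimes>\<^bsub>B\<^esub> \<psi> m)"
    by (intro D_add D_mult) (use assms in auto)
  moreover have "\<phi> m \<ominus>\<^bsub>B\<^esub> \<psi> m = \<phi> m \<oplus>\<^bsub>B\<^esub> (\<ominus>\<^bsub>B\<^esub> \<one>\<^bsub>B\<^esub>) \<otimes>\<^bsub>B\<^esub> \<psi> m" if "m \<in> carrier A" for m
    by (rule B.minus_eq_mult) (use assms that in auto)
  ultimately show ?thesis by (rule D_eqI)
qed

text \<open>Precomposition with multiplication by a commutes with every commutator because A is
  commutative.\<close>

lemma D_shift:
  "\<lbrakk>D n \<phi>; a \<in> carrier A\<rbrakk> \<Longrightarrow> D n (\<lambda>m. \<phi> (a \<otimes>\<^bsub>A\<^esub> m))"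
proof (induction n arbitrary: \<phi>)
  case (Suc n)
  have "D n (adg c (\<lambda>m. \<phi> (a \<otimes>\<^bsub>A\<^esub> m)))" if c: "c \<in> carrier A" for c
  proof -
    have "D n (\<lambda>m. adg c \<phi> (a \<otimes>\<^bsub>A\<^esub> m))"
      by (rule Suc.IH) (use Suc.prems c in auto)
    moreover have "adg c (\<lambda>m. \<phi> (a \<otimes>\<^bsub>A\<^esub> m)) m = adg c \<phi> (a \<otimes>\<^bsub>A\<^esub> m)" if "m \<in> carrier A" for m
      using that c Suc.prems by (simp add: ad_along_def A.m_lcomm)
    ultimately show ?thesis by (rule D_eqI)
  qed
  then show ?case by simp
qed auto

lemma D_finsum:
  assumes "finite I" "\<And>i. i \<in> I \<Longrightarrow> \<exists>n. D n (\<phi> i)" "\<And>i. i \<in> I \<Longrightarrow> \<phi> i \<in> carrier A \<rightarrow> carrier B"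
  shows "\<exists>n. D n (\<lambda>m. finsum B (\<lambda>i. \<phi> i m) I)"
  using assms
proof (induction I)
  case empty
  show ?case by (auto intro: D_zero)
next
  case (insert i I)
  obtain n where n: "D n (\<phi> i)" using insert.prems by blast
  obtain k where k: "D k (\<lambda>m. finsum B (\<lambda>i. \<phi> i m) I)" using insert.IH insert.prems by blast
  have "D (max n k) (\<lambda>m. \<phi> i m \<oplus>\<^bsub>B\<^esub> finsum B (\<lambda>i. \<phi> i m) I)"
    using insert.prems by (intro D_add D_mono[OF n] D_mono[OF k]) (auto simp: Pi_def intro!: B.M.finsum_closed)
  then show ?case
    using insert by (subst (asm) D_cong[of _ "\<lambda>m. finsum B (\<lambda>i. \<phi> i m) (insert i I)"])
      (auto simp: Pi_def B.M.finsum_insert)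
qed

end

end

lemma (in algebra) algebra_map_id: "algebra_map R M M (\<lambda>x. x)"
  by (intro algebra_map.intro algebra_map_axioms.intro algebra_axioms)
    (simp add: alg_hom_def ring_hom_def)

text \<open>As an algebra morphism, g intertwines the commutators over A with the commutators along
  g.\<close>

lemma (in algebra_map) D_comp_g: "\<lbrakk>linear_map K A A \<phi>; diff_along A A (\<lambda>x. x) n \<phi>\<rbrakk> \<Longrightarrow> D n (\<lambda>m. g (\<phi> m))"
proof (induction n arbitrary: \<phi>)
  case (Suc n)
  interpret A_id: algebra_map K A A "\<lambda>x. x" by (rule A.algebra_map_id)
  have "D n (adg a (\<lambda>m. g (\<phi> m)))" if a: "a \<in> carrier A" for a
  proof -
    have "D n (\<lambda>m. g (A_id.adg a \<phi> m))"
      by (rule Suc.IH) (use Suc.prems a A_id.lin_ad in auto)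
    moreover have "adg a (\<lambda>m. g (\<phi> m)) m = g (A_id.adg a \<phi> m)" if "m \<in> carrier A" for m
      using that a linear_map_closed[OF Suc.prems(1)] by (simp add: ad_along_def lin_diff[OF g_linear] g_mult)
    ultimately show ?thesis by (rule D_eqI)
  qed
  then show ?case by simp
qed (simp add: g_zero)

text \<open>Leibniz rule for commutators: \<open>ad_a (\<phi> \<psi>) = (ad_a \<phi>) \<psi> +
  \<phi> (ad_a \<psi>)\<close>. Each summand lowers one of the two indices, so the induction is on
  their sum; it stops as soon as one factor is the zero map.\<close>

lemma diff_along_comp:
  assumes "algebra K B" and \<phi>: "linear_map K B B \<phi>" "diff_along B B (\<lambda>x. x) n \<phi>"
    and \<psi>: "linear_map K B B \<psi>" "diff_along B B (\<lambda>x. x) k \<psi>"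
  shows "diff_along B B (\<lambda>x. x) (n + k) (\<lambda>m. \<phi> (\<psi> m))"
proof -
  interpret algebra K B by fact
  interpret algebra_map K B B "\<lambda>x. x" by (rule algebra_map_id)
  show ?thesis
    using \<phi> \<psi>
  proof (induction "n + k" arbitrary: n k \<phi> \<psi>)
    case 0
    then show ?case using linear_map_closed[OF 0(4)] by auto
  next
    case (Suc j)
    show ?case
    proof (cases "n = 0 \<or> k = 0")
      case True
      have "\<phi> (\<psi> m) = \<zero>\<^bsub>B\<^esub>" if "m \<in> carrier B" for m
        using True
      proof
        assume "n = 0"
        then show ?thesis using Suc.prems(2) linear_map_closed[OF Suc.prems(3) that] by simp
      next
        assume "k = 0"
        then have "\<psi> m = \<zero>\<^bsub>B\<^esub>" using Suc.prems(4) that by simp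
        then show ?thesis using lin_zero[OF Suc.prems(1)] by simp
      qed
      then show ?thesis by (rule D_zero)
    next
      case False
      then obtain n' k' where nk: "n = Suc n'" "k = Suc k'" by (metis not0_implies_Suc)
      have "D j (adg a (\<lambda>m. \<phi> (\<psi> m)))" if a: "a \<in> carrier B" for a
      proof -
        have "D (n' + k) (\<lambda>m. adg a \<phi> (\<psi> m))"
          by (rule Suc.hyps) (use Suc nk a in \<open>auto intro!: lin_ad\<close>)
        moreover have "D (n + k') (\<lambda>m. \<phi> (adg a \<psi> m))"
          by (rule Suc.hyps) (use Suc nk a in \<open>auto intro!: lin_ad\<close>)
        moreover have "n' + k = j" "n + k' = j" using Suc nk by auto
        ultimately have "D j (\<lambda>m. adg a \<phi> (\<psi> m) \<oplus>\<^bsub>B\<^esub> \<phi> (adg a \<psi> m))"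
          using Suc.prems a by (intro D_add) (auto simp: ad_along_def linear_mapD)
        moreover have "adg a (\<lambda>m. \<phi> (\<psi> m)) m = adg a \<phi> (\<psi> m) \<oplus>\<^bsub>B\<^esub> \<phi> (adg a \<psi> m)"
          if "m \<in> carrier B" for m
        proof -
          have 1: "a \<in> carrier B" "\<phi> (\<psi> m) \<in> carrier B"
            "\<phi> (a \<otimes>\<^bsub>B\<^esub> \<psi> m) \<in> carrier B" "\<phi> (\<psi> (a \<otimes>\<^bsub>B\<^esub> m)) \<in> carrier B"
            using Suc.prems a that by (auto simp: linear_mapD)
          have "\<phi> (a \<otimes>\<^bsub>B\<^esub> \<psi> m \<ominus>\<^bsub>B\<^esub> \<psi> (a \<otimes>\<^bsub>B\<^esub> m)) = \<phi> (a \<otimes>\<^bsub>B\<^esub> \<psi> m) \<ominus>\<^bsub>B\<^esub> \<phi> (\<psi> (a \<otimes>\<^bsub>B\<^esub> m))"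
            using Suc.prems a that by (intro lin_diff) (auto simp: linear_mapD)
          with 1 show ?thesis unfolding ad_along_def by (simp add: minus_telescope[symmetric])
        qed
        ultimately show ?thesis by (rule D_eqI)
      qed
      then show ?thesis by (simp add: Suc.hyps(2)[symmetric])
    qed
  qed
qed

section \<open>Extension of differential operators to fractions\<close>

text \<open>These properties determine a localization up to isomorphism. Everything about operators
  is derived from them, so classes of pairs are opened only to show that \<open>comm_loc\<close> has
  these properties.\<close>

locale localization_map = algebra_map +
  fixes S
  assumes submonoid: "submonoid S A"
    and S_unit: "s \<in> S \<Longrightarrow> g s \<in> Units B"
    and ex_fraction: "x \<in> carrier B \<Longrightarrow> \<exists>s\<in>S. \<exists>a\<in>carrier A. g s \<otimes>\<^bsub>B\<^esub> x = g a"
    and ker: "\<lbrakk>a \<in> carrier A; g a = \<zero>\<^bsub>B\<^esub>\<rbrakk> \<Longrightarrow> \<exists>u\<in>S. u \<otimes>\<^bsub>A\<^esub> a = \<zero>\<^bsub>A\<^esub>"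
begin

text \<open>Two kinds of operator coexist from here on: unprefixed names refer to maps from A to B,
  names with \<open>endo\<close> to maps from B to B with commutators by all elements of B.\<close>

sublocale endo: algebra_map K B B "\<lambda>x. x"
  by (rule B.algebra_map_id)

lemma S_closed: "s \<in> S \<Longrightarrow> s \<in> carrier A"
  and S_mult: "\<lbrakk>s \<in> S; t \<in> S\<rbrakk> \<Longrightarrow> s \<otimes>\<^bsub>A\<^esub> t \<in> S"
  and S_one: "\<one>\<^bsub>A\<^esub> \<in> S"
  using submonoid by (auto simp: submonoid_def)

lemma cancel:
  "\<lbrakk>s \<in> S; x \<in> carrier B; y \<in> carrier B; g s \<otimes>\<^bsub>B\<^esub> x = g s \<otimes>\<^bsub>B\<^esub> y\<rbrakk> \<Longrightarrow> x = y"
  using S_unit B.Units_l_cancel by blast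

lemma cancel_zero: "\<lbrakk>s \<in> S; x \<in> carrier B; g s \<otimes>\<^bsub>B\<^esub> x = \<zero>\<^bsub>B\<^esub>\<rbrakk> \<Longrightarrow> x = \<zero>\<^bsub>B\<^esub>"
  using cancel[of s x "\<zero>\<^bsub>B\<^esub>"] S_closed g_closed by simp

lemma fraction_unit:
  assumes "s \<in> S" "b \<in> carrier B"
  shows "g s \<otimes>\<^bsub>B\<^esub> (inv\<^bsub>B\<^esub> (g s) \<otimes>\<^bsub>B\<^esub> b) = b"
  using assms S_unit[of s] by (simp add: B.m_assoc[symmetric] B.Units_closed)

text \<open>By definition of the commutator,
  \<open>\<phi> (s m) + adg s \<phi> m = g s \<phi> m\<close>. If \<open>\<chi>\<close> divides
  \<open>adg s \<phi>\<close> by s, then \<open>\<phi> + \<chi>\<close> takes this value at s m, and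
  multiplication by the inverse of g s gives the wanted map. The commutator has smaller order, so
  the recursion ends; it sums the geometric series of a nilpotent perturbation.\<close>

lemma ex_div:
  "\<lbrakk>lin \<phi>; D n \<phi>; s \<in> S\<rbrakk> \<Longrightarrow> \<exists>\<phi>'. lin \<phi>' \<and> D n \<phi>' \<and> (\<forall>m\<in>carrier A. \<phi>' (s \<otimes>\<^bsub>A\<^esub> m) = \<phi> m)"
proof (induction n arbitrary: \<phi>)
  case 0
  then show ?case using S_closed[of s] by (intro exI[of _ \<phi>]) simp
next
  case (Suc n)
  note s = S_closed[OF \<open>s \<in> S\<close>]
  have ad: "lin (adg s \<phi>)" "D n (adg s \<phi>)"
    using Suc.prems s lin_ad by auto
  obtain \<chi> where \<chi>: "lin \<chi>" "D n \<chi>" "\<And>m. m \<in> carrier A \<Longrightarrow> \<chi> (s \<otimes>\<^bsub>A\<^esub> m) = adg s \<phi> m"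
    using Suc.IH[OF ad \<open>s \<in> S\<close>] by blast
  let ?i = "inv\<^bsub>B\<^esub> (g s)"
  let ?\<phi> = "\<lambda>m. ?i \<otimes>\<^bsub>B\<^esub> (\<phi> m \<oplus>\<^bsub>B\<^esub> \<chi> m)"
  have i: "?i \<in> carrier B" using S_unit[OF \<open>s \<in> S\<close>] by simp
  have closed: "\<phi> m \<in> carrier B" "\<chi> m \<in> carrier B" if "m \<in> carrier A" for m
    using that Suc.prems(1) \<chi>(1) by (auto dest: linear_map_closed)
  have "lin ?\<phi>" by (intro lin_mult lin_add Suc.prems \<chi> i)
  moreover have "D (Suc n) ?\<phi>"
    by (intro D_mult D_add Suc.prems D_Suc \<chi> i) (use closed in auto)
  moreover have "?\<phi> (s \<otimes>\<^bsub>A\<^esub> m) = \<phi> m" if m: "m \<in> carrier A" for m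
  proof -
    have "\<phi> (s \<otimes>\<^bsub>A\<^esub> m) \<oplus>\<^bsub>B\<^esub> \<chi> (s \<otimes>\<^bsub>A\<^esub> m) = g s \<otimes>\<^bsub>B\<^esub> \<phi> m"
      using closed m s g_closed
      by (simp add: \<chi>(3) ad_along_def B.add_minus_cancel)
    then show ?thesis
      using closed m S_unit[OF \<open>s \<in> S\<close>] by (simp add: B.m_assoc[symmetric] B.Units_closed)
  qed
  ultimately show ?case by blast
qed

text \<open>If \<open>\<phi>\<close> vanishes on all multiples of s, so does its commutator with s,
  which is then zero by induction. Hence \<open>g s \<phi> m = \<phi> (s m) = 0\<close>, and g s is
  a unit.\<close>

lemma div_zero:
  "\<lbrakk>lin \<phi>; D n \<phi>; s \<in> S; \<And>m. m \<in> carrier A \<Longrightarrow> \<phi> (s \<otimes>\<^bsub>A\<^esub> m) = \<zero>\<^bsub>B\<^esub>; m \<in> carrier A\<rbrakk> \<Longrightarrow> \<phi> m = \<zero>\<^bsub>B\<^esub>"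
proof (induction n arbitrary: \<phi> m)
  case (Suc n)
  note s = S_closed[OF \<open>s \<in> S\<close>]
  have "adg s \<phi> m = \<zero>\<^bsub>B\<^esub>"
  proof (rule Suc.IH)
    show "adg s \<phi> (s \<otimes>\<^bsub>A\<^esub> k) = \<zero>\<^bsub>B\<^esub>" if "k \<in> carrier A" for k
      using that Suc.prems(4) s g_closed by (simp add: ad_along_def B.M.minus_eq)
  qed (use Suc.prems s lin_ad in auto)
  then have "g s \<otimes>\<^bsub>B\<^esub> \<phi> m = \<zero>\<^bsub>B\<^esub>"
    using Suc.prems s g_closed linear_map_closed[OF Suc.prems(1)]
    by (simp add: ad_along_def B.M.minus_eq)
  then show ?case
    using cancel_zero Suc.prems linear_map_closed[OF Suc.prems(1)] by blast
qed simp

lemma div_unique: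
  assumes "lin \<phi>" "D n \<phi>" "lin \<psi>" "D n \<psi>" "s \<in> S"
    and "\<And>m. m \<in> carrier A \<Longrightarrow> \<phi> (s \<otimes>\<^bsub>A\<^esub> m) = \<psi> (s \<otimes>\<^bsub>A\<^esub> m)" and "m \<in> carrier A"
  shows "\<phi> m = \<psi> m"
proof -
  note cl = linear_map_closed[OF assms(1)] linear_map_closed[OF assms(3)]
  have "\<phi> m \<ominus>\<^bsub>B\<^esub> \<psi> m = \<zero>\<^bsub>B\<^esub>"
  proof (rule div_zero[of "\<lambda>m. \<phi> m \<ominus>\<^bsub>B\<^esub> \<psi> m" n s])
    show "lin (\<lambda>m. \<phi> m \<ominus>\<^bsub>B\<^esub> \<psi> m)" by (intro lin_minus_map assms)
    show "D n (\<lambda>m. \<phi> m \<ominus>\<^bsub>B\<^esub> \<psi> m)" by (intro D_minus assms) (use cl in auto)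
    show "\<phi> (s \<otimes>\<^bsub>A\<^esub> k) \<ominus>\<^bsub>B\<^esub> \<psi> (s \<otimes>\<^bsub>A\<^esub> k) = \<zero>\<^bsub>B\<^esub>" if "k \<in> carrier A" for k
      using that assms(5,6) cl S_closed by simp
  qed (use assms in auto)
  then show ?thesis using cl assms(7) by simp
qed

text \<open>Some u in S annihilates c. If \<open>\<phi>'\<close> divides \<open>\<phi>\<close> by u,
  then \<open>\<phi> c = \<phi>' (u c) = \<phi>' 0 = 0\<close>.\<close>

lemma zero_on_ker:
  assumes "lin \<phi>" "D n \<phi>" "c \<in> carrier A" "g c = \<zero>\<^bsub>B\<^esub>"
  shows "\<phi> c = \<zero>\<^bsub>B\<^esub>"
proof -
  obtain u where u: "u \<in> S" "u \<otimes>\<^bsub>A\<^esub> c = \<zero>\<^bsub>A\<^esub>" using ker assms by blast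
  obtain \<phi>' where \<phi>': "lin \<phi>'" "\<And>m. m \<in> carrier A \<Longrightarrow> \<phi>' (u \<otimes>\<^bsub>A\<^esub> m) = \<phi> m"
    using ex_div[OF assms(1,2) u(1)] by blast
  show ?thesis using \<phi>'(2)[OF assms(3)] u lin_zero[OF \<phi>'(1)] by simp
qed

text \<open>The rigidity behind all transfers from numerators to fractions. With x = a / s, the
  commutator with g s again vanishes on numerators and is zero by induction, so
  \<open>g s \<psi> x = \<psi> (g s x) = \<psi> (g a) = 0\<close>.\<close>

lemma vanish_on_image:
  "\<lbrakk>endo.D n \<psi>; \<psi> \<in> carrier B \<rightarrow> carrier B; \<And>a. a \<in> carrier A \<Longrightarrow> \<psi> (g a) = \<zero>\<^bsub>B\<^esub>; x \<in> carrier B\<rbrakk> \<Longrightarrow> \<psi> x = \<zero>\<^bsub>B\<^esub>"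
proof (induction n arbitrary: \<psi> x)
  case (Suc n)
  obtain s a where sa: "s \<in> S" "a \<in> carrier A" "g s \<otimes>\<^bsub>B\<^esub> x = g a"
    using ex_fraction Suc.prems by blast
  have s: "s \<in> carrier A" "g s \<in> carrier B" using sa S_closed g_closed by auto
  have "endo.adg (g s) \<psi> x = \<zero>\<^bsub>B\<^esub>"
  proof (rule Suc.IH[of "endo.adg (g s) \<psi>" x])
    show "endo.adg (g s) \<psi> (g b) = \<zero>\<^bsub>B\<^esub>" if "b \<in> carrier A" for b
      using that s Suc.prems(3) by (simp add: ad_along_def g_mult[symmetric] B.M.minus_eq)
  qed (use Suc.prems s in \<open>auto simp: ad_along_def\<close>)
  then have "g s \<otimes>\<^bsub>B\<^esub> \<psi> x = \<zero>\<^bsub>B\<^esub>"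
    using Suc.prems sa s funcset_mem[OF Suc.prems(2)] by (simp add: ad_along_def B.M.minus_eq)
  then show ?case using cancel_zero sa funcset_mem[OF Suc.prems(2)] Suc.prems(4) by blast
qed simp

lemma eq_if_eq_on_image:
  assumes "endo.D n \<phi>" "endo.D k \<psi>" "\<phi> \<in> carrier B \<rightarrow> carrier B" "\<psi> \<in> carrier B \<rightarrow> carrier B"
    and "\<And>a. a \<in> carrier A \<Longrightarrow> \<phi> (g a) = \<psi> (g a)" and "x \<in> carrier B"
  shows "\<phi> x = \<psi> x"
proof -
  have "\<phi> x \<ominus>\<^bsub>B\<^esub> \<psi> x = \<zero>\<^bsub>B\<^esub>"
  proof (rule vanish_on_image[of "max n k" "\<lambda>x. \<phi> x \<ominus>\<^bsub>B\<^esub> \<psi> x"])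
    show "endo.D (max n k) (\<lambda>x. \<phi> x \<ominus>\<^bsub>B\<^esub> \<psi> x)"
      by (intro endo.D_minus endo.D_mono[OF assms(1)] endo.D_mono[OF assms(2)] assms) auto
    show "\<phi> (g a) \<ominus>\<^bsub>B\<^esub> \<psi> (g a) = \<zero>\<^bsub>B\<^esub>" if "a \<in> carrier A" for a
      using that assms(4,5) g_closed by (auto simp: Pi_def)
  qed (use assms in auto)
  then show ?thesis
    using funcset_mem[OF assms(3,6)] funcset_mem[OF assms(4,6)] by simp
qed

text \<open>Reduces commutators with arbitrary fractions to commutators with elements of A. All
  translates by y are included so that the base case, at m = 1, reaches every point of B.\<close>

lemma D_along_imp_D:
  "\<lbrakk>\<psi> \<in> carrier B \<rightarrow> carrier B; \<And>y. y \<in> carrier B \<Longrightarrow> D n (\<lambda>m. \<psi> (g m \<otimes>\<^bsub>B\<^esub> y))\<rbrakk> \<Longrightarrow> endo.D n \<psi>"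
proof (induction n arbitrary: \<psi>)
  case 0
  then have "\<psi> (g \<one>\<^bsub>A\<^esub> \<otimes>\<^bsub>B\<^esub> y) = \<zero>\<^bsub>B\<^esub>" if "y \<in> carrier B" for y
    using that unfolding diff_along.simps by blast
  then show ?case by (simp add: g_one)
next
  case (Suc n)
  have "endo.D n (endo.adg z \<psi>)" if z: "z \<in> carrier B" for z
  proof (rule Suc.IH)
    show "endo.adg z \<psi> \<in> carrier B \<rightarrow> carrier B"
      using Suc.prems(1) z by (auto simp: ad_along_def)
    fix y assume y: "y \<in> carrier B"
    obtain t c where tc: "t \<in> S" "c \<in> carrier A" "g t \<otimes>\<^bsub>B\<^esub> z = g c"
      using ex_fraction z by blast
    have t: "t \<in> carrier A" "g t \<in> carrier B" "g c \<in> carrier B" using tc S_closed g_closed by auto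
    \<comment> \<open>Dividing y by the denominator t of z = c / t makes both commutators below land
      on the right points: \<open>c m y' = z m y\<close> and \<open>t m y' = m y\<close>.\<close>
    define y' where "y' = inv\<^bsub>B\<^esub> (g t) \<otimes>\<^bsub>B\<^esub> y"
    have y': "y' \<in> carrier B" "g t \<otimes>\<^bsub>B\<^esub> y' = y"
      using y tc fraction_unit[of t y] S_unit[of t] by (auto simp: y'_def)
    let ?f = "\<lambda>m. \<psi> (g m \<otimes>\<^bsub>B\<^esub> y')"
    have f: "?f \<in> carrier A \<rightarrow> carrier B" using Suc.prems(1) y' g_closed by auto
    have "D n (\<lambda>m. adg c ?f m \<ominus>\<^bsub>B\<^esub> z \<otimes>\<^bsub>B\<^esub> adg t ?f m)"
      by (intro D_minus D_mult) (use Suc.prems(2)[OF y'(1)] t tc f z funcset_mem[OF ad_closed[OF f t(1)]] funcset_mem[OF ad_closed[OF f tc(2)]] in \<open>auto intro!: ad_closed\<close>)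
    then show "D n (\<lambda>m. endo.adg z \<psi> (g m \<otimes>\<^bsub>B\<^esub> y))"
    proof (rule D_eqI)
      fix m assume m: "m \<in> carrier A"
      then have gm: "g m \<in> carrier B" using g_closed by simp
      have 1: "g t \<otimes>\<^bsub>B\<^esub> g m \<otimes>\<^bsub>B\<^esub> y' = g m \<otimes>\<^bsub>B\<^esub> y"
        using y' gm t by (simp add: B.m_assoc B.m_lcomm)
      have 2: "g c \<otimes>\<^bsub>B\<^esub> g m \<otimes>\<^bsub>B\<^esub> y' = z \<otimes>\<^bsub>B\<^esub> (g m \<otimes>\<^bsub>B\<^esub> y)"
        using y'(1) gm t z unfolding y'(2)[symmetric] tc(3)[symmetric] by (simp add: B.m_ac)
      have cl: "\<psi> (g m \<otimes>\<^bsub>B\<^esub> y') \<in> carrier B" "\<psi> (g m \<otimes>\<^bsub>B\<^esub> y) \<in> carrier B"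
          "\<psi> (z \<otimes>\<^bsub>B\<^esub> (g m \<otimes>\<^bsub>B\<^esub> y)) \<in> carrier B"
        using Suc.prems(1) gm y y' z by auto
      have e: "p \<otimes>\<^bsub>B\<^esub> u \<ominus>\<^bsub>B\<^esub> q = (q' \<otimes>\<^bsub>B\<^esub> p \<otimes>\<^bsub>B\<^esub> w \<ominus>\<^bsub>B\<^esub> q) \<ominus>\<^bsub>B\<^esub> p \<otimes>\<^bsub>B\<^esub> (q' \<otimes>\<^bsub>B\<^esub> w \<ominus>\<^bsub>B\<^esub> u)"
        if "p \<in> carrier B" "u \<in> carrier B" "q \<in> carrier B" "q' \<in> carrier B" "w \<in> carrier B" for p u q q' w
        using that by (rule B.commutator_eq)
      show "endo.adg z \<psi> (g m \<otimes>\<^bsub>B\<^esub> y) = adg c ?f m \<ominus>\<^bsub>B\<^esub> z \<otimes>\<^bsub>B\<^esub> adg t ?f m"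
        unfolding ad_along_def using m t tc 1 2 cl z
        by (simp add: g_mult e[of z "\<psi> (g m \<otimes>\<^bsub>B\<^esub> y)" "\<psi> (z \<otimes>\<^bsub>B\<^esub> (g m \<otimes>\<^bsub>B\<^esub> y))" "g t" "\<psi> (g m \<otimes>\<^bsub>B\<^esub> y')"])
    qed
  qed
  then show ?case by simp
qed

lemma common_denominator:
  assumes "x \<in> carrier B" "y \<in> carrier B"
  shows "\<exists>s\<in>S. \<exists>a\<in>carrier A. \<exists>b\<in>carrier A. g s \<otimes>\<^bsub>B\<^esub> x = g a \<and> g s \<otimes>\<^bsub>B\<^esub> y = g b"
proof -
  obtain s a where s: "s \<in> S" "a \<in> carrier A" "g s \<otimes>\<^bsub>B\<^esub> x = g a" using ex_fraction assms by blast
  obtain t b where t: "t \<in> S" "b \<in> carrier A" "g t \<otimes>\<^bsub>B\<^esub> y = g b" using ex_fraction assms by blast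
  have cl: "s \<in> carrier A" "t \<in> carrier A" "g s \<in> carrier B" "g t \<in> carrier B"
    using s t S_closed g_closed by auto
  have 1: "g (s \<otimes>\<^bsub>A\<^esub> t) \<otimes>\<^bsub>B\<^esub> x = g (t \<otimes>\<^bsub>A\<^esub> a)"
    using cl s assms by (simp add: g_mult s(3)[symmetric] B.m_ac)
  have 2: "g (s \<otimes>\<^bsub>A\<^esub> t) \<otimes>\<^bsub>B\<^esub> y = g (s \<otimes>\<^bsub>A\<^esub> b)"
    using cl t assms by (simp add: g_mult t(3)[symmetric] B.m_ac)
  show ?thesis
    by (rule bexI[OF _ S_mult[OF s(1) t(1)]], rule bexI[of _ "t \<otimes>\<^bsub>A\<^esub> a"], rule bexI[of _ "s \<otimes>\<^bsub>A\<^esub> b"])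
       (use 1 2 cl s t in auto)
qed

text \<open>A differential operator \<open>\<phi>\<close> can be divided by every \<open>s \<in> S\<close>, and the extension to fractions
  maps \<open>a / s\<close> to \<open>\<phi>' a\<close> where \<open>\<phi>' (s m) = \<phi> m\<close> for all \<open>m\<close>.\<close>

lemma ex_extension:
  assumes \<phi>: "lin \<phi>" "D n \<phi>"
  shows "\<exists>\<psi>. endo.lin \<psi> \<and> endo.D n \<psi> \<and> (\<forall>a\<in>carrier A. \<psi> (g a) = \<phi> a)"
proof -
  define Q where "Q s \<phi>' \<longleftrightarrow> lin \<phi>' \<and> D n \<phi>' \<and> (\<forall>m\<in>carrier A. \<phi>' (s \<otimes>\<^bsub>A\<^esub> m) = \<phi> m)" for s \<phi>'
  have exQ: "\<exists>\<phi>'. Q s \<phi>'" if "s \<in> S" for s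
    unfolding Q_def by (rule ex_div) (use \<phi> that in auto)
  \<comment> \<open>Two presentations a / s and b / t of x. Dividing \<open>\<phi>'\<close> by t
    gives a map \<open>\<chi>\<close> that is \<open>\<phi>\<close> divided by s t; its translate by
    s is \<open>\<phi>''\<close> by uniqueness. As t a - s b lies in the kernel of g,
    \<open>\<phi>' a = \<chi> (t a) = \<chi> (s b) = \<phi>'' b\<close>.\<close>
  have wd: "\<phi>' a = \<phi>'' b"
    if st: "s \<in> S" "t \<in> S" and ab: "a \<in> carrier A" "b \<in> carrier A"
      and x: "x \<in> carrier B" "g s \<otimes>\<^bsub>B\<^esub> x = g a" "g t \<otimes>\<^bsub>B\<^esub> x = g b"
      and q: "Q s \<phi>'" "Q t \<phi>''" for s t a b x \<phi>' \<phi>''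
  proof -
    have cl: "s \<in> carrier A" "t \<in> carrier A" "g s \<in> carrier B" "g t \<in> carrier B"
      using st S_closed g_closed by auto
    obtain \<chi> where \<chi>: "lin \<chi>" "D n \<chi>" "\<And>m. m \<in> carrier A \<Longrightarrow> \<chi> (t \<otimes>\<^bsub>A\<^esub> m) = \<phi>' m"
      using ex_div[of \<phi>' n t] q st by (auto simp: Q_def)
    have \<chi>s: "\<chi> (s \<otimes>\<^bsub>A\<^esub> m) = \<phi>'' m" if "m \<in> carrier A" for m
    proof (rule div_unique[of "\<lambda>m. \<chi> (s \<otimes>\<^bsub>A\<^esub> m)" n \<phi>'' t])
      show "\<chi> (s \<otimes>\<^bsub>A\<^esub> (t \<otimes>\<^bsub>A\<^esub> k)) = \<phi>'' (t \<otimes>\<^bsub>A\<^esub> k)" if "k \<in> carrier A" for k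
        using that q cl \<chi>(3)[of "s \<otimes>\<^bsub>A\<^esub> k"] by (simp add: Q_def A.m_lcomm)
    qed (use lin_shift D_shift \<chi> cl q st that in \<open>auto simp: Q_def\<close>)
    have "g (t \<otimes>\<^bsub>A\<^esub> a) = g (s \<otimes>\<^bsub>A\<^esub> b)"
      using cl ab x(1) by (simp add: g_mult x(2,3)[symmetric] B.m_lcomm)
    then have "g (t \<otimes>\<^bsub>A\<^esub> a \<ominus>\<^bsub>A\<^esub> s \<otimes>\<^bsub>A\<^esub> b) = \<zero>\<^bsub>B\<^esub>"
      using cl ab g_closed by (simp add: lin_diff[OF g_linear])
    then have "\<chi> (t \<otimes>\<^bsub>A\<^esub> a \<ominus>\<^bsub>A\<^esub> s \<otimes>\<^bsub>A\<^esub> b) = \<zero>\<^bsub>B\<^esub>"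
      using zero_on_ker[OF \<chi>(1,2)] cl ab by simp
    then have "\<chi> (t \<otimes>\<^bsub>A\<^esub> a) = \<chi> (s \<otimes>\<^bsub>A\<^esub> b)"
      using cl ab linear_map_closed[OF \<chi>(1)] by (simp add: lin_diff[OF \<chi>(1)])
    then show ?thesis using \<chi>(3)[OF ab(1)] \<chi>s[OF ab(2)] by simp
  qed
  define P where "P x y \<longleftrightarrow> (\<exists>s\<in>S. \<exists>a\<in>carrier A. \<exists>\<phi>'. g s \<otimes>\<^bsub>B\<^esub> x = g a \<and> Q s \<phi>' \<and> y = \<phi>' a)" for x y
  define \<psi> where "\<psi> x = (SOME y. P x y)" for x
  have \<psi>: "\<psi> x = \<phi>' a"
    if "s \<in> S" "a \<in> carrier A" "x \<in> carrier B" "g s \<otimes>\<^bsub>B\<^esub> x = g a" "Q s \<phi>'" for s a x \<phi>'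
  proof -
    have "P x (\<phi>' a)" using that by (auto simp: P_def)
    then have "P x (\<psi> x)" unfolding \<psi>_def by (rule someI)
    then obtain t b \<phi>'' where t: "t \<in> S" "b \<in> carrier A" "g t \<otimes>\<^bsub>B\<^esub> x = g b" "Q t \<phi>''"
        and "\<psi> x = \<phi>'' b"
      unfolding P_def by blast
    then show ?thesis
      using wd[OF that(1) t(1) that(2) t(2) that(3,4) t(3) that(5) t(4)] by simp
  qed
  have lin: "endo.lin \<psi>"
  proof (rule linear_mapI)
    fix x assume x: "x \<in> carrier B"
    obtain s a \<phi>' where s: "s \<in> S" "a \<in> carrier A" "g s \<otimes>\<^bsub>B\<^esub> x = g a" "Q s \<phi>'"
      using ex_fraction[OF x] exQ by blast
    note l = s(4)[unfolded Q_def, THEN conjunct1]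
    have "\<psi> x = \<phi>' a" using \<psi> s x by blast
    then show "\<psi> x \<in> carrier B" using linear_map_closed[OF l] s by simp
    fix c assume c: "c \<in> carrier K"
    have "g s \<otimes>\<^bsub>B\<^esub> (c \<odot>\<^bsub>B\<^esub> x) = g (c \<odot>\<^bsub>A\<^esub> a)"
      using s c x S_closed g_closed by (simp add: B.smult_mult_right g_smult)
    then have "\<psi> (c \<odot>\<^bsub>B\<^esub> x) = \<phi>' (c \<odot>\<^bsub>A\<^esub> a)" using \<psi> s x c by blast
    then show "\<psi> (c \<odot>\<^bsub>B\<^esub> x) = c \<odot>\<^bsub>B\<^esub> \<psi> x"
      using \<open>\<psi> x = \<phi>' a\<close> linear_map_smult[OF l] s c by simp
  next
    fix x y assume xy: "x \<in> carrier B" "y \<in> carrier B"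
    obtain s a b \<phi>' where s: "s \<in> S" "a \<in> carrier A" "b \<in> carrier A"
        "g s \<otimes>\<^bsub>B\<^esub> x = g a" "g s \<otimes>\<^bsub>B\<^esub> y = g b" "Q s \<phi>'"
      using common_denominator[OF xy] exQ by blast
    note l = s(6)[unfolded Q_def, THEN conjunct1]
    have "\<psi> x = \<phi>' a" "\<psi> y = \<phi>' b" using \<psi> s xy by blast+
    moreover have "g s \<otimes>\<^bsub>B\<^esub> (x \<oplus>\<^bsub>B\<^esub> y) = g (a \<oplus>\<^bsub>A\<^esub> b)"
      using s xy S_closed g_closed by (simp add: B.r_distr g_add)
    then have "\<psi> (x \<oplus>\<^bsub>B\<^esub> y) = \<phi>' (a \<oplus>\<^bsub>A\<^esub> b)"
      by (intro \<psi>[OF s(1) _ _ _ s(6)]) (use s xy in auto)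
    ultimately show "\<psi> (x \<oplus>\<^bsub>B\<^esub> y) = \<psi> x \<oplus>\<^bsub>B\<^esub> \<psi> y"
      using linear_map_add[OF l] s by simp
  qed
  moreover have "endo.D n \<psi>"
  proof (rule D_along_imp_D)
    show "\<psi> \<in> carrier B \<rightarrow> carrier B" using linear_map_closed[OF lin] by blast
    fix y assume y: "y \<in> carrier B"
    obtain s b \<phi>' where s: "s \<in> S" "b \<in> carrier A" "g s \<otimes>\<^bsub>B\<^esub> y = g b" "Q s \<phi>'"
      using ex_fraction[OF y] exQ by blast
    \<comment> \<open>For y = b / s, the translate of \<open>\<psi>\<close> by y sends m to
      \<open>\<phi>' (b m)\<close>, so it is a shift of an operator of the same order.\<close>
    have "D n (\<lambda>m. \<phi>' (b \<otimes>\<^bsub>A\<^esub> m))" using s by (intro D_shift) (auto simp: Q_def)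
    then show "D n (\<lambda>m. \<psi> (g m \<otimes>\<^bsub>B\<^esub> y))"
    proof (rule D_eqI)
      fix m assume m: "m \<in> carrier A"
      have "g s \<otimes>\<^bsub>B\<^esub> (g m \<otimes>\<^bsub>B\<^esub> y) = g (b \<otimes>\<^bsub>A\<^esub> m)"
        using s y m S_closed g_closed by (simp add: g_mult s(3)[symmetric] B.m_ac)
      then show "\<psi> (g m \<otimes>\<^bsub>B\<^esub> y) = \<phi>' (b \<otimes>\<^bsub>A\<^esub> m)"
        by (intro \<psi>[OF s(1) _ _ _ s(4)]) (use s y m g_closed in auto)
    qed
  qed
  moreover have "\<psi> (g a) = \<phi> a" if a: "a \<in> carrier A" for a
  proof -
    have "Q \<one>\<^bsub>A\<^esub> \<phi>" using \<phi> by (simp add: Q_def)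
    then show ?thesis
      by (rule \<psi>[OF S_one, rotated -1]) (use a g_closed in \<open>auto simp: g_one\<close>)
  qed
  ultimately show ?thesis by blast
qed

end

lemma linear_map_cong:
  "\<lbrakk>algebra K A; linear_map K A B \<psi>; \<And>m. m \<in> carrier A \<Longrightarrow> \<phi> m = \<psi> m\<rbrakk> \<Longrightarrow> linear_map K A B \<phi>"
proof -
  assume "algebra K A" then interpret algebra K A .
  show "linear_map K A B \<psi> \<Longrightarrow> (\<And>m. m \<in> carrier A \<Longrightarrow> \<phi> m = \<psi> m) \<Longrightarrow> linear_map K A B \<phi>"
    by (auto simp: linear_map_def)
qed

lemma bidiff_op_iff:
  "bidiff_op K A k\<^sub>1 k\<^sub>2 C \<longleftrightarrow>
    (\<forall>b\<in>carrier A. linear_map K A A (\<lambda>a. C a b) \<and> diff_along A A (\<lambda>x. x) (Suc k\<^sub>1) (\<lambda>a. C a b)) \<and>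
    (\<forall>a\<in>carrier A. linear_map K A A (C a) \<and> diff_along A A (\<lambda>x. x) (Suc k\<^sub>2) (C a))"
  by (simp only: bidiff_op_def diff_op_iff)

section \<open>Extension of bidifferential operators, one argument at a time\<close>

context localization_map
begin

text \<open>Commutators in the second argument combine values of F at the same x linearly, so they
  stay differential in x. After k of them the result vanishes for numerators x and hence, by
  rigidity, for all x. The source Y is general because it is A in the first application and B in the
  second.\<close>

lemma partial_D:
  assumes "algebra_map K Y B h"
    and "\<And>b. b \<in> carrier Y \<Longrightarrow> (\<lambda>x. F x b) \<in> carrier B \<rightarrow> carrier B"
    and "\<And>b. b \<in> carrier Y \<Longrightarrow> endo.D n (\<lambda>x. F x b)"
    and "\<And>a. a \<in> carrier A \<Longrightarrow> diff_along Y B h k (F (g a))"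
    and "x \<in> carrier B"
  shows "diff_along Y B h k (F x)"
proof -
  interpret Y: algebra_map K Y B h by fact
  show ?thesis
    using assms(2-5)
  proof (induction k arbitrary: F)
    case 0
    have "F x b = \<zero>\<^bsub>B\<^esub>" if b: "b \<in> carrier Y" for b
      by (rule vanish_on_image[OF 0(2)[OF b] 0(1)[OF b]]) (use 0 b in auto)
    then show ?case by simp
  next
    case (Suc k)
    have "Y.D k (Y.adg c (F x))" if c: "c \<in> carrier Y" for c
    proof (rule Suc.IH[of "\<lambda>x. Y.adg c (F x)"])
      fix b assume b: "b \<in> carrier Y"
      have cb: "c \<otimes>\<^bsub>Y\<^esub> b \<in> carrier Y" "h c \<in> carrier B" using b c Y.g_closed by auto
      note cl = Suc.prems(1)[OF b] Suc.prems(1)[OF cb(1)]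
      have cl': "(\<lambda>x. h c \<otimes>\<^bsub>B\<^esub> F x b) \<in> carrier B \<rightarrow> carrier B" using cl cb by auto
      show "(\<lambda>x. Y.adg c (F x) b) \<in> carrier B \<rightarrow> carrier B"
        using cl cl' by (auto simp: ad_along_def Pi_def)
      show "endo.D n (\<lambda>x. Y.adg c (F x) b)"
        unfolding ad_along_def by (intro endo.D_minus endo.D_mult Suc.prems cl cl' b cb)
    next
      fix a assume "a \<in> carrier A"
      then show "Y.D k (Y.adg c (F (g a)))" using Suc.prems(3) c by simp
    qed (rule Suc.prems)
    then show ?case by simp
  qed
qed

text \<open>Turns scalars into elements of B, so that \<open>endo.D_mult\<close> covers scalar
  multiplication too.\<close>

lemma smult_eq_mult: "\<lbrakk>c \<in> carrier K; x \<in> carrier B\<rbrakk> \<Longrightarrow> c \<odot>\<^bsub>B\<^esub> x = (c \<odot>\<^bsub>B\<^esub> \<one>\<^bsub>B\<^esub>) \<otimes>\<^bsub>B\<^esub> x"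
  by (simp add: B.smult_assoc2)

text \<open>For fixed second arguments, additivity and homogeneity are equations between
  differential operators in x; they hold at numerators, hence everywhere.\<close>

lemma partial_linear:
  assumes "algebra K Y"
    and F: "\<And>b. b \<in> carrier Y \<Longrightarrow> (\<lambda>x. F x b) \<in> carrier B \<rightarrow> carrier B"
    and D: "\<And>b. b \<in> carrier Y \<Longrightarrow> endo.D n (\<lambda>x. F x b)"
    and lin: "\<And>a. a \<in> carrier A \<Longrightarrow> linear_map K Y B (F (g a))"
    and x: "x \<in> carrier B"
  shows "linear_map K Y B (F x)"
proof -
  interpret Y: algebra K Y by fact
  note F' = funcset_mem[OF F]
  show ?thesis
  proof (rule linear_mapI)
    show "F x b \<in> carrier B" if "b \<in> carrier Y" for b using F'[OF that x] .
    show "F x (b \<oplus>\<^bsub>Y\<^esub> b') = F x b \<oplus>\<^bsub>B\<^esub> F x b'" if "b \<in> carrier Y" "b' \<in> carrier Y" for b b'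
    proof (rule eq_if_eq_on_image[OF _ _ _ _ _ x])
      show "endo.D n (\<lambda>x. F x (b \<oplus>\<^bsub>Y\<^esub> b'))" using D that by simp
      show "endo.D n (\<lambda>x. F x b \<oplus>\<^bsub>B\<^esub> F x b')" using D F that by (intro endo.D_add)
      show "F (g a) (b \<oplus>\<^bsub>Y\<^esub> b') = F (g a) b \<oplus>\<^bsub>B\<^esub> F (g a) b'" if "a \<in> carrier A" for a
        using linear_map_add[OF lin[OF that]] \<open>b \<in> carrier Y\<close> \<open>b' \<in> carrier Y\<close> by simp
    qed (use F' that in auto)
    show "F x (c \<odot>\<^bsub>Y\<^esub> b) = c \<odot>\<^bsub>B\<^esub> F x b" if c: "c \<in> carrier K" "b \<in> carrier Y" for c b
    proof (rule eq_if_eq_on_image[OF _ _ _ _ _ x])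
      show "endo.D n (\<lambda>x. F x (c \<odot>\<^bsub>Y\<^esub> b))" using D that by simp
      have "endo.D n (\<lambda>x. (c \<odot>\<^bsub>B\<^esub> \<one>\<^bsub>B\<^esub>) \<otimes>\<^bsub>B\<^esub> F x b)"
        using c by (intro endo.D_mult D F) auto
      then show "endo.D n (\<lambda>x. c \<odot>\<^bsub>B\<^esub> F x b)"
        by (rule endo.D_eqI) (use F' c in \<open>auto simp: smult_eq_mult[symmetric]\<close>)
      show "F (g a) (c \<odot>\<^bsub>Y\<^esub> b) = c \<odot>\<^bsub>B\<^esub> F (g a) b" if "a \<in> carrier A" for a
        using linear_map_smult[OF lin[OF that]] c by simp
    qed (use F' that in auto)
  qed
qed

text \<open>Extending in the first argument yields maps \<open>E1 b\<close> chosen for each b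
  separately, with no control over the dependence on b. \<open>partial_linear\<close> and
  \<open>partial_D\<close> recover it, which permits the extension in the second argument; the same
  two lemmas with exchanged roles then restore the regularity in the first.\<close>

lemma ex_bidiff_extension:
  assumes C: "bidiff_op K A k\<^sub>1 k\<^sub>2 C"
  shows "\<exists>E. bidiff_op K B k\<^sub>1 k\<^sub>2 E \<and> (\<forall>a\<in>carrier A. \<forall>b\<in>carrier A. g (C a b) = E (g a) (g b))"
proof -
  note C = C[unfolded bidiff_op_iff]
  have C1: "lin (\<lambda>a. g (C a b))" "D (Suc k\<^sub>1) (\<lambda>a. g (C a b))" if "b \<in> carrier A" for b
    by (rule linear_map_comp[OF _ g_linear], use C that in blast)
      (rule D_comp_g; use C that in blast)
  have C2: "lin (\<lambda>b. g (C a b))" "D (Suc k\<^sub>2) (\<lambda>b. g (C a b))" if "a \<in> carrier A" for a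
    by (rule linear_map_comp[OF _ g_linear], use C that in blast)
      (rule D_comp_g; use C that in blast)
  have "\<forall>b\<in>carrier A. \<exists>\<psi>. endo.lin \<psi> \<and> endo.D (Suc k\<^sub>1) \<psi> \<and> (\<forall>a\<in>carrier A. \<psi> (g a) = g (C a b))"
    by (intro ballI ex_extension C1)
  from bchoice[OF this] obtain E1 where "\<forall>b\<in>carrier A. endo.lin (E1 b) \<and> endo.D (Suc k\<^sub>1) (E1 b) \<and>
      (\<forall>a\<in>carrier A. E1 b (g a) = g (C a b))" ..
  then have E1: "\<And>b. b \<in> carrier A \<Longrightarrow> endo.lin (E1 b)"
      "\<And>b. b \<in> carrier A \<Longrightarrow> endo.D (Suc k\<^sub>1) (E1 b)"
      "\<And>a b. \<lbrakk>b \<in> carrier A; a \<in> carrier A\<rbrakk> \<Longrightarrow> E1 b (g a) = g (C a b)"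
    by blast+
  have E1_cl: "E1 b \<in> carrier B \<rightarrow> carrier B" if "b \<in> carrier A" for b
    using linear_map_closed[OF E1(1)[OF that]] by blast
  have E1_lin: "lin (\<lambda>b. E1 b x)" if x: "x \<in> carrier B" for x
  proof (rule partial_linear[OF A.algebra_axioms _ _ _ x, of "\<lambda>x b. E1 b x" "Suc k\<^sub>1"])
    show "lin (\<lambda>b. E1 b (g a))" if "a \<in> carrier A" for a
      by (rule linear_map_cong[OF A.algebra_axioms C2(1)[OF that]]) (simp add: E1(3) that)
  qed (use E1 E1_cl in auto)
  have E1_D: "D (Suc k\<^sub>2) (\<lambda>b. E1 b x)" if x: "x \<in> carrier B" for x
  proof (rule partial_D[OF algebra_map_axioms _ _ _ x, of "\<lambda>x b. E1 b x" "Suc k\<^sub>1"])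
    show "D (Suc k\<^sub>2) (\<lambda>b. E1 b (g a))" if "a \<in> carrier A" for a
      by (rule D_eqI[OF C2(2)[OF that]]) (simp add: E1(3) that)
  qed (use E1 E1_cl in \<open>simp_all del: diff_along.simps\<close>)
  have "\<forall>x\<in>carrier B. \<exists>\<psi>. endo.lin \<psi> \<and> endo.D (Suc k\<^sub>2) \<psi> \<and> (\<forall>b\<in>carrier A. \<psi> (g b) = E1 b x)"
    using E1_lin E1_D by (intro ballI ex_extension)
  from bchoice[OF this] obtain E where "\<forall>x\<in>carrier B. endo.lin (E x) \<and> endo.D (Suc k\<^sub>2) (E x) \<and>
      (\<forall>b\<in>carrier A. E x (g b) = E1 b x)" ..
  then have E: "\<And>x. x \<in> carrier B \<Longrightarrow> endo.lin (E x)"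
      "\<And>x. x \<in> carrier B \<Longrightarrow> endo.D (Suc k\<^sub>2) (E x)"
      "\<And>x b. \<lbrakk>x \<in> carrier B; b \<in> carrier A\<rbrakk> \<Longrightarrow> E x (g b) = E1 b x"
    by blast+
  have E_cl: "E x \<in> carrier B \<rightarrow> carrier B" if "x \<in> carrier B" for x
    using linear_map_closed[OF E(1)[OF that]] by blast
  have E_lin: "endo.lin (\<lambda>x. E x y)" if y: "y \<in> carrier B" for y
  proof (rule partial_linear[OF B.algebra_axioms _ _ _ y, of "\<lambda>y x. E x y" "Suc k\<^sub>2"])
    show "endo.lin (\<lambda>x. E x (g b))" if "b \<in> carrier A" for b
      by (rule linear_map_cong[OF B.algebra_axioms E1(1)[OF that]]) (simp add: E(3) that)
  qed (use E E_cl in auto)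
  have E_D: "endo.D (Suc k\<^sub>1) (\<lambda>x. E x y)" if y: "y \<in> carrier B" for y
  proof (rule partial_D[OF endo.algebra_map_axioms _ _ _ y, of "\<lambda>y x. E x y" "Suc k\<^sub>2"])
    show "endo.D (Suc k\<^sub>1) (\<lambda>x. E x (g b))" if "b \<in> carrier A" for b
      by (rule endo.D_eqI[OF E1(2)[OF that]]) (simp add: E(3) that)
  qed (use E E_cl in \<open>simp_all del: diff_along.simps\<close>)
  have "bidiff_op K B k\<^sub>1 k\<^sub>2 E"
    unfolding bidiff_op_iff using E E_lin E_D by blast
  moreover have "g (C a b) = E (g a) (g b)" if "a \<in> carrier A" "b \<in> carrier A" for a b
    using that E(3) E1(3) g_closed by simp
  ultimately show ?thesis by blast
qed

end

text \<open>The next lemmas are applied with \<open>N = 0\<close>, to annihilate series in the kernel, and with \<open>N\<close> the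
  image of \<open>A\<close>, to clear denominators.\<close>

context algebra_map
begin

context
  fixes N
  assumes N_sub: "N \<subseteq> carrier B"
    and N_zero: "\<zero>\<^bsub>B\<^esub> \<in> N"
    and N_add: "\<And>x y. \<lbrakk>x \<in> N; y \<in> N\<rbrakk> \<Longrightarrow> x \<oplus>\<^bsub>B\<^esub> y \<in> N"
    and N_minus: "\<And>x y. \<lbrakk>x \<in> N; y \<in> N\<rbrakk> \<Longrightarrow> x \<ominus>\<^bsub>B\<^esub> y \<in> N"
    and N_mult: "\<And>a x. \<lbrakk>a \<in> carrier A; x \<in> N\<rbrakk> \<Longrightarrow> g a \<otimes>\<^bsub>B\<^esub> x \<in> N"
begin

text \<open>Induction on the order by
  \<open>s^(k+1) \<phi> x = s^k \<phi> (s x) + s^k (ad_s \<phi>) x\<close>. The hypothesis covers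
  all multiples of s so that it passes from \<open>\<phi>\<close> to its commutator with s.\<close>

lemma pow_mult_value_mem:
  "\<lbrakk>diff_along B B (\<lambda>x. x) k \<phi>; \<phi> \<in> carrier B \<rightarrow> carrier B; s \<in> carrier A; x \<in> carrier B;
    \<And>c. c \<in> carrier A \<Longrightarrow> \<phi> (g (s \<otimes>\<^bsub>A\<^esub> c) \<otimes>\<^bsub>B\<^esub> x) \<in> N\<rbrakk> \<Longrightarrow> g (s [^]\<^bsub>A\<^esub> k) \<otimes>\<^bsub>B\<^esub> \<phi> x \<in> N"
proof (induction k arbitrary: \<phi>)
  case 0
  then show ?case using N_zero g_closed by simp
next
  case (Suc k)
  interpret endo: algebra_map K B B "\<lambda>x. x" by (rule B.algebra_map_id)
  have gs: "g s \<in> carrier B" "g (s [^]\<^bsub>A\<^esub> k) \<in> carrier B" using Suc.prems g_closed by auto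
  have cl: "\<phi> x \<in> carrier B" "\<phi> (g s \<otimes>\<^bsub>B\<^esub> x) \<in> carrier B" using Suc.prems gs by auto
  have 1: "g (s [^]\<^bsub>A\<^esub> k) \<otimes>\<^bsub>B\<^esub> endo.adg (g s) \<phi> x \<in> N"
  proof (rule Suc.IH)
    show "diff_along B B (\<lambda>x. x) k (endo.adg (g s) \<phi>)" using Suc.prems gs by simp
    show "endo.adg (g s) \<phi> \<in> carrier B \<rightarrow> carrier B" using Suc.prems gs endo.ad_closed by blast
    fix c assume c: "c \<in> carrier A"
    have "g s \<otimes>\<^bsub>B\<^esub> (g (s \<otimes>\<^bsub>A\<^esub> c) \<otimes>\<^bsub>B\<^esub> x) = g (s \<otimes>\<^bsub>A\<^esub> (s \<otimes>\<^bsub>A\<^esub> c)) \<otimes>\<^bsub>B\<^esub> x"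
      using Suc.prems c g_closed by (simp add: g_mult B.m_assoc)
    then show "endo.adg (g s) \<phi> (g (s \<otimes>\<^bsub>A\<^esub> c) \<otimes>\<^bsub>B\<^esub> x) \<in> N"
      unfolding ad_along_def using Suc.prems c by (auto intro!: N_minus N_mult)
  qed (use Suc.prems in auto)
  have 2: "g (s [^]\<^bsub>A\<^esub> k) \<otimes>\<^bsub>B\<^esub> \<phi> (g s \<otimes>\<^bsub>B\<^esub> x) \<in> N"
    using Suc.prems(5)[of "\<one>\<^bsub>A\<^esub>"] Suc.prems N_mult by simp
  have "g (s [^]\<^bsub>A\<^esub> Suc k) \<otimes>\<^bsub>B\<^esub> \<phi> x =
      g (s [^]\<^bsub>A\<^esub> k) \<otimes>\<^bsub>B\<^esub> \<phi> (g s \<otimes>\<^bsub>B\<^esub> x) \<oplus>\<^bsub>B\<^esub> g (s [^]\<^bsub>A\<^esub> k) \<otimes>\<^bsub>B\<^esub> endo.adg (g s) \<phi> x"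
    using Suc.prems gs cl
    by (simp add: ad_along_def g_mult B.r_distr[symmetric] B.add_minus_cancel B.m_assoc)
  then show ?case using N_add[OF 2 1] by simp
qed

text \<open>The counterpart with the power inside: in
  \<open>\<phi> (v v^k b) = v \<phi> (v^k b) - (ad_v \<phi>) (v^k b)\<close> the first term is in N
  by hypothesis and the second by induction.\<close>

lemma value_at_pow_mem:
  "\<lbrakk>D k \<phi>; \<phi> \<in> carrier A \<rightarrow> carrier B; v \<in> carrier A; \<And>b. b \<in> carrier A \<Longrightarrow> g v \<otimes>\<^bsub>B\<^esub> \<phi> b \<in> N;
    b \<in> carrier A\<rbrakk> \<Longrightarrow> \<phi> (v [^]\<^bsub>A\<^esub> k \<otimes>\<^bsub>A\<^esub> b) \<in> N"
proof (induction k arbitrary: \<phi>)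
  case 0
  then show ?case using N_zero by simp
next
  case (Suc k)
  let ?b = "v [^]\<^bsub>A\<^esub> k \<otimes>\<^bsub>A\<^esub> b"
  have gv: "g v \<in> carrier B" and b: "?b \<in> carrier A" using Suc.prems g_closed by auto
  have 1: "adg v \<phi> ?b \<in> N"
  proof (rule Suc.IH)
    show "D k (adg v \<phi>)" using Suc.prems by simp
    show "adg v \<phi> \<in> carrier A \<rightarrow> carrier B" using Suc.prems ad_closed by blast
    fix c assume c: "c \<in> carrier A"
    have "g v \<otimes>\<^bsub>B\<^esub> adg v \<phi> c = g v \<otimes>\<^bsub>B\<^esub> (g v \<otimes>\<^bsub>B\<^esub> \<phi> c) \<ominus>\<^bsub>B\<^esub> g v \<otimes>\<^bsub>B\<^esub> \<phi> (v \<otimes>\<^bsub>A\<^esub> c)"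
      using Suc.prems c gv funcset_mem[OF Suc.prems(2)]
      by (simp add: ad_along_def B.r_distr B.r_minus B.M.minus_eq)
    then show "g v \<otimes>\<^bsub>B\<^esub> adg v \<phi> c \<in> N"
      using Suc.prems c by (auto intro!: N_minus N_mult[OF _ Suc.prems(4)])
  qed (use Suc.prems in auto)
  have "\<phi> (v \<otimes>\<^bsub>A\<^esub> ?b) = g v \<otimes>\<^bsub>B\<^esub> \<phi> ?b \<ominus>\<^bsub>B\<^esub> adg v \<phi> ?b"
    unfolding ad_along_def
    by (rule B.minus_minus_cancel) (use funcset_mem[OF Suc.prems(2)] gv b Suc.prems(3) in auto)
  also have "\<dots> \<in> N" by (intro N_minus 1 Suc.prems b)
  also have "v \<otimes>\<^bsub>A\<^esub> ?b = v [^]\<^bsub>A\<^esub> Suc k \<otimes>\<^bsub>A\<^esub> b"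
    using Suc.prems by (simp add: A.m_ac)
  finally show ?case .
qed

text \<open>The exponent comes before x: it depends on the orders alone, so a single one serves all
  coefficients of a series.\<close>

lemma ex_pow_bidiff_mem:
  assumes "s \<in> carrier A"
    and "\<And>b. b \<in> carrier A \<Longrightarrow> diff_along B B (\<lambda>x. x) k (\<lambda>x. G x b)"
    and G: "\<And>x b. \<lbrakk>x \<in> carrier B; b \<in> carrier A\<rbrakk> \<Longrightarrow> G x b \<in> carrier B"
    and "\<And>x. x \<in> carrier B \<Longrightarrow> D l (G x)"
  shows "\<exists>n. \<forall>x\<in>carrier B. (\<forall>c\<in>carrier A. \<forall>b\<in>carrier A. G (g (s \<otimes>\<^bsub>A\<^esub> c) \<otimes>\<^bsub>B\<^esub> x) b \<in> N) \<longrightarrow>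
    (\<forall>b\<in>carrier A. G x (s [^]\<^bsub>A\<^esub> (n :: nat) \<otimes>\<^bsub>A\<^esub> b) \<in> N)"
proof (intro exI ballI impI)
  fix x b
  assume x: "x \<in> carrier B" and b: "b \<in> carrier A"
    and *: "\<forall>c\<in>carrier A. \<forall>b\<in>carrier A. G (g (s \<otimes>\<^bsub>A\<^esub> c) \<otimes>\<^bsub>B\<^esub> x) b \<in> N"
  have "g (s [^]\<^bsub>A\<^esub> k) \<otimes>\<^bsub>B\<^esub> G x b' \<in> N" if "b' \<in> carrier A" for b'
    by (rule pow_mult_value_mem[of k "\<lambda>x. G x b'"]) (use assms that x * in auto)
  then have "G x ((s [^]\<^bsub>A\<^esub> k) [^]\<^bsub>A\<^esub> l \<otimes>\<^bsub>A\<^esub> b) \<in> N"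
    using assms x b by (intro value_at_pow_mem[of l "G x"]) auto
  \<comment> \<open>The first argument costs the factor s^k; with v = s^k,
    \<open>value_at_pow_mem\<close> raises it to the power l. This gives the exponent
    \<open>k * l\<close>.\<close>
  then show "G x (s [^]\<^bsub>A\<^esub> (k * l) \<otimes>\<^bsub>A\<^esub> b) \<in> N"
    using assms(1) by (simp add: A.nat_pow_pow)
qed

end

end

section \<open>The commutative localization\<close>

text \<open>The operations of \<open>comm_loc\<close> are unions over all representatives.
  Independence of the representatives collapses such a union, the classes being nonempty.\<close>

lemma UN_UN_const:
  assumes "(a, s) \<in> X" "(b, t) \<in> Y"
    and "\<And>a' s' b' t'. \<lbrakk>(a', s') \<in> X; (b', t') \<in> Y\<rbrakk> \<Longrightarrow> F a' s' b' t' = c"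
  shows "(\<Union>(a, s)\<in>X. \<Union>(b, t)\<in>Y. F a s b t) = c"
  using assms by fast

text \<open>Transitivity of the fraction relation. The middle denominator t enters the witness u v t
  so that u (t a) can be formed on the left and v (t c) on the right.\<close>

lemma (in cring) frac_trans_eq:
  assumes "u \<otimes> (t \<otimes> a) = u \<otimes> (s \<otimes> b)" "v \<otimes> (r \<otimes> b) = v \<otimes> (t \<otimes> c)"
    and "a \<in> carrier R" "b \<in> carrier R" "c \<in> carrier R" "s \<in> carrier R" "t \<in> carrier R" "r \<in> carrier R"
      "u \<in> carrier R" "v \<in> carrier R"
  shows "(u \<otimes> v \<otimes> t) \<otimes> (r \<otimes> a) = (u \<otimes> v \<otimes> t) \<otimes> (s \<otimes> c)"
proof -
  have "(u \<otimes> v \<otimes> t) \<otimes> (r \<otimes> a) = v \<otimes> r \<otimes> (u \<otimes> (t \<otimes> a))" using assms(3-) by (simp add: m_ac)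
  also have "\<dots> = u \<otimes> s \<otimes> (v \<otimes> (r \<otimes> b))" unfolding assms(1) using assms(3-) by (simp add: m_ac)
  also have "\<dots> = (u \<otimes> v \<otimes> t) \<otimes> (s \<otimes> c)" unfolding assms(2) using assms(3-) by (simp add: m_ac)
  finally show ?thesis .
qed

lemma (in cring) frac_mult_eq:
  assumes "u \<otimes> (s' \<otimes> a) = u \<otimes> (s \<otimes> a')" "v \<otimes> (t' \<otimes> b) = v \<otimes> (t \<otimes> b')"
    and "a \<in> carrier R" "b \<in> carrier R" "a' \<in> carrier R" "b' \<in> carrier R"
      "s \<in> carrier R" "t \<in> carrier R" "s' \<in> carrier R" "t' \<in> carrier R" "u \<in> carrier R" "v \<in> carrier R"
  shows "(u \<otimes> v) \<otimes> ((s' \<otimes> t') \<otimes> (a \<otimes> b)) = (u \<otimes> v) \<otimes> ((s \<otimes> t) \<otimes> (a' \<otimes> b'))"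
    and "(u \<otimes> v) \<otimes> ((s' \<otimes> t') \<otimes> (a \<otimes> t \<oplus> b \<otimes> s)) = (u \<otimes> v) \<otimes> ((s \<otimes> t) \<otimes> (a' \<otimes> t' \<oplus> b' \<otimes> s'))"
proof -
  have "(u \<otimes> v) \<otimes> ((s' \<otimes> t') \<otimes> (a \<otimes> b)) = (u \<otimes> (s' \<otimes> a)) \<otimes> (v \<otimes> (t' \<otimes> b))"
    using assms(3-) by (simp add: m_ac)
  also have "\<dots> = (u \<otimes> v) \<otimes> ((s \<otimes> t) \<otimes> (a' \<otimes> b'))"
    unfolding assms(1,2) using assms(3-) by (simp add: m_ac)
  finally show "(u \<otimes> v) \<otimes> ((s' \<otimes> t') \<otimes> (a \<otimes> b)) = (u \<otimes> v) \<otimes> ((s \<otimes> t) \<otimes> (a' \<otimes> b'))" .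
  have "(u \<otimes> v) \<otimes> ((s' \<otimes> t') \<otimes> (a \<otimes> t \<oplus> b \<otimes> s)) =
      (u \<otimes> (s' \<otimes> a)) \<otimes> (v \<otimes> t' \<otimes> t) \<oplus> (v \<otimes> (t' \<otimes> b)) \<otimes> (u \<otimes> s' \<otimes> s)"
    using assms(3-) by (simp add: m_ac r_distr)
  also have "\<dots> = (u \<otimes> v) \<otimes> ((s \<otimes> t) \<otimes> (a' \<otimes> t' \<oplus> b' \<otimes> s'))"
    unfolding assms(1,2) using assms(3-) by (simp add: m_ac r_distr)
  finally show "(u \<otimes> v) \<otimes> ((s' \<otimes> t') \<otimes> (a \<otimes> t \<oplus> b \<otimes> s)) =
      (u \<otimes> v) \<otimes> ((s \<otimes> t) \<otimes> (a' \<otimes> t' \<oplus> b' \<otimes> s'))" .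
qed

locale commutative_localization = algebra K A for K A +
  fixes S
  assumes submonoid: "submonoid S A"
begin

lemma S_closed: "s \<in> S \<Longrightarrow> s \<in> carrier A"
  and S_mult: "\<lbrakk>s \<in> S; t \<in> S\<rbrakk> \<Longrightarrow> s \<otimes>\<^bsub>A\<^esub> t \<in> S"
  and S_one: "\<one>\<^bsub>A\<^esub> \<in> S"
  using submonoid by (auto simp: submonoid_def)

context
  notes [simp, intro] = S_closed S_mult S_one
begin

abbreviation "B \<equiv> comm_loc A S"
abbreviation "fr \<equiv> frac A S"

lemma frac_rel_iff:
  "((a, s), (b, t)) \<in> frac_rel A S \<longleftrightarrow> a \<in> carrier A \<and> b \<in> carrier A \<and> s \<in> S \<and> t \<in> S \<and>
    (\<exists>u\<in>S. u \<otimes>\<^bsub>A\<^esub> (t \<otimes>\<^bsub>A\<^esub> a) = u \<otimes>\<^bsub>A\<^esub> (s \<otimes>\<^bsub>A\<^esub> b))"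
  by (simp add: frac_rel_def)

lemma equiv_frac_rel: "equiv (carrier A \<times> S) (frac_rel A S)"
proof (rule equivI)
  show "frac_rel A S \<subseteq> (carrier A \<times> S) \<times> carrier A \<times> S" by (auto simp: frac_rel_def)
  show "refl_on (carrier A \<times> S) (frac_rel A S)"
    by (auto simp: refl_on_def frac_rel_iff)
  show "sym (frac_rel A S)" by (rule symI) (auto simp: frac_rel_iff; metis)
  show "trans (frac_rel A S)"
  proof (rule transI)
    fix x y z assume xy: "(x, y) \<in> frac_rel A S" and yz: "(y, z) \<in> frac_rel A S"
    obtain a s b t c r where [simp]: "x = (a, s)" "y = (b, t)" "z = (c, r)"
      by (cases x; cases y; cases z) auto
    obtain u where u: "u \<in> S" "u \<otimes>\<^bsub>A\<^esub> (t \<otimes>\<^bsub>A\<^esub> a) = u \<otimes>\<^bsub>A\<^esub> (s \<otimes>\<^bsub>A\<^esub> b)"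
      using xy by (auto simp: frac_rel_iff)
    obtain v where v: "v \<in> S" "v \<otimes>\<^bsub>A\<^esub> (r \<otimes>\<^bsub>A\<^esub> b) = v \<otimes>\<^bsub>A\<^esub> (t \<otimes>\<^bsub>A\<^esub> c)"
      using yz by (auto simp: frac_rel_iff)
    have "(u \<otimes>\<^bsub>A\<^esub> v \<otimes>\<^bsub>A\<^esub> t) \<otimes>\<^bsub>A\<^esub> (r \<otimes>\<^bsub>A\<^esub> a) = (u \<otimes>\<^bsub>A\<^esub> v \<otimes>\<^bsub>A\<^esub> t) \<otimes>\<^bsub>A\<^esub> (s \<otimes>\<^bsub>A\<^esub> c)"
      by (rule frac_trans_eq[OF u(2) v(2)]) (use xy yz u v in \<open>auto simp: frac_rel_iff\<close>)
    moreover have "u \<otimes>\<^bsub>A\<^esub> v \<otimes>\<^bsub>A\<^esub> t \<in> S" using u v xy by (auto simp: frac_rel_iff)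
    ultimately show "(x, z) \<in> frac_rel A S" using xy yz by (auto simp: frac_rel_iff)
  qed
qed

lemma frac_eq_iff:
  "\<lbrakk>a \<in> carrier A; b \<in> carrier A; s \<in> S; t \<in> S\<rbrakk> \<Longrightarrow>
    fr a s = fr b t \<longleftrightarrow> (\<exists>u\<in>S. u \<otimes>\<^bsub>A\<^esub> (t \<otimes>\<^bsub>A\<^esub> a) = u \<otimes>\<^bsub>A\<^esub> (s \<otimes>\<^bsub>A\<^esub> b))"
  unfolding frac_def using eq_equiv_class_iff[OF equiv_frac_rel, of "(a, s)" "(b, t)"]
  by (simp add: frac_rel_iff)

lemma frac_eqI:
  "\<lbrakk>t \<otimes>\<^bsub>A\<^esub> a = s \<otimes>\<^bsub>A\<^esub> b; a \<in> carrier A; b \<in> carrier A; s \<in> S; t \<in> S\<rbrakk> \<Longrightarrow> fr a s = fr b t"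
  by (auto simp: frac_eq_iff)

lemma mem_frac:
  "(b, t) \<in> fr a s \<longleftrightarrow> a \<in> carrier A \<and> b \<in> carrier A \<and> s \<in> S \<and> t \<in> S \<and>
    (\<exists>u\<in>S. u \<otimes>\<^bsub>A\<^esub> (t \<otimes>\<^bsub>A\<^esub> a) = u \<otimes>\<^bsub>A\<^esub> (s \<otimes>\<^bsub>A\<^esub> b))"
  by (simp add: frac_def frac_rel_iff)

lemma frac_self: "\<lbrakk>a \<in> carrier A; s \<in> S\<rbrakk> \<Longrightarrow> (a, s) \<in> fr a s"
  by (auto simp: mem_frac)

lemma loc_carrier: "carrier B = {fr a s |a s. a \<in> carrier A \<and> s \<in> S}"
  by (auto simp: comm_loc_def quotient_def frac_def)

lemma frac_closed: "\<lbrakk>a \<in> carrier A; s \<in> S\<rbrakk> \<Longrightarrow> fr a s \<in> carrier B"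
  by (auto simp: loc_carrier)

lemma loc_cases:
  assumes "x \<in> carrier B"
  obtains a s where "x = fr a s" "a \<in> carrier A" "s \<in> S"
  using assms by (auto simp: loc_carrier)

lemma loc_mult:
  assumes "a \<in> carrier A" "b \<in> carrier A" "s \<in> S" "t \<in> S"
  shows "fr a s \<otimes>\<^bsub>B\<^esub> fr b t = fr (a \<otimes>\<^bsub>A\<^esub> b) (s \<otimes>\<^bsub>A\<^esub> t)"
proof -
  have "fr (a' \<otimes>\<^bsub>A\<^esub> b') (s' \<otimes>\<^bsub>A\<^esub> t') = fr (a \<otimes>\<^bsub>A\<^esub> b) (s \<otimes>\<^bsub>A\<^esub> t)"
    if x: "(a', s') \<in> fr a s" and y: "(b', t') \<in> fr b t" for a' s' b' t'
  proof -
    obtain u where u: "u \<in> S" "u \<otimes>\<^bsub>A\<^esub> (s' \<otimes>\<^bsub>A\<^esub> a) = u \<otimes>\<^bsub>A\<^esub> (s \<otimes>\<^bsub>A\<^esub> a')"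
      and a': "a' \<in> carrier A" "s' \<in> S" using x by (auto simp: mem_frac)
    obtain v where v: "v \<in> S" "v \<otimes>\<^bsub>A\<^esub> (t' \<otimes>\<^bsub>A\<^esub> b) = v \<otimes>\<^bsub>A\<^esub> (t \<otimes>\<^bsub>A\<^esub> b')"
      and b': "b' \<in> carrier A" "t' \<in> S" using y by (auto simp: mem_frac)
    have "\<exists>w\<in>S. w \<otimes>\<^bsub>A\<^esub> ((s' \<otimes>\<^bsub>A\<^esub> t') \<otimes>\<^bsub>A\<^esub> (a \<otimes>\<^bsub>A\<^esub> b)) = w \<otimes>\<^bsub>A\<^esub> ((s \<otimes>\<^bsub>A\<^esub> t) \<otimes>\<^bsub>A\<^esub> (a' \<otimes>\<^bsub>A\<^esub> b'))"
      by (rule bexI[OF _ S_mult[OF u(1) v(1)]], rule frac_mult_eq(1)[OF u(2) v(2)])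
        (use u(1) v(1) a' b' assms in auto)
    then have "fr (a \<otimes>\<^bsub>A\<^esub> b) (s \<otimes>\<^bsub>A\<^esub> t) = fr (a' \<otimes>\<^bsub>A\<^esub> b') (s' \<otimes>\<^bsub>A\<^esub> t')"
      using a' b' assms S_closed[OF a'(2)] S_closed[OF b'(2)] S_closed[OF assms(3)] S_closed[OF assms(4)]
      by (intro frac_eq_iff[THEN iffD2] m_closed add.m_closed S_mult)
    then show ?thesis by simp
  qed
  then have "(\<Union>(a, s)\<in>fr a s. \<Union>(b, t)\<in>fr b t. fr (a \<otimes>\<^bsub>A\<^esub> b) (s \<otimes>\<^bsub>A\<^esub> t)) = fr (a \<otimes>\<^bsub>A\<^esub> b) (s \<otimes>\<^bsub>A\<^esub> t)"
    by (rule UN_UN_const[OF frac_self[OF assms(1,3)] frac_self[OF assms(2,4)]])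
  then show ?thesis by (simp add: comm_loc_def)
qed

lemma loc_add:
  assumes "a \<in> carrier A" "b \<in> carrier A" "s \<in> S" "t \<in> S"
  shows "fr a s \<oplus>\<^bsub>B\<^esub> fr b t = fr (a \<otimes>\<^bsub>A\<^esub> t \<oplus>\<^bsub>A\<^esub> b \<otimes>\<^bsub>A\<^esub> s) (s \<otimes>\<^bsub>A\<^esub> t)"
proof -
  have "fr (a' \<otimes>\<^bsub>A\<^esub> t' \<oplus>\<^bsub>A\<^esub> b' \<otimes>\<^bsub>A\<^esub> s') (s' \<otimes>\<^bsub>A\<^esub> t') = fr (a \<otimes>\<^bsub>A\<^esub> t \<oplus>\<^bsub>A\<^esub> b \<otimes>\<^bsub>A\<^esub> s) (s \<otimes>\<^bsub>A\<^esub> t)"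
    if x: "(a', s') \<in> fr a s" and y: "(b', t') \<in> fr b t" for a' s' b' t'
  proof -
    obtain u where u: "u \<in> S" "u \<otimes>\<^bsub>A\<^esub> (s' \<otimes>\<^bsub>A\<^esub> a) = u \<otimes>\<^bsub>A\<^esub> (s \<otimes>\<^bsub>A\<^esub> a')"
      and a': "a' \<in> carrier A" "s' \<in> S" using x by (auto simp: mem_frac)
    obtain v where v: "v \<in> S" "v \<otimes>\<^bsub>A\<^esub> (t' \<otimes>\<^bsub>A\<^esub> b) = v \<otimes>\<^bsub>A\<^esub> (t \<otimes>\<^bsub>A\<^esub> b')"
      and b': "b' \<in> carrier A" "t' \<in> S" using y by (auto simp: mem_frac)
    have "\<exists>w\<in>S. w \<otimes>\<^bsub>A\<^esub> ((s' \<otimes>\<^bsub>A\<^esub> t') \<otimes>\<^bsub>A\<^esub> (a \<otimes>\<^bsub>A\<^esub> t \<oplus>\<^bsub>A\<^esub> b \<otimes>\<^bsub>A\<^esub> s)) = w \<otimes>\<^bsub>A\<^esub> ((s \<otimes>\<^bsub>A\<^esub> t) \<otimes>\<^bsub>A\<^esub> (a' \<otimes>\<^bsub>A\<^esub> t' \<oplus>\<^bsub>A\<^esub> b' \<otimes>\<^bsub>A\<^esub> s'))"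
      by (rule bexI[OF _ S_mult[OF u(1) v(1)]], rule frac_mult_eq(2)[OF u(2) v(2)])
        (use u(1) v(1) a' b' assms in auto)
    then have "fr (a \<otimes>\<^bsub>A\<^esub> t \<oplus>\<^bsub>A\<^esub> b \<otimes>\<^bsub>A\<^esub> s) (s \<otimes>\<^bsub>A\<^esub> t) = fr (a' \<otimes>\<^bsub>A\<^esub> t' \<oplus>\<^bsub>A\<^esub> b' \<otimes>\<^bsub>A\<^esub> s') (s' \<otimes>\<^bsub>A\<^esub> t')"
      using a' b' assms S_closed[OF a'(2)] S_closed[OF b'(2)] S_closed[OF assms(3)] S_closed[OF assms(4)]
      by (intro frac_eq_iff[THEN iffD2] m_closed add.m_closed S_mult)
    then show ?thesis by simp
  qed
  then have "(\<Union>(a, s)\<in>fr a s. \<Union>(b, t)\<in>fr b t. fr (a \<otimes>\<^bsub>A\<^esub> t \<oplus>\<^bsub>A\<^esub> b \<otimes>\<^bsub>A\<^esub> s) (s \<otimes>\<^bsub>A\<^esub> t)) = fr (a \<otimes>\<^bsub>A\<^esub> t \<oplus>\<^bsub>A\<^esub> b \<otimes>\<^bsub>A\<^esub> s) (s \<otimes>\<^bsub>A\<^esub> t)"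
    by (rule UN_UN_const[OF frac_self[OF assms(1,3)] frac_self[OF assms(2,4)]])
  then show ?thesis by (simp add: comm_loc_def)
qed

lemma loc_smult:
  assumes "c \<in> carrier K" "a \<in> carrier A" "s \<in> S"
  shows "c \<odot>\<^bsub>B\<^esub> fr a s = fr (c \<odot>\<^bsub>A\<^esub> a) s"
proof -
  have "fr (c \<odot>\<^bsub>A\<^esub> a') s' = fr (c \<odot>\<^bsub>A\<^esub> a) s" if "(a', s') \<in> fr a s" for a' s'
    using that assms by (auto simp: mem_frac frac_eq_iff smult_mult_right; metis)
  then have "(\<Union>(a', s')\<in>fr a s. fr (c \<odot>\<^bsub>A\<^esub> a') s') = fr (c \<odot>\<^bsub>A\<^esub> a) s"
    using frac_self[OF assms(2,3)] by fast
  then show ?thesis by (simp add: comm_loc_def)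
qed

lemma loc_one: "\<one>\<^bsub>B\<^esub> = fr \<one>\<^bsub>A\<^esub> \<one>\<^bsub>A\<^esub>"
  and loc_zero: "\<zero>\<^bsub>B\<^esub> = fr \<zero>\<^bsub>A\<^esub> \<one>\<^bsub>A\<^esub>"
  by (simp_all add: comm_loc_def)

lemmas loc_simps = loc_mult loc_add loc_one loc_zero

lemma loc_cring: "cring B"
proof (rule cringI)
  show "abelian_group B"
  proof (rule abelian_groupI)
    fix x y z assume "x \<in> carrier B" "y \<in> carrier B" "z \<in> carrier B"
    then show "x \<oplus>\<^bsub>B\<^esub> y \<oplus>\<^bsub>B\<^esub> z = x \<oplus>\<^bsub>B\<^esub> (y \<oplus>\<^bsub>B\<^esub> z)"
      by (elim loc_cases) (simp add: loc_simps m_ac r_distr l_distr a_ac)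
  next
    fix x assume "x \<in> carrier B"
    then show "\<exists>y\<in>carrier B. y \<oplus>\<^bsub>B\<^esub> x = \<zero>\<^bsub>B\<^esub>"
    proof (rule loc_cases)
      fix a s assume x: "x = fr a s" "a \<in> carrier A" "s \<in> S"
      show ?thesis
        by (rule bexI[of _ "fr (\<ominus>\<^bsub>A\<^esub> a) s"])
          (use x in \<open>auto simp: loc_simps frac_closed l_minus l_neg del: equalityI intro!: frac_eqI\<close>)
    qed
  qed (auto elim!: loc_cases simp: loc_simps frac_closed m_comm a_comm)
  show "comm_monoid B"
    by (rule comm_monoidI) (auto elim!: loc_cases simp: loc_simps frac_closed m_ac)
  fix x y z assume "x \<in> carrier B" "y \<in> carrier B" "z \<in> carrier B"
  then show "(x \<oplus>\<^bsub>B\<^esub> y) \<otimes>\<^bsub>B\<^esub> z = x \<otimes>\<^bsub>B\<^esub> z \<oplus>\<^bsub>B\<^esub> y \<otimes>\<^bsub>B\<^esub> z"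
    by (elim loc_cases) (auto simp: loc_simps m_ac r_distr l_distr del: equalityI intro!: frac_eqI)
qed

lemma loc_algebra: "algebra K B"
proof (rule algebraI[OF R.is_cring loc_cring])
  fix c d x y assume "c \<in> carrier K" "d \<in> carrier K" "x \<in> carrier B" "y \<in> carrier B"
  then show "(c \<oplus>\<^bsub>K\<^esub> d) \<odot>\<^bsub>B\<^esub> x = c \<odot>\<^bsub>B\<^esub> x \<oplus>\<^bsub>B\<^esub> d \<odot>\<^bsub>B\<^esub> x"
    by (elim loc_cases)
      (auto simp: loc_simps loc_smult smult_l_distr smult_mult_right smult_assoc2 r_distr l_distr m_ac
        del: equalityI intro!: frac_eqI)
qed (auto elim!: loc_cases simp: loc_simps loc_smult frac_closed smult_r_distr smult_assoc1 smult_assoc2)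

lemma numer_hom: "numer A S \<in> alg_hom K A B"
  by (auto simp: alg_hom_def ring_hom_def numer_def frac_closed loc_simps loc_smult)

lemma loc_localization_map: "localization_map K A B (numer A S) S"
proof (intro localization_map.intro algebra_map.intro algebra_map_axioms.intro
    localization_map_axioms.intro algebra_axioms loc_algebra numer_hom submonoid)
  interpret B: cring B by (rule loc_cring)
  show "numer A S s \<in> Units B" if s: "s \<in> S" for s
  proof -
    have "fr s \<one>\<^bsub>A\<^esub> \<otimes>\<^bsub>B\<^esub> fr \<one>\<^bsub>A\<^esub> s = \<one>\<^bsub>B\<^esub>"
      using s by (auto simp: loc_simps del: equalityI intro!: frac_eqI)
    moreover have cl: "fr s \<one>\<^bsub>A\<^esub> \<in> carrier B" "fr \<one>\<^bsub>A\<^esub> s \<in> carrier B"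
      using s by (auto intro: frac_closed)
    ultimately show ?thesis
      unfolding Units_def numer_def using B.m_comm[OF cl] by (intro CollectI conjI bexI[OF _ cl(2)] cl) simp_all
  qed
  show "\<exists>s\<in>S. \<exists>a\<in>carrier A. numer A S s \<otimes>\<^bsub>B\<^esub> x = numer A S a" if "x \<in> carrier B" for x
    using that
  proof (rule loc_cases)
    fix a s assume x: "x = fr a s" "a \<in> carrier A" "s \<in> S"
    have "numer A S s \<otimes>\<^bsub>B\<^esub> x = numer A S a"
      using x by (auto simp: numer_def loc_simps del: equalityI intro!: frac_eqI)
    then show ?thesis using x by blast
  qed
  show "\<exists>u\<in>S. u \<otimes>\<^bsub>A\<^esub> a = \<zero>\<^bsub>A\<^esub>" if "a \<in> carrier A" "numer A S a = \<zero>\<^bsub>B\<^esub>" for a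
    using that by (auto simp: numer_def loc_zero frac_eq_iff)
qed

end

end

section \<open>The algebra of a star product\<close>

lemma finsum_additive:
  assumes "abelian_monoid G" "abelian_monoid H"
    and add: "\<And>x y. \<lbrakk>x \<in> carrier G; y \<in> carrier G\<rbrakk> \<Longrightarrow> \<phi> (x \<oplus>\<^bsub>G\<^esub> y) = \<phi> x \<oplus>\<^bsub>H\<^esub> \<phi> y"
    and zero: "\<phi> \<zero>\<^bsub>G\<^esub> = \<zero>\<^bsub>H\<^esub>"
    and closed: "\<And>x. x \<in> carrier G \<Longrightarrow> \<phi> x \<in> carrier H"
    and F: "\<And>i. i \<in> I \<Longrightarrow> F i \<in> carrier G"
  shows "\<phi> (finsum G F I) = finsum H (\<lambda>i. \<phi> (F i)) I"
proof -
  interpret G: abelian_monoid G by fact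
  interpret H: abelian_monoid H by fact
  show ?thesis
    using F
  proof (induction I rule: infinite_finite_induct)
    \<comment> \<open>Sums over infinite sets are zero by convention, so this case amounts to
      \<open>\<phi>\<close> preserving zero.\<close>
    case (infinite I)
    then show ?case by (simp add: G.finsum_infinite H.finsum_infinite zero)
  next
    case empty
    show ?case by (simp add: zero)
  next
    case (insert i I)
    then have "finsum G F I \<in> carrier G" by (intro G.finsum_closed) auto
    then show ?case
      using insert closed by (simp add: G.finsum_insert H.finsum_insert Pi_def add)
  qed
qed

lemma linear_map_finsum:
  assumes "algebra K A" "algebra K B" "linear_map K A B \<phi>" "\<And>i. i \<in> I \<Longrightarrow> F i \<in> carrier A"
  shows "\<phi> (finsum A F I) = finsum B (\<lambda>i. \<phi> (F i)) I"
proof -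
  interpret A: algebra K A by fact
  interpret B: algebra K B by fact
  have "\<phi> \<zero>\<^bsub>A\<^esub> = \<zero>\<^bsub>B\<^esub>"
    using linear_map_add[OF assms(3), of "\<zero>\<^bsub>A\<^esub>" "\<zero>\<^bsub>A\<^esub>"] linear_map_closed[OF assms(3), of "\<zero>\<^bsub>A\<^esub>"]
    by simp
  then show ?thesis
    using assms by (intro finsum_additive[of A B \<phi>]) (auto simp: linear_mapD A.M.abelian_monoid_axioms B.M.abelian_monoid_axioms)
qed

context abelian_monoid
begin

lemma finsum_bij:
  assumes "bij_betw h I J" "\<And>j. j \<in> J \<Longrightarrow> F j \<in> carrier G"
  shows "finsum G F J = finsum G (\<lambda>i. F (h i)) I"
  using assms finsum_reindex[of F h I] by (auto simp: bij_betw_def)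

lemma finsum_single:
  assumes "finite I" "i \<in> I" "F i \<in> carrier G" "\<And>j. \<lbrakk>j \<in> I; j \<noteq> i\<rbrakk> \<Longrightarrow> F j = \<zero>"
  shows "finsum G F I = F i"
proof -
  have "finsum G F I = finsum G F (insert i (I - {i}))" using assms(2) by (simp add: insert_absorb)
  also have "\<dots> = F i \<oplus> finsum G F (I - {i})"
    by (rule finsum_insert) (use assms in auto)
  also have "finsum G F (I - {i}) = \<zero>" by (rule add.finprod_one_eqI) (use assms in auto)
  finally show ?thesis using assms by simp
qed

lemma finsum_Sigma:
  assumes "finite I" "\<And>i. i \<in> I \<Longrightarrow> finite (J i)" "\<And>i j. \<lbrakk>i \<in> I; j \<in> J i\<rbrakk> \<Longrightarrow> F i j \<in> carrier G"
  shows "(\<Oplus>i\<in>I. \<Oplus>j\<in>J i. F i j) = finsum G (\<lambda>(i, j). F i j) (Sigma I J)"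
  using assms
proof (induction I)
  case (insert i I)
  have *: "Sigma (insert i I) J = Pair i ` J i \<union> Sigma I J" by auto
  have "finsum G (\<lambda>(i, j). F i j) (Sigma (insert i I) J) =
      finsum G (\<lambda>(i, j). F i j) (Pair i ` J i) \<oplus> finsum G (\<lambda>(i, j). F i j) (Sigma I J)"
    unfolding * using insert by (intro finsum_Un_disjoint) (auto simp: Pi_def)
  also have "finsum G (\<lambda>(i, j). F i j) (Pair i ` J i) = (\<Oplus>j\<in>J i. F i j)"
    using insert.prems by (subst finsum_reindex) (auto simp: inj_on_def Pi_def)
  finally show ?case
    using insert by (subst finsum_insert) (auto simp: Pi_def intro!: finsum_closed)
qed simp

text \<open>Both sides run over the ways to write n as a sum of three naturals. This is the
  associativity of Cauchy products, both of power series and of their action on series over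
  A.\<close>

lemma finsum_triangle:
  assumes F: "\<And>i j k. F i j k \<in> carrier G"
  shows "(\<Oplus>i\<in>{..n :: nat}. \<Oplus>j\<in>{..i}. F j (i - j) (n - i)) = (\<Oplus>i\<in>{..n}. \<Oplus>j\<in>{..n - i}. F i j (n - i - j))"
proof -
  have bij: "bij_betw (\<lambda>(i, j). (i + j, i)) (SIGMA i:{..n}. {..n - i}) (SIGMA i:{..n}. {..i})"
    by (rule bij_betw_byWitness[of _ "\<lambda>(i, j). (j, i - j)"]) auto
  have "(\<Oplus>i\<in>{..n}. \<Oplus>j\<in>{..i}. F j (i - j) (n - i)) =
      finsum G (\<lambda>(i, j). F j (i - j) (n - i)) (SIGMA i:{..n}. {..i})"
    by (rule finsum_Sigma) (auto simp: F)
  also have "\<dots> = finsum G (\<lambda>(i, j). F i j (n - i - j)) (SIGMA i:{..n}. {..n - i})"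
    by (subst finsum_bij[OF bij]) (auto simp: F case_prod_unfold)
  also have "\<dots> = (\<Oplus>i\<in>{..n}. \<Oplus>j\<in>{..n - i}. F i j (n - i - j))"
    by (rule finsum_Sigma[symmetric]) (auto simp: F)
  finally show ?thesis .
qed

end

section \<open>Sums over the index triples of a star product\<close>

abbreviation triples :: "nat \<Rightarrow> (nat \<times> nat \<times> nat) set"
  where "triples n \<equiv> {(l, p, q). l + p + q = n}"

lemma finite_triples [simp]: "finite (triples n)"
  by (rule finite_subset[of _ "{..n} \<times> {..n} \<times> {..n}"]) auto

text \<open>Moves a Cauchy sum in the slot p out of a star product: i is taken off p and hence off
  the total. It is the combinatorial content of \<open>star_smult\<close>.\<close>

lemma (in abelian_monoid) finsum_triples_left:
  assumes F: "\<And>i l p q. F i l p q \<in> carrier G"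
  shows "finsum G (\<lambda>(l, p, q). \<Oplus>i\<in>{..p}. F i l (p - i) q) (triples n) =
    (\<Oplus>i\<in>{..n}. finsum G (\<lambda>(l, p, q). F i l p q) (triples (n - i)))"
proof -
  have bij: "bij_betw (\<lambda>(i, (l, p, q)). ((l, p + i, q), i)) (SIGMA i:{..n}. triples (n - i))
      (SIGMA x:triples n. {..fst (snd x)})"
    by (rule bij_betw_byWitness[of _ "\<lambda>((l, p, q), i). (i, (l, p - i, q))"]) auto
  have "finsum G (\<lambda>(l, p, q). \<Oplus>i\<in>{..p}. F i l (p - i) q) (triples n) =
      finsum G (\<lambda>x. \<Oplus>i\<in>{..fst (snd x)}. F i (fst x) (fst (snd x) - i) (snd (snd x))) (triples n)"
    by (simp add: case_prod_unfold)
  also have "\<dots> = finsum G (\<lambda>(x, i). F i (fst x) (fst (snd x) - i) (snd (snd x)))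
      (SIGMA x:triples n. {..fst (snd x)})"
    by (rule finsum_Sigma) (auto simp: F)
  also have "\<dots> = finsum G (\<lambda>(i, x). case x of (l, p, q) \<Rightarrow> F i l p q) (SIGMA i:{..n}. triples (n - i))"
    by (subst finsum_bij[OF bij]) (auto simp: F case_prod_unfold)
  also have "\<dots> = (\<Oplus>i\<in>{..n}. finsum G (\<lambda>(l, p, q). F i l p q) (triples (n - i)))"
    by (rule finsum_Sigma[symmetric]) (auto simp: F)
  finally show ?thesis .
qed

lemma (in abelian_monoid) finsum_triples_swap:
  assumes F: "\<And>l p q. F l p q \<in> carrier G"
  shows "finsum G (\<lambda>(l, p, q). F l p q) (triples n) = finsum G (\<lambda>(l, p, q). F l q p) (triples n)"
proof -
  have bij: "bij_betw (\<lambda>(l, p, q). (l, q, p)) (triples n) (triples n)"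
    by (rule bij_betw_byWitness[of _ "\<lambda>(l, p, q). (l, q, p)"]) auto
  show ?thesis by (subst finsum_bij[OF bij]) (auto simp: F case_prod_unfold)
qed

section \<open>Formal power series\<close>

lemma ps_ring_simps:
  "carrier (ps_ring K) = UNIV \<rightarrow> carrier K"
  "\<zero>\<^bsub>ps_ring K\<^esub> = (\<lambda>n. \<zero>\<^bsub>K\<^esub>)"
  "\<one>\<^bsub>ps_ring K\<^esub> = (\<lambda>n. if n = 0 then \<one>\<^bsub>K\<^esub> else \<zero>\<^bsub>K\<^esub>)"
  "f \<oplus>\<^bsub>ps_ring K\<^esub> h = (\<lambda>n. f n \<oplus>\<^bsub>K\<^esub> h n)"
  "f \<otimes>\<^bsub>ps_ring K\<^esub> h = (\<lambda>n. \<Oplus>\<^bsub>K\<^esub>i\<in>{..n}. f i \<otimes>\<^bsub>K\<^esub> h (n - i))"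
  by (simp_all add: ps_ring_def)

lemma star_algebra_simps:
  "carrier (star_algebra A C) = UNIV \<rightarrow> carrier A"
  "\<zero>\<^bsub>star_algebra A C\<^esub> = (\<lambda>n. \<zero>\<^bsub>A\<^esub>)"
  "\<one>\<^bsub>star_algebra A C\<^esub> = (\<lambda>n. if n = 0 then \<one>\<^bsub>A\<^esub> else \<zero>\<^bsub>A\<^esub>)"
  "f \<oplus>\<^bsub>star_algebra A C\<^esub> h = (\<lambda>n. f n \<oplus>\<^bsub>A\<^esub> h n)"
  "f \<otimes>\<^bsub>star_algebra A C\<^esub> h = star A C f h"
  "c \<odot>\<^bsub>star_algebra A C\<^esub> f = (\<lambda>n. \<Oplus>\<^bsub>A\<^esub>i\<in>{..n}. c i \<odot>\<^bsub>A\<^esub> f (n - i))"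
  by (simp_all add: star_algebra_def)

lemma (in cring) cring_ps_ring: "cring (ps_ring R)"
proof (rule cringI)
  show "abelian_group (ps_ring R)"
  proof (rule abelian_groupI)
    fix f assume "f \<in> carrier (ps_ring R)"
    then show "\<exists>h\<in>carrier (ps_ring R). h \<oplus>\<^bsub>ps_ring R\<^esub> f = \<zero>\<^bsub>ps_ring R\<^esub>"
      by (intro bexI[of _ "\<lambda>n. \<ominus> f n"]) (auto simp: ps_ring_simps l_neg Pi_def)
  qed (auto simp: ps_ring_simps Pi_def a_ac)
  have closed: "(\<lambda>n. \<Oplus>i\<in>{..n}. f i \<otimes> h (n - i)) \<in> UNIV \<rightarrow> carrier R"
    if "f \<in> UNIV \<rightarrow> carrier R" "h \<in> UNIV \<rightarrow> carrier R" for f h :: "nat \<Rightarrow> 'a"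
    using that by (auto intro!: finsum_closed simp: Pi_def)
  show "comm_monoid (ps_ring R)"
  proof (rule comm_monoidI)
    fix f h k assume "f \<in> carrier (ps_ring R)" "h \<in> carrier (ps_ring R)" "k \<in> carrier (ps_ring R)"
    then have cl: "f n \<in> carrier R" "h n \<in> carrier R" "k n \<in> carrier R" for n
      by (auto simp: ps_ring_simps)
    show "f \<otimes>\<^bsub>ps_ring R\<^esub> h \<otimes>\<^bsub>ps_ring R\<^esub> k = f \<otimes>\<^bsub>ps_ring R\<^esub> (h \<otimes>\<^bsub>ps_ring R\<^esub> k)"
    proof
      fix n
      have "(\<Oplus>i\<in>{..n}. (\<Oplus>j\<in>{..i}. f j \<otimes> h (i - j)) \<otimes> k (n - i)) =
          (\<Oplus>i\<in>{..n}. \<Oplus>j\<in>{..i}. (f j \<otimes> h (i - j)) \<otimes> k (n - i))"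
        using cl by (intro finsum_cong' finsum_ldistr) (auto intro!: finsum_closed)
      also have "\<dots> = (\<Oplus>i\<in>{..n}. \<Oplus>j\<in>{..n - i}. (f i \<otimes> h j) \<otimes> k (n - i - j))"
        using cl by (intro finsum_triangle) auto
      also have "\<dots> = (\<Oplus>i\<in>{..n}. f i \<otimes> (\<Oplus>j\<in>{..n - i}. h j \<otimes> k (n - i - j)))"
        using cl by (intro finsum_cong') (auto simp: finsum_rdistr m_assoc intro!: finsum_closed)
      finally show "(f \<otimes>\<^bsub>ps_ring R\<^esub> h \<otimes>\<^bsub>ps_ring R\<^esub> k) n = (f \<otimes>\<^bsub>ps_ring R\<^esub> (h \<otimes>\<^bsub>ps_ring R\<^esub> k)) n"
        by (simp add: ps_ring_simps)
    qed
    show "\<one>\<^bsub>ps_ring R\<^esub> \<otimes>\<^bsub>ps_ring R\<^esub> f = f"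
    proof
      fix n show "(\<one>\<^bsub>ps_ring R\<^esub> \<otimes>\<^bsub>ps_ring R\<^esub> f) n = f n"
        using cl unfolding ps_ring_simps by (subst finsum_single[of _ 0]) auto
    qed
    show "f \<otimes>\<^bsub>ps_ring R\<^esub> h = h \<otimes>\<^bsub>ps_ring R\<^esub> f"
    proof
      fix n :: nat
      have bij: "bij_betw (\<lambda>i. n - i) {..n} {..n}"
        by (rule bij_betw_byWitness[of _ "\<lambda>i. n - i"]) auto
      show "(f \<otimes>\<^bsub>ps_ring R\<^esub> h) n = (h \<otimes>\<^bsub>ps_ring R\<^esub> f) n"
        using cl unfolding ps_ring_simps
        by (subst finsum_bij[OF bij]) (auto intro!: finsum_cong' simp: m_comm)
    qed
  qed (use closed in \<open>auto simp: ps_ring_simps\<close>)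
  fix f h k assume "f \<in> carrier (ps_ring R)" "h \<in> carrier (ps_ring R)" "k \<in> carrier (ps_ring R)"
  then have cl: "f n \<in> carrier R" "h n \<in> carrier R" "k n \<in> carrier R" for n
    by (auto simp: ps_ring_simps)
  show "(f \<oplus>\<^bsub>ps_ring R\<^esub> h) \<otimes>\<^bsub>ps_ring R\<^esub> k = f \<otimes>\<^bsub>ps_ring R\<^esub> k \<oplus>\<^bsub>ps_ring R\<^esub> h \<otimes>\<^bsub>ps_ring R\<^esub> k"
    using cl by (simp add: ps_ring_simps l_distr finsum_addf Pi_def)
qed

section \<open>Star products as algebras over the power series ring\<close>

locale star_product = A: algebra K A for K A +
  fixes C
  assumes star_product: "diff_star_product K A C"
begin

abbreviation "R \<equiv> star_algebra A C"

lemma C_linear: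
  "b \<in> carrier A \<Longrightarrow> linear_map K A A (\<lambda>a. C l a b)"
  "a \<in> carrier A \<Longrightarrow> linear_map K A A (C l a)"
proof -
  obtain k1 k2 where "bidiff_op K A k1 k2 (C l)"
    using star_product unfolding diff_star_product_def by blast
  then show "b \<in> carrier A \<Longrightarrow> linear_map K A A (\<lambda>a. C l a b)"
    "a \<in> carrier A \<Longrightarrow> linear_map K A A (C l a)"
    unfolding bidiff_op_iff by blast+
qed

lemma C_closed [simp]: "\<lbrakk>a \<in> carrier A; b \<in> carrier A\<rbrakk> \<Longrightarrow> C l a b \<in> carrier A"
  using linear_map_closed[OF C_linear(2)] by blast

lemma C_add:
  "\<lbrakk>a \<in> carrier A; a' \<in> carrier A; b \<in> carrier A\<rbrakk> \<Longrightarrow> C l (a \<oplus>\<^bsub>A\<^esub> a') b = C l a b \<oplus>\<^bsub>A\<^esub> C l a' b"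
  "\<lbrakk>a \<in> carrier A; b \<in> carrier A; b' \<in> carrier A\<rbrakk> \<Longrightarrow> C l a (b \<oplus>\<^bsub>A\<^esub> b') = C l a b \<oplus>\<^bsub>A\<^esub> C l a b'"
  using linear_map_add[OF C_linear(1)] linear_map_add[OF C_linear(2)] by blast+

lemma C_smult:
  "\<lbrakk>c \<in> carrier K; a \<in> carrier A; b \<in> carrier A\<rbrakk> \<Longrightarrow> C l (c \<odot>\<^bsub>A\<^esub> a) b = c \<odot>\<^bsub>A\<^esub> C l a b"
  "\<lbrakk>c \<in> carrier K; a \<in> carrier A; b \<in> carrier A\<rbrakk> \<Longrightarrow> C l a (c \<odot>\<^bsub>A\<^esub> b) = c \<odot>\<^bsub>A\<^esub> C l a b"
  using linear_map_smult[OF C_linear(1)] linear_map_smult[OF C_linear(2)] by blast+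

lemma C_0: "\<lbrakk>a \<in> carrier A; b \<in> carrier A\<rbrakk> \<Longrightarrow> C 0 a b = a \<otimes>\<^bsub>A\<^esub> b"
  using star_product by (simp add: diff_star_product_def)

lemma star_closed:
  "\<lbrakk>f \<in> UNIV \<rightarrow> carrier A; h \<in> UNIV \<rightarrow> carrier A\<rbrakk> \<Longrightarrow> star A C f h \<in> UNIV \<rightarrow> carrier A"
  unfolding star_def by (auto simp: Pi_def intro!: A.M.finsum_closed)

lemma star_assoc:
  "\<lbrakk>f \<in> UNIV \<rightarrow> carrier A; h \<in> UNIV \<rightarrow> carrier A; k \<in> UNIV \<rightarrow> carrier A\<rbrakk> \<Longrightarrow>
    star A C (star A C f h) k = star A C f (star A C h k)"
  using star_product by (simp add: diff_star_product_def star_algebra_simps Let_def)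

lemma star_one:
  "f \<in> UNIV \<rightarrow> carrier A \<Longrightarrow> star A C (\<lambda>n. if n = 0 then \<one>\<^bsub>A\<^esub> else \<zero>\<^bsub>A\<^esub>) f = f"
  "f \<in> UNIV \<rightarrow> carrier A \<Longrightarrow> star A C f (\<lambda>n. if n = 0 then \<one>\<^bsub>A\<^esub> else \<zero>\<^bsub>A\<^esub>) = f"
  using star_product by (simp_all add: diff_star_product_def star_algebra_simps Let_def)

lemma star_swap:
  "\<lbrakk>f \<in> UNIV \<rightarrow> carrier A; h \<in> UNIV \<rightarrow> carrier A\<rbrakk> \<Longrightarrow> star A (\<lambda>l a b. C l b a) f h = star A C h f"
  unfolding star_def
  by (intro ext A.M.finsum_triples_swap[of "\<lambda>l p q. C l (h q) (f p)"]) (auto simp: Pi_def)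

text \<open>The lowest term stays the product of A because A is commutative. Through the opposite
  product each one-sided argument yields the other side: the second distributive law, left inverses
  and left denominators.\<close>

lemma star_product_swap: "star_product K A (\<lambda>l a b. C l b a)"
proof (intro star_product.intro star_product_axioms.intro A.algebra_axioms)
  have "\<exists>k1 k2. bidiff_op K A k1 k2 (\<lambda>a b. C l b a)" for l
  proof -
    obtain k1 k2 where "bidiff_op K A k1 k2 (C l)"
      using star_product unfolding diff_star_product_def by blast
    then have "bidiff_op K A k2 k1 (\<lambda>a b. C l b a)" by (simp add: bidiff_op_def)
    then show ?thesis by blast
  qed
  then show "diff_star_product K A (\<lambda>l a b. C l b a)"
    unfolding diff_star_product_def Let_def star_algebra_simps
    using star_one by (auto simp: star_swap star_closed star_assoc C_0 A.m_comm)
qed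

lemma star_smult:
  assumes "c \<in> UNIV \<rightarrow> carrier K" "f \<in> UNIV \<rightarrow> carrier A" "h \<in> UNIV \<rightarrow> carrier A"
  shows "star A C (\<lambda>n. \<Oplus>\<^bsub>A\<^esub>i\<in>{..n}. c i \<odot>\<^bsub>A\<^esub> f (n - i)) h =
    (\<lambda>n. \<Oplus>\<^bsub>A\<^esub>i\<in>{..n}. c i \<odot>\<^bsub>A\<^esub> star A C f h (n - i))"
proof
  fix n
  have cl: "c i \<in> carrier K" "f i \<in> carrier A" "h i \<in> carrier A" for i using assms by auto
  have 1: "C l (\<Oplus>\<^bsub>A\<^esub>i\<in>{..p}. c i \<odot>\<^bsub>A\<^esub> f (p - i)) (h q) = (\<Oplus>\<^bsub>A\<^esub>i\<in>{..p}. c i \<odot>\<^bsub>A\<^esub> C l (f (p - i)) (h q))" for l p q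
    by (subst linear_map_finsum[OF A.algebra_axioms A.algebra_axioms C_linear(1)]) (auto simp: cl C_smult)
  have 2: "c i \<odot>\<^bsub>A\<^esub> finsum A (\<lambda>(l, p, q). C l (f p) (h q)) (triples m) =
      finsum A (\<lambda>(l, p, q). c i \<odot>\<^bsub>A\<^esub> C l (f p) (h q)) (triples m)" for i m
    by (subst A.finsum_smult_ldistr) (auto simp: cl intro!: A.M.finsum_cong')
  have "star A C (\<lambda>n. \<Oplus>\<^bsub>A\<^esub>i\<in>{..n}. c i \<odot>\<^bsub>A\<^esub> f (n - i)) h n =
      finsum A (\<lambda>(l, p, q). \<Oplus>\<^bsub>A\<^esub>i\<in>{..p}. c i \<odot>\<^bsub>A\<^esub> C l (f (p - i)) (h q)) (triples n)"
    by (simp add: star_def 1)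
  also have "\<dots> = (\<Oplus>\<^bsub>A\<^esub>i\<in>{..n}. finsum A (\<lambda>(l, p, q). c i \<odot>\<^bsub>A\<^esub> C l (f p) (h q)) (triples (n - i)))"
    by (rule A.M.finsum_triples_left[of "\<lambda>i l p q. c i \<odot>\<^bsub>A\<^esub> C l (f p) (h q)"]) (auto simp: cl)
  also have "\<dots> = (\<Oplus>\<^bsub>A\<^esub>i\<in>{..n}. c i \<odot>\<^bsub>A\<^esub> star A C f h (n - i))"
    by (simp add: star_def 2)
  finally show "star A C (\<lambda>n. \<Oplus>\<^bsub>A\<^esub>i\<in>{..n}. c i \<odot>\<^bsub>A\<^esub> f (n - i)) h n =
      (\<Oplus>\<^bsub>A\<^esub>i\<in>{..n}. c i \<odot>\<^bsub>A\<^esub> star A C f h (n - i))" .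
qed

lemma star_add:
  assumes "f \<in> UNIV \<rightarrow> carrier A" "h \<in> UNIV \<rightarrow> carrier A" "k \<in> UNIV \<rightarrow> carrier A"
  shows "star A C (\<lambda>n. f n \<oplus>\<^bsub>A\<^esub> h n) k = (\<lambda>n. star A C f k n \<oplus>\<^bsub>A\<^esub> star A C h k n)"
proof
  fix n
  have cl: "f i \<in> carrier A" "h i \<in> carrier A" "k i \<in> carrier A" for i using assms by auto
  show "star A C (\<lambda>n. f n \<oplus>\<^bsub>A\<^esub> h n) k n = star A C f k n \<oplus>\<^bsub>A\<^esub> star A C h k n"
    unfolding star_def
    by (subst A.M.finsum_addf[symmetric]) (auto simp: case_prod_unfold cl C_add)
qed

end

sublocale star_product \<subseteq> swap: star_product K A "\<lambda>l a b. C l b a"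
  by (rule star_product_swap)

context star_product
begin

lemma module_star: "module (ps_ring K) R"
proof (rule moduleI)
  show "cring (ps_ring K)" by (rule A.R.cring_ps_ring)
  show "abelian_group R"
  proof (rule abelian_groupI)
    fix f assume "f \<in> carrier R"
    then show "\<exists>h\<in>carrier R. h \<oplus>\<^bsub>R\<^esub> f = \<zero>\<^bsub>R\<^esub>"
      by (intro bexI[of _ "\<lambda>n. \<ominus>\<^bsub>A\<^esub> f n"]) (auto simp: star_algebra_simps A.l_neg Pi_def)
  qed (auto simp: star_algebra_simps Pi_def A.M.a_ac)
next
  fix c d f h
  assume "c \<in> carrier (ps_ring K)" "d \<in> carrier (ps_ring K)" "f \<in> carrier R" "h \<in> carrier R"
  then have cl: "c n \<in> carrier K" "d n \<in> carrier K" "f n \<in> carrier A" "h n \<in> carrier A" for n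
    by (auto simp: ps_ring_simps star_algebra_simps)
  show "c \<odot>\<^bsub>R\<^esub> f \<in> carrier R"
    using cl by (auto simp: star_algebra_simps intro!: A.M.finsum_closed)
  show "(c \<oplus>\<^bsub>ps_ring K\<^esub> d) \<odot>\<^bsub>R\<^esub> f = c \<odot>\<^bsub>R\<^esub> f \<oplus>\<^bsub>R\<^esub> d \<odot>\<^bsub>R\<^esub> f"
    using cl by (simp add: star_algebra_simps ps_ring_simps A.smult_l_distr A.M.finsum_addf Pi_def)
  show "c \<odot>\<^bsub>R\<^esub> (f \<oplus>\<^bsub>R\<^esub> h) = c \<odot>\<^bsub>R\<^esub> f \<oplus>\<^bsub>R\<^esub> c \<odot>\<^bsub>R\<^esub> h"
    using cl by (simp add: star_algebra_simps A.smult_r_distr A.M.finsum_addf Pi_def)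
  show "(c \<otimes>\<^bsub>ps_ring K\<^esub> d) \<odot>\<^bsub>R\<^esub> f = c \<odot>\<^bsub>R\<^esub> (d \<odot>\<^bsub>R\<^esub> f)"
  proof
    fix n
    have 1: "(\<Oplus>\<^bsub>K\<^esub>j\<in>{..i}. c j \<otimes>\<^bsub>K\<^esub> d (i - j)) \<odot>\<^bsub>A\<^esub> f (n - i) =
        (\<Oplus>\<^bsub>A\<^esub>j\<in>{..i}. c j \<odot>\<^bsub>A\<^esub> (d (i - j) \<odot>\<^bsub>A\<^esub> f (n - i)))" for i
      by (subst finsum_additive[OF A.R.abelian_monoid_axioms A.M.abelian_monoid_axioms])
        (auto simp: cl A.smult_l_distr A.smult_assoc1)
    have "((c \<otimes>\<^bsub>ps_ring K\<^esub> d) \<odot>\<^bsub>R\<^esub> f) n =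
        (\<Oplus>\<^bsub>A\<^esub>i\<in>{..n}. \<Oplus>\<^bsub>A\<^esub>j\<in>{..i}. c j \<odot>\<^bsub>A\<^esub> (d (i - j) \<odot>\<^bsub>A\<^esub> f (n - i)))"
      by (simp add: star_algebra_simps ps_ring_simps 1)
    also have "\<dots> = (\<Oplus>\<^bsub>A\<^esub>i\<in>{..n}. \<Oplus>\<^bsub>A\<^esub>j\<in>{..n - i}. c i \<odot>\<^bsub>A\<^esub> (d j \<odot>\<^bsub>A\<^esub> f (n - i - j)))"
      by (rule A.M.finsum_triangle) (auto simp: cl)
    also have "\<dots> = (c \<odot>\<^bsub>R\<^esub> (d \<odot>\<^bsub>R\<^esub> f)) n"
      unfolding star_algebra_simps
      by (intro A.M.finsum_cong') (auto simp: cl A.finsum_smult_ldistr intro!: A.M.finsum_closed)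
    finally show "((c \<otimes>\<^bsub>ps_ring K\<^esub> d) \<odot>\<^bsub>R\<^esub> f) n = (c \<odot>\<^bsub>R\<^esub> (d \<odot>\<^bsub>R\<^esub> f)) n" .
  qed
next
  fix f assume "f \<in> carrier R"
  then have cl: "f n \<in> carrier A" for n by (auto simp: star_algebra_simps)
  show "\<one>\<^bsub>ps_ring K\<^esub> \<odot>\<^bsub>R\<^esub> f = f"
  proof
    fix n show "(\<one>\<^bsub>ps_ring K\<^esub> \<odot>\<^bsub>R\<^esub> f) n = f n"
      using cl unfolding ps_ring_simps star_algebra_simps by (subst A.M.finsum_single[of _ 0]) auto
  qed
qed

lemma ring_star: "ring R"
proof (rule ringI)
  show "abelian_group R" using module_star by (simp add: module_def)
  show "monoid R"
    by (rule monoidI) (auto simp: star_algebra_simps star_closed star_assoc star_one intro: star_closed[THEN funcset_mem])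
  fix f h k assume "f \<in> carrier R" "h \<in> carrier R" "k \<in> carrier R"
  then show "(f \<oplus>\<^bsub>R\<^esub> h) \<otimes>\<^bsub>R\<^esub> k = f \<otimes>\<^bsub>R\<^esub> k \<oplus>\<^bsub>R\<^esub> h \<otimes>\<^bsub>R\<^esub> k"
    "k \<otimes>\<^bsub>R\<^esub> (f \<oplus>\<^bsub>R\<^esub> h) = k \<otimes>\<^bsub>R\<^esub> f \<oplus>\<^bsub>R\<^esub> k \<otimes>\<^bsub>R\<^esub> h"
    using swap.star_add[of f h k] by (auto simp: star_algebra_simps star_add star_swap Pi_def)
qed

lemma nc_algebra_star: "nc_algebra (ps_ring K) R"
proof (intro nc_algebra.intro module_star ring_star nc_algebra_axioms.intro)
  fix c f h assume *: "c \<in> carrier (ps_ring K)" "f \<in> carrier R" "h \<in> carrier R"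
  then have cl: "c n \<in> carrier K" "f n \<in> carrier A" "h n \<in> carrier A" for n
    by (auto simp: ps_ring_simps star_algebra_simps)
  show "(c \<odot>\<^bsub>R\<^esub> f) \<otimes>\<^bsub>R\<^esub> h = c \<odot>\<^bsub>R\<^esub> (f \<otimes>\<^bsub>R\<^esub> h)"
    using * by (simp add: star_algebra_simps ps_ring_simps star_smult)
  have "(\<lambda>n. \<Oplus>\<^bsub>A\<^esub>i\<in>{..n}. c i \<odot>\<^bsub>A\<^esub> h (n - i)) \<in> UNIV \<rightarrow> carrier A"
    using cl by (auto intro!: A.M.finsum_closed)
  then show "f \<otimes>\<^bsub>R\<^esub> (c \<odot>\<^bsub>R\<^esub> h) = c \<odot>\<^bsub>R\<^esub> (f \<otimes>\<^bsub>R\<^esub> h)"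
    using * swap.star_smult[of c h f] by (simp add: star_algebra_simps ps_ring_simps star_swap)
qed

text \<open>In \<open>star A C f h n\<close> the coefficient \<open>h n\<close> occurs only for the
  triple (0, 0, n), as the product of \<open>f 0\<close> and \<open>h n\<close>. Since
  \<open>f 0\<close> is a unit, the equations can be solved for \<open>h 0\<close>,
  \<open>h 1\<close> and so on in turn.\<close>

lemma ex_right_inverse:
  assumes f: "f \<in> carrier R" and f0: "f 0 \<in> Units A"
  shows "\<exists>h\<in>carrier R. f \<otimes>\<^bsub>R\<^esub> h = \<one>\<^bsub>R\<^esub>"
proof -
  \<comment> \<open>In all triples other than (0, 0, n) the index q is below n. The guard
    \<open>q < n\<close> therefore changes no term; it makes the dependence on earlier values
    visible for the recursion, and its default zero is never reached.\<close>
  let ?r = "\<lambda>h n. finsum A (\<lambda>(l, p, q). C l (f p) (if q < n then h q else \<zero>\<^bsub>A\<^esub>)) (triples n - {(0, 0, n)})"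
  let ?\<Phi> = "\<lambda>h n. inv\<^bsub>A\<^esub> (f 0) \<otimes>\<^bsub>A\<^esub> (\<one>\<^bsub>R\<^esub> n \<ominus>\<^bsub>A\<^esub> ?r h n)"
  define h where "h = wfrec less_than ?\<Phi>"
  have cl: "f n \<in> carrier A" for n using f by (auto simp: star_algebra_simps)
  have one: "\<one>\<^bsub>R\<^esub> n \<in> carrier A" for n by (simp add: star_algebra_simps)
  have locality: "?\<Phi> h n = ?\<Phi> h' n" if "\<And>z. z < n \<Longrightarrow> h z = h' z" for h h' n
  proof -
    have "(if q < n then h q else \<zero>\<^bsub>A\<^esub>) = (if q < n then h' q else \<zero>\<^bsub>A\<^esub>)" for q using that by simp
    then show "?\<Phi> h n = ?\<Phi> h' n" by (simp only:)
  qed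
  have "adm_wf less_than ?\<Phi>" unfolding adm_wf_def by (intro allI impI, rule locality) simp
  then have "h = ?\<Phi> h"
    unfolding h_def by (rule wfrec_fixpoint[OF wf_less_than])
  then have h: "h n = ?\<Phi> h n" for n by (rule fun_cong)
  have r_closed: "?r h n \<in> carrier A" if "\<And>q. q < n \<Longrightarrow> h q \<in> carrier A" for n
    using that by (intro A.M.finsum_closed) (auto simp: cl)
  have h_closed: "h n \<in> carrier A" for n
  proof (induction n rule: less_induct)
    case (less n)
    show ?case using r_closed[OF less] one f0 by (subst h) simp
  qed
  have "star A C f h n = \<one>\<^bsub>R\<^esub> n" for n
  proof -
    have "star A C f h n = finsum A (\<lambda>(l, p, q). C l (f p) (h q)) (insert (0, 0, n) (triples n - {(0, 0, n)}))"
      unfolding star_def by (rule arg_cong[where f = "finsum A _"]) auto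
    also have "\<dots> = C 0 (f 0) (h n) \<oplus>\<^bsub>A\<^esub> finsum A (\<lambda>(l, p, q). C l (f p) (h q)) (triples n - {(0, 0, n)})"
      by (subst A.M.finsum_insert) (auto simp: cl h_closed)
    also have "finsum A (\<lambda>(l, p, q). C l (f p) (h q)) (triples n - {(0, 0, n)}) = ?r h n"
      by (rule A.M.finsum_cong') (auto simp: cl h_closed split: if_split_asm)
    also have "C 0 (f 0) (h n) = \<one>\<^bsub>R\<^esub> n \<ominus>\<^bsub>A\<^esub> ?r h n"
      using h_closed cl f0 one r_closed[OF h_closed]
      by (subst h) (simp add: C_0 A.m_assoc[symmetric] A.Units_r_inv del: A.Units_inv_Units)
    also have "\<dots> \<oplus>\<^bsub>A\<^esub> ?r h n = \<one>\<^bsub>R\<^esub> n"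
      using one r_closed[OF h_closed] by (simp add: A.M.minus_eq A.M.a_assoc A.M.l_neg)
    finally show ?thesis .
  qed
  then show ?thesis using h_closed by (intro bexI[of _ h]) (auto simp: star_algebra_simps)
qed

lemma Units_star:
  assumes f: "f \<in> carrier R" and f0: "f 0 \<in> Units A"
  shows "f \<in> Units R"
proof -
  interpret R: ring R by (rule ring_star)
  obtain h where h: "h \<in> carrier R" "f \<otimes>\<^bsub>R\<^esub> h = \<one>\<^bsub>R\<^esub>" using ex_right_inverse[OF assms] by blast
  \<comment> \<open>A right inverse for the opposite product is a left inverse for the given
    one.\<close>
  obtain k where k: "k \<in> carrier R" "k \<otimes>\<^bsub>R\<^esub> f = \<one>\<^bsub>R\<^esub>"
    using star_product.ex_right_inverse[OF star_product_swap, of f] f f0 by (auto simp: star_algebra_simps star_swap)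
  have "k = h" using R.inv_unique[OF k(2) h(2)] f h k by simp
  then show ?thesis using f h k by (auto simp: Units_def)
qed

end

section \<open>Noncommutative localization by right fractions\<close>

text \<open>T is a ring of right fractions of R at S: elements of S become units, the kernel is
  right S-torsion, and all elements have the form \<open>g r\<close> times the inverse of
  \<open>g s\<close>. The Ore condition is derived from this.\<close>

locale fraction_algebra = R: nc_algebra L R + T: nc_algebra L T for L R T +
  fixes S g
  assumes submonoid: "submonoid S R"
    and g_hom: "g \<in> alg_hom L R T"
    and S_unit: "s \<in> S \<Longrightarrow> g s \<in> Units T"
    and ker: "\<lbrakk>r \<in> carrier R; g r = \<zero>\<^bsub>T\<^esub>\<rbrakk> \<Longrightarrow> \<exists>s\<in>S. r \<otimes>\<^bsub>R\<^esub> s = \<zero>\<^bsub>R\<^esub>"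
    and ex_fraction: "t \<in> carrier T \<Longrightarrow> \<exists>s\<in>S. \<exists>r\<in>carrier R. t \<otimes>\<^bsub>T\<^esub> g s = g r"
begin

lemma S_closed: "s \<in> S \<Longrightarrow> s \<in> carrier R"
  and S_mult: "\<lbrakk>s \<in> S; t \<in> S\<rbrakk> \<Longrightarrow> s \<otimes>\<^bsub>R\<^esub> t \<in> S"
  and S_one: "\<one>\<^bsub>R\<^esub> \<in> S"
  using submonoid by (auto simp: submonoid_def)

lemma g_ring_hom: "g \<in> ring_hom R T"
  using g_hom by (simp add: alg_hom_def)

lemmas g_closed = ring_hom_closed[OF g_ring_hom]
  and g_add = ring_hom_add[OF g_ring_hom]
  and g_mult = ring_hom_mult[OF g_ring_hom]
  and g_zero = ring_hom_zero[OF g_ring_hom R.ring_axioms T.ring_axioms]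

lemma ex_annihilator:
  assumes "x \<in> carrier R" "y \<in> carrier R" "g x = g y"
  shows "\<exists>s\<in>S. x \<otimes>\<^bsub>R\<^esub> s = y \<otimes>\<^bsub>R\<^esub> s"
proof -
  interpret ring_hom_ring R T g
    by (intro ring_hom_ring.intro ring_hom_ring_axioms.intro g_ring_hom R.ring_axioms T.ring_axioms)
  have "g (x \<ominus>\<^bsub>R\<^esub> y) = \<zero>\<^bsub>T\<^esub>"
    using assms g_closed[of y] by (simp add: R.M.minus_eq T.M.r_neg)
  then obtain s where s: "s \<in> S" "(x \<ominus>\<^bsub>R\<^esub> y) \<otimes>\<^bsub>R\<^esub> s = \<zero>\<^bsub>R\<^esub>"
    using ker[of "x \<ominus>\<^bsub>R\<^esub> y"] assms by auto
  have "x \<otimes>\<^bsub>R\<^esub> s \<ominus>\<^bsub>R\<^esub> y \<otimes>\<^bsub>R\<^esub> s = \<zero>\<^bsub>R\<^esub>"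
    using s assms S_closed[of s] by (simp add: R.M.minus_eq R.l_distr R.l_minus)
  then show ?thesis using s assms S_closed[of s] by auto
qed

text \<open>The left fraction of r by s, formed in T, is also a right fraction of some r1 by some
  s1. Then r s1 and s r1 have the same image, and a further factor s2 on the right makes them equal
  in R.\<close>

lemma right_ore:
  assumes r: "r \<in> carrier R" and s: "s \<in> S"
  shows "\<exists>r'\<in>carrier R. \<exists>s'\<in>S. r \<otimes>\<^bsub>R\<^esub> s' = s \<otimes>\<^bsub>R\<^esub> r'"
proof -
  have u: "g s \<in> Units T" "s \<in> carrier R" using S_unit s S_closed by auto
  let ?t = "inv\<^bsub>T\<^esub> (g s) \<otimes>\<^bsub>T\<^esub> g r"
  have t: "?t \<in> carrier T" "g s \<otimes>\<^bsub>T\<^esub> ?t = g r"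
    using u r g_closed by (auto simp: T.m_assoc[symmetric] T.Units_r_inv)
  obtain s1 r1 where 1: "s1 \<in> S" "r1 \<in> carrier R" "?t \<otimes>\<^bsub>T\<^esub> g s1 = g r1" using ex_fraction[OF t(1)] by blast
  have s1: "s1 \<in> carrier R" "g s1 \<in> carrier T" using S_closed 1 g_closed by auto
  have "g (r \<otimes>\<^bsub>R\<^esub> s1) = (g s \<otimes>\<^bsub>T\<^esub> ?t) \<otimes>\<^bsub>T\<^esub> g s1" unfolding t(2) using r s1 by (simp add: g_mult)
  also have "\<dots> = g (s \<otimes>\<^bsub>R\<^esub> r1)"
    using u 1 s1 t(1) g_closed[of s] by (simp add: T.m_assoc g_mult)
  finally have "g (r \<otimes>\<^bsub>R\<^esub> s1) = g (s \<otimes>\<^bsub>R\<^esub> r1)" .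
  then obtain s2 where 2: "s2 \<in> S" "r \<otimes>\<^bsub>R\<^esub> s1 \<otimes>\<^bsub>R\<^esub> s2 = s \<otimes>\<^bsub>R\<^esub> r1 \<otimes>\<^bsub>R\<^esub> s2"
    using ex_annihilator[of "r \<otimes>\<^bsub>R\<^esub> s1" "s \<otimes>\<^bsub>R\<^esub> r1"] r u s1 1 by auto
  show ?thesis
    by (intro bexI[of _ "r1 \<otimes>\<^bsub>R\<^esub> s2"] bexI[of _ "s1 \<otimes>\<^bsub>R\<^esub> s2"])
      (use 1 2 r u s1 S_mult S_closed[of s2] in \<open>auto simp: R.m_assoc\<close>)
qed

text \<open>For condition (b): s r = 0 forces \<open>g r = 0\<close> because \<open>g s\<close> is a
  unit, and the kernel property gives the annihilator on the right.\<close>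

lemma right_denominator_set: "right_denominator_set R S"
  unfolding right_denominator_set_def
proof (intro conjI ballI impI submonoid right_ore)
  fix r s assume *: "r \<in> carrier R" "s \<in> S" "s \<otimes>\<^bsub>R\<^esub> r = \<zero>\<^bsub>R\<^esub>"
  then have "g s \<otimes>\<^bsub>T\<^esub> g r = g s \<otimes>\<^bsub>T\<^esub> \<zero>\<^bsub>T\<^esub>"
    using g_mult[of s r] g_zero S_closed[of s] g_closed[of s] by (metis T.r_null)
  then have "g r = \<zero>\<^bsub>T\<^esub>"
    using T.Units_l_cancel[OF S_unit[OF *(2)] g_closed[OF *(1)] T.zero_closed] by simp
  then show "\<exists>s\<in>S. r \<otimes>\<^bsub>R\<^esub> s = \<zero>\<^bsub>R\<^esub>" using ker * by blast
qed

text \<open>Injectivity requires knowing that every element of the abstract localization is a right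
  fraction, which is shown by induction on terms; the kernel property of g then applies to the
  numerator. Surjectivity holds because the elements of T are right fractions.\<close>

lemma induced_morphism_iso:
  assumes \<Phi>: "induced_morphism L R S T g \<Phi>"
  shows "\<Phi> \<in> alg_iso L (nc_loc L R S) T"
proof -
  let ?L = "nc_loc L R S"
  let ?\<iota> = "nc_loc_map L R S"
  have R_alg: "nc_algebra L R" by (rule R.nc_algebra_axioms)
  interpret L: nc_algebra L ?L by (rule nc_loc_nc_algebra[OF R_alg])
  have S_sub: "S \<subseteq> carrier R" using S_closed by blast
  have \<iota>_hom: "?\<iota> \<in> alg_hom L R ?L" by (rule nc_loc_map_hom[OF R_alg])
  then have \<iota>_ring_hom: "?\<iota> \<in> ring_hom R ?L" by (simp add: alg_hom_def)
  have \<iota>_smult: "?\<iota> (c \<odot>\<^bsub>R\<^esub> x) = c \<odot>\<^bsub>?L\<^esub> ?\<iota> x" if "c \<in> carrier L" "x \<in> carrier R" for c x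
    using \<iota>_hom that by (simp add: alg_hom_def)
  note \<iota>_closed = ring_hom_closed[OF \<iota>_ring_hom]
    and \<iota>_add = ring_hom_add[OF \<iota>_ring_hom]
    and \<iota>_mult = ring_hom_mult[OF \<iota>_ring_hom]
    and \<iota>_one = ring_hom_one[OF \<iota>_ring_hom]
    and \<iota>_zero = ring_hom_zero[OF \<iota>_ring_hom R.ring_axioms L.ring_axioms]
  have \<iota>_unit: "?\<iota> s \<in> Units ?L" if "s \<in> S" for s
    by (rule nc_loc_map_Units[OF R_alg S_sub that])
  have \<Phi>_hom: "\<Phi> \<in> alg_hom L ?L T" and \<Phi>_\<iota>: "\<And>r. r \<in> carrier R \<Longrightarrow> \<Phi> (?\<iota> r) = g r"
    using \<Phi> by (auto simp: induced_morphism_def)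
  then have \<Phi>_ring_hom: "\<Phi> \<in> ring_hom ?L T" by (simp add: alg_hom_def)
  interpret \<Phi>: ring_hom_ring ?L T \<Phi>
    by (intro ring_hom_ring.intro ring_hom_ring_axioms.intro \<Phi>_ring_hom L.ring_axioms T.ring_axioms)
  define P where "P x \<longleftrightarrow> (\<exists>s\<in>S. \<exists>r\<in>carrier R. x \<otimes>\<^bsub>?L\<^esub> ?\<iota> s = ?\<iota> r)" for x
  have P: "P (loc_class L R S t)" if "t \<in> loc_terms L R S" for t
    using that
  proof induction
    case (Emb r)
    have "?\<iota> r \<otimes>\<^bsub>?L\<^esub> ?\<iota> \<one>\<^bsub>R\<^esub> = ?\<iota> r" using \<iota>_closed[OF Emb] by (simp add: \<iota>_one)
    then show ?case unfolding P_def nc_loc_map_def[symmetric] using S_one Emb by blast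
  next
    case (Inv s)
    have s: "s \<in> carrier R" using Inv S_closed by simp
    have t: "Emb s \<in> loc_terms L R S" "loc_term.Inv s \<in> loc_terms L R S"
      using Inv s by (auto intro: loc_terms.intros)
    have "loc_class L R S (loc_term.Inv s) \<otimes>\<^bsub>?L\<^esub> ?\<iota> s = ?\<iota> \<one>\<^bsub>R\<^esub>"
      using t loc_class_cong[OF loc_eq.Inv_left[OF Inv, of L R]] by (simp add: nc_loc_map_def nc_loc_simps)
    then show ?case unfolding P_def using Inv by blast
  next
    case (Add t u)
    let ?x = "loc_class L R S t" and ?y = "loc_class L R S u"
    have xy: "?x \<in> carrier ?L" "?y \<in> carrier ?L" using Add.hyps by (auto simp: nc_loc_carrier)
    obtain s r where 1: "s \<in> S" "r \<in> carrier R" "?x \<otimes>\<^bsub>?L\<^esub> ?\<iota> s = ?\<iota> r" using Add.IH unfolding P_def by blast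
    obtain s' r' where 2: "s' \<in> S" "r' \<in> carrier R" "?y \<otimes>\<^bsub>?L\<^esub> ?\<iota> s' = ?\<iota> r'" using Add.IH unfolding P_def by blast
    have cl: "s \<in> carrier R" "s' \<in> carrier R" using 1 2 S_closed by auto
    \<comment> \<open>The Ore condition supplies a common right multiple s' s1 = s r1 of the two
      denominators.\<close>
    obtain r1 s1 where 3: "r1 \<in> carrier R" "s1 \<in> S" "s' \<otimes>\<^bsub>R\<^esub> s1 = s \<otimes>\<^bsub>R\<^esub> r1"
      using right_ore[OF cl(2) 1(1)] by blast
    have s1: "s1 \<in> carrier R" using 3 S_closed by simp
    have \<iota>cl: "?\<iota> s \<in> carrier ?L" "?\<iota> s' \<in> carrier ?L" "?\<iota> s1 \<in> carrier ?L" "?\<iota> r1 \<in> carrier ?L"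
      using cl s1 3 \<iota>_closed by auto
    have x: "?x \<otimes>\<^bsub>?L\<^esub> ?\<iota> (s' \<otimes>\<^bsub>R\<^esub> s1) = ?\<iota> (r \<otimes>\<^bsub>R\<^esub> r1)"
      unfolding 3(3) using cl 1 3 \<iota>cl xy by (simp add: \<iota>_mult L.m_assoc[symmetric])
    have y: "?y \<otimes>\<^bsub>?L\<^esub> ?\<iota> (s' \<otimes>\<^bsub>R\<^esub> s1) = ?\<iota> (r' \<otimes>\<^bsub>R\<^esub> s1)"
      using cl 2 s1 \<iota>cl xy by (simp add: \<iota>_mult L.m_assoc[symmetric])
    have "(?x \<oplus>\<^bsub>?L\<^esub> ?y) \<otimes>\<^bsub>?L\<^esub> ?\<iota> (s' \<otimes>\<^bsub>R\<^esub> s1) = ?\<iota> (r \<otimes>\<^bsub>R\<^esub> r1 \<oplus>\<^bsub>R\<^esub> r' \<otimes>\<^bsub>R\<^esub> s1)"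
      using x y xy cl s1 1 2 3 \<iota>_closed[of "s' \<otimes>\<^bsub>R\<^esub> s1"] by (simp add: L.l_distr \<iota>_add)
    moreover have "?x \<oplus>\<^bsub>?L\<^esub> ?y = loc_class L R S (Add t u)" using Add.hyps by (simp add: nc_loc_simps)
    ultimately show ?case
      unfolding P_def using S_mult[OF 2(1) 3(2)] 1 2 3 s1
      by (intro bexI[of _ "s' \<otimes>\<^bsub>R\<^esub> s1"] bexI[of _ "r \<otimes>\<^bsub>R\<^esub> r1 \<oplus>\<^bsub>R\<^esub> r' \<otimes>\<^bsub>R\<^esub> s1"]) auto
  next
    case (Mul t u)
    let ?x = "loc_class L R S t" and ?y = "loc_class L R S u"
    have xy: "?x \<in> carrier ?L" "?y \<in> carrier ?L" using Mul.hyps by (auto simp: nc_loc_carrier)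
    obtain s r where 1: "s \<in> S" "r \<in> carrier R" "?x \<otimes>\<^bsub>?L\<^esub> ?\<iota> s = ?\<iota> r" using Mul.IH unfolding P_def by blast
    obtain s' r' where 2: "s' \<in> S" "r' \<in> carrier R" "?y \<otimes>\<^bsub>?L\<^esub> ?\<iota> s' = ?\<iota> r'" using Mul.IH unfolding P_def by blast
    have cl: "s \<in> carrier R" "s' \<in> carrier R" using 1 2 S_closed by auto
    \<comment> \<open>The Ore condition moves the numerator r' of the second factor across the
      denominator s of the first: x y s' s1 = x r' s1 = x s r1 = r r1.\<close>
    obtain r1 s1 where 3: "r1 \<in> carrier R" "s1 \<in> S" "r' \<otimes>\<^bsub>R\<^esub> s1 = s \<otimes>\<^bsub>R\<^esub> r1"
      using right_ore[OF 2(2) 1(1)] by blast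
    have s1: "s1 \<in> carrier R" using 3 S_closed by simp
    have \<iota>cl: "?\<iota> s \<in> carrier ?L" "?\<iota> s' \<in> carrier ?L" "?\<iota> s1 \<in> carrier ?L" "?\<iota> r1 \<in> carrier ?L"
      using cl s1 3 \<iota>_closed by auto
    have "(?x \<otimes>\<^bsub>?L\<^esub> ?y) \<otimes>\<^bsub>?L\<^esub> ?\<iota> (s' \<otimes>\<^bsub>R\<^esub> s1) = ?x \<otimes>\<^bsub>?L\<^esub> ((?y \<otimes>\<^bsub>?L\<^esub> ?\<iota> s') \<otimes>\<^bsub>?L\<^esub> ?\<iota> s1)"
      using xy cl s1 \<iota>cl by (simp add: \<iota>_mult L.m_assoc)
    also have "\<dots> = ?x \<otimes>\<^bsub>?L\<^esub> ?\<iota> (s \<otimes>\<^bsub>R\<^esub> r1)"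
      unfolding 2(3) 3(3)[symmetric] using 2 s1 by (simp add: \<iota>_mult)
    also have "\<dots> = (?x \<otimes>\<^bsub>?L\<^esub> ?\<iota> s) \<otimes>\<^bsub>?L\<^esub> ?\<iota> r1"
      using cl 3 xy \<iota>cl by (simp add: \<iota>_mult L.m_assoc)
    also have "\<dots> = ?\<iota> (r \<otimes>\<^bsub>R\<^esub> r1)" using 1 3 by (simp add: \<iota>_mult)
    finally have "(?x \<otimes>\<^bsub>?L\<^esub> ?y) \<otimes>\<^bsub>?L\<^esub> ?\<iota> (s' \<otimes>\<^bsub>R\<^esub> s1) = ?\<iota> (r \<otimes>\<^bsub>R\<^esub> r1)" .
    moreover have "?x \<otimes>\<^bsub>?L\<^esub> ?y = loc_class L R S (Mul t u)" using Mul.hyps by (simp add: nc_loc_simps)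
    ultimately show ?case
      unfolding P_def using S_mult[OF 2(1) 3(2)] 1 3
      by (intro bexI[of _ "s' \<otimes>\<^bsub>R\<^esub> s1"] bexI[of _ "r \<otimes>\<^bsub>R\<^esub> r1"]) auto
  next
    case (Smul c t)
    let ?x = "loc_class L R S t"
    have x: "?x \<in> carrier ?L" using Smul.hyps by (auto simp: nc_loc_carrier)
    obtain s r where 1: "s \<in> S" "r \<in> carrier R" "?x \<otimes>\<^bsub>?L\<^esub> ?\<iota> s = ?\<iota> r" using Smul.IH unfolding P_def by blast
    have "(c \<odot>\<^bsub>?L\<^esub> ?x) \<otimes>\<^bsub>?L\<^esub> ?\<iota> s = ?\<iota> (c \<odot>\<^bsub>R\<^esub> r)"
      using 1 x Smul.hyps \<iota>_closed[OF S_closed[OF 1(1)]] by (simp add: L.smult_mult_left \<iota>_smult)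
    moreover have "c \<odot>\<^bsub>?L\<^esub> ?x = loc_class L R S (Smul c t)" using Smul.hyps by (simp add: nc_loc_simps)
    ultimately show ?case
      unfolding P_def using 1 Smul.hyps by (intro bexI[of _ s] bexI[of _ "c \<odot>\<^bsub>R\<^esub> r"]) auto
  qed
  have ker_\<Phi>: "x = \<zero>\<^bsub>?L\<^esub>" if x: "x \<in> carrier ?L" "\<Phi> x = \<zero>\<^bsub>T\<^esub>" for x
  proof -
    obtain s r where 1: "s \<in> S" "r \<in> carrier R" "x \<otimes>\<^bsub>?L\<^esub> ?\<iota> s = ?\<iota> r"
      using P x(1) unfolding P_def nc_loc_carrier by blast
    have s: "s \<in> carrier R" "?\<iota> s \<in> carrier ?L" using 1 S_closed \<iota>_closed by auto
    have "g r = \<Phi> x \<otimes>\<^bsub>T\<^esub> g s" using \<Phi>.hom_mult[OF x(1) s(2)] 1 s \<Phi>_\<iota> by simp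
    then have "g r = \<zero>\<^bsub>T\<^esub>" using x s g_closed by simp
    then obtain s' where 2: "s' \<in> S" "r \<otimes>\<^bsub>R\<^esub> s' = \<zero>\<^bsub>R\<^esub>" using ker 1 by blast
    have s': "s' \<in> carrier R" "?\<iota> s' \<in> carrier ?L" using 2 S_closed \<iota>_closed by auto
    \<comment> \<open>Annihilating the numerator annihilates x times the unit that comes from s s',
      hence x itself.\<close>
    have "x \<otimes>\<^bsub>?L\<^esub> ?\<iota> (s \<otimes>\<^bsub>R\<^esub> s') = \<zero>\<^bsub>?L\<^esub>"
      using x s s' 1 2 by (simp add: \<iota>_mult L.m_assoc[symmetric]) (simp add: \<iota>_mult[symmetric] \<iota>_zero)
    then have "x \<otimes>\<^bsub>?L\<^esub> ?\<iota> (s \<otimes>\<^bsub>R\<^esub> s') \<otimes>\<^bsub>?L\<^esub> inv\<^bsub>?L\<^esub> (?\<iota> (s \<otimes>\<^bsub>R\<^esub> s')) = \<zero>\<^bsub>?L\<^esub>"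
      using \<iota>_unit[OF S_mult[OF 1(1) 2(1)]] by simp
    then show ?thesis
      using x \<iota>_unit[OF S_mult[OF 1(1) 2(1)]] by (simp add: L.m_assoc L.Units_r_inv L.Units_closed)
  qed
  have "inj_on \<Phi> (carrier ?L)"
  proof (rule inj_onI)
    fix x y assume xy: "x \<in> carrier ?L" "y \<in> carrier ?L" "\<Phi> x = \<Phi> y"
    have "\<Phi> (x \<ominus>\<^bsub>?L\<^esub> y) = \<zero>\<^bsub>T\<^esub>"
      using xy \<Phi>.hom_closed[OF xy(2)] by (simp add: L.M.minus_eq T.M.r_neg)
    then have "x \<ominus>\<^bsub>?L\<^esub> y = \<zero>\<^bsub>?L\<^esub>" using ker_\<Phi>[of "x \<ominus>\<^bsub>?L\<^esub> y"] xy by simp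
    then show "x = y" using xy by simp
  qed
  moreover have "t \<in> \<Phi> ` carrier ?L" if t: "t \<in> carrier T" for t
  proof -
    obtain s r where 1: "s \<in> S" "r \<in> carrier R" "t \<otimes>\<^bsub>T\<^esub> g s = g r" using ex_fraction[OF t] by blast
    have s: "s \<in> carrier R" "?\<iota> s \<in> carrier ?L" "?\<iota> r \<in> carrier ?L" "?\<iota> s \<in> Units ?L" "g s \<in> Units T"
      using 1 S_closed \<iota>_closed \<iota>_unit S_unit by auto
    let ?x = "?\<iota> r \<otimes>\<^bsub>?L\<^esub> inv\<^bsub>?L\<^esub> (?\<iota> s)"
    have x: "?x \<in> carrier ?L" "?x \<otimes>\<^bsub>?L\<^esub> ?\<iota> s = ?\<iota> r" using s by (auto simp: L.m_assoc L.Units_l_inv)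
    have eq: "\<Phi> ?x \<otimes>\<^bsub>T\<^esub> g s = t \<otimes>\<^bsub>T\<^esub> g s"
      using \<Phi>.hom_mult[OF x(1) s(2)] x s 1 \<Phi>_\<iota> by simp
    have "y \<otimes>\<^bsub>T\<^esub> g s \<otimes>\<^bsub>T\<^esub> inv\<^bsub>T\<^esub> (g s) = y" if "y \<in> carrier T" for y
      using that s by (simp add: T.m_assoc T.Units_r_inv T.Units_closed)
    then have "\<Phi> ?x = t" using eq \<Phi>.hom_closed[OF x(1)] t by metis
    then show ?thesis using x(1) by blast
  qed
  ultimately show ?thesis
    using \<Phi>_hom \<Phi>.hom_closed by (auto simp: alg_iso_def bij_betw_def)
qed

end

section \<open>Localization of a star product\<close>

lemma bidiff_op_diff_along:
  assumes "algebra K B" "bidiff_op K B k\<^sub>1 k\<^sub>2 E"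
  shows "\<exists>k. (\<forall>b\<in>carrier B. diff_along B B (\<lambda>x. x) k (\<lambda>a. E a b)) \<and> (\<forall>a\<in>carrier B. diff_along B B (\<lambda>x. x) k (E a))"
proof -
  interpret algebra K B by fact
  interpret algebra_map K B B "\<lambda>x. x" by (rule algebra_map_id)
  have *: "\<And>b. b \<in> carrier B \<Longrightarrow> D (Suc k\<^sub>1) (\<lambda>a. E a b)" "\<And>a. a \<in> carrier B \<Longrightarrow> D (Suc k\<^sub>2) (E a)"
    using assms(2) unfolding bidiff_op_iff by blast+
  show ?thesis
    by (intro exI[of _ "max (Suc k\<^sub>1) (Suc k\<^sub>2)"] conjI ballI D_mono[OF *(1)] D_mono[OF *(2)]) auto
qed

text \<open>E is constrained by its two properties alone. This admits the operators picked by
  \<open>loc_bidiff\<close> and also the pair C, E with exchanged arguments, from which the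
  left-handed result is read off.\<close>

locale star_localization = localization_map K A B g S + star_product K A C for K A B g S C +
  fixes E
  assumes E_bidiff: "\<exists>k\<^sub>1 k\<^sub>2. bidiff_op K B k\<^sub>1 k\<^sub>2 (E l)"
    and E_compat: "\<lbrakk>a \<in> carrier A; b \<in> carrier A\<rbrakk> \<Longrightarrow> g (C l a b) = E l (g a) (g b)"
    and sigma_CM: "sigma_CM A S"
begin

abbreviation "T \<equiv> star_algebra B E"

lemma E_linear:
  "b \<in> carrier B \<Longrightarrow> endo.lin (\<lambda>a. E l a b)"
  "a \<in> carrier B \<Longrightarrow> endo.lin (E l a)"
proof -
  obtain k1 k2 where "bidiff_op K B k1 k2 (E l)" using E_bidiff by blast
  then show "b \<in> carrier B \<Longrightarrow> endo.lin (\<lambda>a. E l a b)" "a \<in> carrier B \<Longrightarrow> endo.lin (E l a)"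
    unfolding bidiff_op_iff by blast+
qed

lemma E_diff: "\<exists>k. (\<forall>b\<in>carrier B. endo.D k (\<lambda>a. E l a b)) \<and> (\<forall>a\<in>carrier B. endo.D k (E l a))"
  using E_bidiff[of l] by (blast intro: bidiff_op_diff_along[OF B.algebra_axioms])

lemma C_diff: "\<exists>k. (\<forall>b\<in>carrier A. diff_along A A (\<lambda>x. x) k (\<lambda>a. C l a b)) \<and>
    (\<forall>a\<in>carrier A. diff_along A A (\<lambda>x. x) k (C l a))"
proof -
  obtain k1 k2 where "bidiff_op K A k1 k2 (C l)"
    using star_product unfolding diff_star_product_def by blast
  then show ?thesis by (rule bidiff_op_diff_along[OF A.algebra_axioms])
qed

lemma E_closed: "\<lbrakk>a \<in> carrier B; b \<in> carrier B\<rbrakk> \<Longrightarrow> E l a b \<in> carrier B"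
  using linear_map_closed[OF E_linear(2)] by blast

lemma starB_closed:
  "\<lbrakk>f \<in> UNIV \<rightarrow> carrier B; h \<in> UNIV \<rightarrow> carrier B\<rbrakk> \<Longrightarrow> star B E f h \<in> UNIV \<rightarrow> carrier B"
  unfolding star_def by (auto simp: Pi_def E_closed intro!: B.M.finsum_closed)

abbreviation "\<eta> \<equiv> \<lambda>f (n :: nat). g (f n)"

lemma eta_closed: "f \<in> UNIV \<rightarrow> carrier A \<Longrightarrow> \<eta> f \<in> UNIV \<rightarrow> carrier B"
  using g_closed by auto

lemma eta_star:
  assumes "f \<in> UNIV \<rightarrow> carrier A" "h \<in> UNIV \<rightarrow> carrier A"
  shows "\<eta> (star A C f h) = star B E (\<eta> f) (\<eta> h)"
proof
  fix n
  have cl: "f i \<in> carrier A" "h i \<in> carrier A" for i using assms by auto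
  show "g (star A C f h n) = star B E (\<eta> f) (\<eta> h) n"
    unfolding star_def
    by (subst linear_map_finsum[OF A.algebra_axioms B.algebra_axioms g_linear])
      (auto simp: cl case_prod_unfold E_compat)
qed

text \<open>The commutator of the restriction of \<open>\<psi>\<close> with a is the restriction of
  the commutator of \<open>\<psi>\<close> with g a.\<close>

lemma D_comp_along:
  "endo.D n \<psi> \<Longrightarrow> D n (\<lambda>a. \<psi> (g a))"
proof (induction n arbitrary: \<psi>)
  case 0
  then show ?case using g_closed by simp
next
  case (Suc n)
  have "D n (adg a (\<lambda>a. \<psi> (g a)))" if a: "a \<in> carrier A" for a
  proof (rule D_eqI)
    show "D n (\<lambda>b. endo.adg (g a) \<psi> (g b))"
      by (rule Suc.IH) (use Suc.prems a g_closed in auto)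
  qed (use a g_mult in \<open>auto simp: ad_along_def\<close>)
  then show ?case by simp
qed

text \<open>The order may grow with n, since the coefficient of index n of a star product involves
  \<open>E l\<close> for all l up to n. Series are compared coefficient by coefficient, so each
  coefficient has its own order.\<close>

definition diff_series
  where "diff_series \<Phi> \<longleftrightarrow> (\<forall>n :: nat. endo.lin (\<lambda>x. \<Phi> x n) \<and> (\<exists>k. endo.D k (\<lambda>x. \<Phi> x n)))"

lemma diff_seriesD:
  assumes "diff_series \<Phi>"
  shows "endo.lin (\<lambda>x. \<Phi> x n)" "\<exists>k. endo.D k (\<lambda>x. \<Phi> x n)"
  using assms by (auto simp: diff_series_def)

lemma diff_series_eq:
  assumes \<Phi>: "diff_series \<Phi>" and \<Psi>: "diff_series \<Psi>"
    and eq: "\<And>a. a \<in> carrier A \<Longrightarrow> \<Phi> (g a) = \<Psi> (g a)" and x: "x \<in> carrier B"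
  shows "\<Phi> x = \<Psi> x"
proof
  fix n
  obtain k where k: "endo.D k (\<lambda>x. \<Phi> x n)" using diff_seriesD(2)[OF \<Phi>] by blast
  obtain l where l: "endo.D l (\<lambda>x. \<Psi> x n)" using diff_seriesD(2)[OF \<Psi>] by blast
  show "\<Phi> x n = \<Psi> x n"
    by (rule eq_if_eq_on_image[OF k l _ _ _ x])
      (use eq linear_map_closed[OF diff_seriesD(1)[OF \<Phi>]] linear_map_closed[OF diff_seriesD(1)[OF \<Psi>]] in auto)
qed

lemma lin_finsum:
  assumes "finite I" "\<And>i. i \<in> I \<Longrightarrow> endo.lin (\<phi> i)"
  shows "endo.lin (\<lambda>x. finsum B (\<lambda>i. \<phi> i x) I)"
  using assms
proof (induction I)
  case empty
  show ?case by (rule linear_mapI) auto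
next
  case (insert i I)
  have "endo.lin (\<lambda>x. \<phi> i x \<oplus>\<^bsub>B\<^esub> finsum B (\<lambda>i. \<phi> i x) I)"
    using insert by (intro endo.lin_add) auto
  then show ?case
    by (rule linear_map_cong[OF B.algebra_axioms])
      (use insert linear_map_closed[OF insert.prems] in \<open>auto simp: Pi_def B.M.finsum_insert\<close>)
qed

lemma diff_series_finsum:
  assumes "\<And>n. finite (I n)"
    and lin: "\<And>n i. i \<in> I n \<Longrightarrow> endo.lin (\<lambda>x. \<phi> i x)"
    and D: "\<And>n i. i \<in> I n \<Longrightarrow> \<exists>k. endo.D k (\<lambda>x. \<phi> i x)"
  shows "diff_series (\<lambda>x n. finsum B (\<lambda>i. \<phi> i x) (I n))"
  unfolding diff_series_def
proof (intro allI conjI)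
  fix n
  show "endo.lin (\<lambda>x. finsum B (\<lambda>i. \<phi> i x) (I n))"
    by (rule lin_finsum) (use assms in auto)
  show "\<exists>k. endo.D k (\<lambda>x. finsum B (\<lambda>i. \<phi> i x) (I n))"
    by (rule endo.D_finsum) (use assms(1) D linear_map_closed[OF lin] in blast)+
qed

text \<open>Each coefficient is a finite sum of operators \<open>E l\<close>, with one argument
  fixed, composed with a coefficient of \<open>\<Phi>\<close>; \<open>diff_along_comp\<close> bounds
  the orders of the compositions.\<close>

lemma diff_series_star:
  assumes \<Phi>: "diff_series \<Phi>" and G: "G \<in> UNIV \<rightarrow> carrier B"
  shows "diff_series (\<lambda>x. star B E (\<Phi> x) G)" "diff_series (\<lambda>x. star B E G (\<Phi> x))"
proof -
  have comp: "\<exists>k. endo.D k (\<lambda>x. \<psi> (\<Phi> x n))" if "endo.lin \<psi>" "\<exists>k. endo.D k \<psi>" for \<psi> n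
    using diff_along_comp[OF B.algebra_axioms that(1) _ diff_seriesD(1)[OF \<Phi>]]
      that(2) diff_seriesD(2)[OF \<Phi>, of n] by blast
  have Gn: "G n \<in> carrier B" for n using G by auto
  show "diff_series (\<lambda>x. star B E (\<Phi> x) G)"
    unfolding star_def case_prod_unfold
  proof (rule diff_series_finsum)
    fix i :: "nat \<times> nat \<times> nat"
    show "endo.lin (\<lambda>x. E (fst i) (\<Phi> x (fst (snd i))) (G (snd (snd i))))"
      by (rule linear_map_comp[OF diff_seriesD(1)[OF \<Phi>] E_linear(1)[OF Gn]])
    show "\<exists>k. endo.D k (\<lambda>x. E (fst i) (\<Phi> x (fst (snd i))) (G (snd (snd i))))"
      by (rule comp[OF E_linear(1)[OF Gn]]) (use E_diff Gn in blast)
  qed (use finite_triples in \<open>simp add: case_prod_unfold\<close>)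
  show "diff_series (\<lambda>x. star B E G (\<Phi> x))"
    unfolding star_def case_prod_unfold
  proof (rule diff_series_finsum)
    fix i :: "nat \<times> nat \<times> nat"
    show "endo.lin (\<lambda>x. E (fst i) (G (fst (snd i))) (\<Phi> x (snd (snd i))))"
      by (rule linear_map_comp[OF diff_seriesD(1)[OF \<Phi>] E_linear(2)[OF Gn]])
    show "\<exists>k. endo.D k (\<lambda>x. E (fst i) (G (fst (snd i))) (\<Phi> x (snd (snd i))))"
      by (rule comp[OF E_linear(2)[OF Gn]]) (use E_diff Gn in blast)
  qed (use finite_triples in \<open>simp add: case_prod_unfold\<close>)
qed

lemma diff_series_scale:
  assumes G: "G \<in> UNIV \<rightarrow> carrier B"
  shows "diff_series (\<lambda>x n. x \<otimes>\<^bsub>B\<^esub> G n)"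
  unfolding diff_series_def
proof (intro allI conjI exI)
  fix n
  have Gn: "G n \<in> carrier B" using G by auto
  show "endo.lin (\<lambda>x. x \<otimes>\<^bsub>B\<^esub> G n)"
    by (rule linear_mapI) (auto simp: Gn B.l_distr B.smult_assoc2)
  \<comment> \<open>Multiplication operators have order 0, so one commutator gives zero.\<close>
  show "endo.D (Suc 0) (\<lambda>x. x \<otimes>\<^bsub>B\<^esub> G n)"
    by (simp add: ad_along_def Gn B.m_assoc[symmetric])
qed

text \<open>If all \<open>s n b n\<close> equal t, then \<open>t F n = b n (s n F n)\<close> is a
  numerator for every n.\<close>

lemma ex_common_denominator:
  assumes F: "F \<in> UNIV \<rightarrow> carrier B"
  shows "\<exists>s\<in>S. \<exists>a \<in> UNIV \<rightarrow> carrier A. \<forall>n :: nat. g s \<otimes>\<^bsub>B\<^esub> F n = g (a n)"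
proof -
  have Fn: "F n \<in> carrier B" for n using F by auto
  have "\<forall>n. \<exists>s a. s \<in> S \<and> a \<in> carrier A \<and> g s \<otimes>\<^bsub>B\<^esub> F n = g a"
    using ex_fraction[OF Fn] by blast
  then obtain s a where sa: "\<And>n. s n \<in> S" "\<And>n. a n \<in> carrier A" "\<And>n. g (s n) \<otimes>\<^bsub>B\<^esub> F n = g (a n)"
    by metis
  obtain t b where t: "t \<in> S" and b: "\<And>n. b n \<in> carrier A" "\<And>n. s n \<otimes>\<^bsub>A\<^esub> b n = t"
    using sigma_CM sa(1) unfolding sigma_CM_def by blast
  have "g t \<otimes>\<^bsub>B\<^esub> F n = g (b n \<otimes>\<^bsub>A\<^esub> a n)" for n
    using sa b(1) Fn g_closed S_closed[OF sa(1)]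
    by (simp add: b(2)[of n, symmetric] g_mult sa(3)[symmetric] B.m_ac)
  then show ?thesis using t b sa(2) by (intro bexI[of _ t] bexI[of _ "\<lambda>n. b n \<otimes>\<^bsub>A\<^esub> a n"]) auto
qed

text \<open>The inverse x of the common denominator carries all that keeps F from being a series of
  numerators. An identity in F becomes one in the single variable x, where rigidity applies.\<close>

lemma ex_scaled_numerators:
  assumes F: "F \<in> UNIV \<rightarrow> carrier B"
  shows "\<exists>x\<in>carrier B. \<exists>a \<in> UNIV \<rightarrow> carrier A. F = (\<lambda>n :: nat. x \<otimes>\<^bsub>B\<^esub> g (a n))"
proof -
  obtain s a where s: "s \<in> S" "a \<in> UNIV \<rightarrow> carrier A" "\<And>n. g s \<otimes>\<^bsub>B\<^esub> F n = g (a n)"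
    using ex_common_denominator[OF F] by blast
  have "F n \<in> carrier B" for n using F by auto
  then have "F n = inv\<^bsub>B\<^esub> (g s) \<otimes>\<^bsub>B\<^esub> g (a n)" for n
    using S_unit[OF s(1)] by (simp add: s(3)[symmetric] B.m_assoc[symmetric] B.Units_l_inv B.Units_closed)
  then show ?thesis using s(2) S_unit[OF s(1)] by (intro bexI[of _ "inv\<^bsub>B\<^esub> (g s)"] bexI[of _ a]) auto
qed

lemma scaled_numerators:
  "\<lbrakk>c \<in> carrier A; a \<in> UNIV \<rightarrow> carrier A\<rbrakk> \<Longrightarrow> (\<lambda>n :: nat. g c \<otimes>\<^bsub>B\<^esub> g (a n)) = \<eta> (\<lambda>n. c \<otimes>\<^bsub>A\<^esub> a n)"
  by (auto simp: g_mult Pi_def)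

text \<open>By the common denominators, the laws of the localized star product become identities between
  series whose coefficients are differential operators in a scalar \<open>x \<in> B\<close>; they hold for numerators,
  hence for all \<open>x\<close>.\<close>

lemma starB_assoc:
  assumes "F \<in> UNIV \<rightarrow> carrier B" "G \<in> UNIV \<rightarrow> carrier B" "H \<in> UNIV \<rightarrow> carrier B"
  shows "star B E (star B E F G) H = star B E F (star B E G H)"
proof -
  obtain x a where x: "x \<in> carrier B" "a \<in> UNIV \<rightarrow> carrier A" "F = (\<lambda>n. x \<otimes>\<^bsub>B\<^esub> \<eta> a n)"
    using ex_scaled_numerators[OF assms(1)] by blast
  obtain y b where y: "y \<in> carrier B" "b \<in> UNIV \<rightarrow> carrier A" "G = (\<lambda>n. y \<otimes>\<^bsub>B\<^esub> \<eta> b n)"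
    using ex_scaled_numerators[OF assms(2)] by blast
  obtain z c where z: "z \<in> carrier B" "c \<in> UNIV \<rightarrow> carrier A" "H = (\<lambda>n. z \<otimes>\<^bsub>B\<^esub> \<eta> c n)"
    using ex_scaled_numerators[OF assms(3)] by blast
  note cl = eta_closed[OF x(2)] eta_closed[OF y(2)] eta_closed[OF z(2)]
  note scale = diff_series_scale[OF cl(1)] diff_series_scale[OF cl(2)] diff_series_scale[OF cl(3)]
  have scale_closed: "(\<lambda>n. u \<otimes>\<^bsub>B\<^esub> \<eta> f n) \<in> UNIV \<rightarrow> carrier B" if "u \<in> carrier B" "f \<in> UNIV \<rightarrow> carrier A" for u f
    using that g_closed by auto
  let ?f = "\<lambda>x n. x \<otimes>\<^bsub>B\<^esub> \<eta> a n" and ?g = "\<lambda>x n. x \<otimes>\<^bsub>B\<^esub> \<eta> b n" and ?h = "\<lambda>x n. x \<otimes>\<^bsub>B\<^esub> \<eta> c n"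
  let ?eq = "\<lambda>x y z. star B E (star B E (?f x) (?g y)) (?h z) = star B E (?f x) (star B E (?g y) (?h z))"
  \<comment> \<open>For numerator scalars all three series come from A, where the star product is
    associative.\<close>
  have 1: "?eq (g x') (g y') (g z')"
    if *: "x' \<in> carrier A" "y' \<in> carrier A" "z' \<in> carrier A" for x' y' z'
  proof -
    have m: "(\<lambda>n. u \<otimes>\<^bsub>A\<^esub> f n) \<in> UNIV \<rightarrow> carrier A" if "u \<in> carrier A" "f \<in> UNIV \<rightarrow> carrier A" for u and f :: "nat \<Rightarrow> _"
      using that by auto
    note m = m[OF *(1) x(2)] m[OF *(2) y(2)] m[OF *(3) z(2)]
    show ?thesis
      unfolding scaled_numerators[OF *(1) x(2)] scaled_numerators[OF *(2) y(2)] scaled_numerators[OF *(3) z(2)]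
      using m by (simp add: eta_star[symmetric] star_closed star_assoc)
  qed
  \<comment> \<open>The scalars are released from last to first; at each stage both sides are
    differential in the released one while the other two stay fixed.\<close>
  have 2: "?eq (g x') (g y') z" if *: "x' \<in> carrier A" "y' \<in> carrier A" for x' y'
  proof (rule diff_series_eq[OF _ _ _ z(1)])
    show "?eq (g x') (g y') (g z')" if "z' \<in> carrier A" for z' by (rule 1) (use * that in auto)
    note cl' = scale_closed[OF g_closed[OF *(1)] x(2)] scale_closed[OF g_closed[OF *(2)] y(2)]
    show "diff_series (\<lambda>z. star B E (star B E (?f (g x')) (?g (g y'))) (?h z))"
      by (intro diff_series_star scale starB_closed cl')
    show "diff_series (\<lambda>z. star B E (?f (g x')) (star B E (?g (g y')) (?h z)))"
      by (intro diff_series_star scale starB_closed cl')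
  qed
  have 3: "?eq (g x') y z" if *: "x' \<in> carrier A" for x'
  proof (rule diff_series_eq[OF _ _ _ y(1)])
    show "?eq (g x') (g y') z" if "y' \<in> carrier A" for y' by (rule 2) (use * that in auto)
    note cl' = scale_closed[OF g_closed[OF *(1)] x(2)] scale_closed[OF z(1,2)]
    show "diff_series (\<lambda>y. star B E (star B E (?f (g x')) (?g y)) (?h z))"
      by (intro diff_series_star scale starB_closed cl')
    show "diff_series (\<lambda>y. star B E (?f (g x')) (star B E (?g y) (?h z)))"
      by (intro diff_series_star scale starB_closed cl')
  qed
  have "?eq x y z"
  proof (rule diff_series_eq[OF _ _ _ x(1)])
    show "?eq (g x') y z" if "x' \<in> carrier A" for x' by (rule 3) (use that in auto)
    note cl' = scale_closed[OF y(1,2)] scale_closed[OF z(1,2)]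
    show "diff_series (\<lambda>x. star B E (star B E (?f x) (?g y)) (?h z))"
      by (intro diff_series_star scale starB_closed cl')
    show "diff_series (\<lambda>x. star B E (?f x) (star B E (?g y) (?h z)))"
      by (intro diff_series_star scale starB_closed cl')
  qed
  then show ?thesis by (simp add: x(3) y(3) z(3))
qed

lemma eta_one: "\<eta> \<one>\<^bsub>R\<^esub> = \<one>\<^bsub>T\<^esub>"
  by (auto simp: star_algebra_simps g_one g_zero)

lemma starB_one:
  assumes F: "F \<in> UNIV \<rightarrow> carrier B"
  shows "star B E \<one>\<^bsub>T\<^esub> F = F" "star B E F \<one>\<^bsub>T\<^esub> = F"
proof -
  obtain x a where x: "x \<in> carrier B" "a \<in> UNIV \<rightarrow> carrier A" "F = (\<lambda>n. x \<otimes>\<^bsub>B\<^esub> \<eta> a n)"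
    using ex_scaled_numerators[OF F] by blast
  note scale = diff_series_scale[OF eta_closed[OF x(2)]]
  have one: "\<one>\<^bsub>R\<^esub> \<in> UNIV \<rightarrow> carrier A" "\<one>\<^bsub>T\<^esub> \<in> UNIV \<rightarrow> carrier B" by (auto simp: star_algebra_simps)
  let ?f = "\<lambda>x n. x \<otimes>\<^bsub>B\<^esub> \<eta> a n"
  have *: "star B E \<one>\<^bsub>T\<^esub> (?f (g x')) = ?f (g x')" "star B E (?f (g x')) \<one>\<^bsub>T\<^esub> = ?f (g x')"
    if x': "x' \<in> carrier A" for x'
  proof -
    have m: "(\<lambda>n. x' \<otimes>\<^bsub>A\<^esub> a n) \<in> UNIV \<rightarrow> carrier A" using x' x(2) by auto
    show "star B E \<one>\<^bsub>T\<^esub> (?f (g x')) = ?f (g x')" "star B E (?f (g x')) \<one>\<^bsub>T\<^esub> = ?f (g x')"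
      unfolding scaled_numerators[OF x' x(2)] eta_one[symmetric]
      using star_one[OF m] by (simp_all add: eta_star[symmetric] m one star_algebra_simps(3))
  qed
  have "star B E \<one>\<^bsub>T\<^esub> (?f x) = ?f x"
    by (rule diff_series_eq[OF diff_series_star(2)[OF scale one(2)] scale *(1) x(1)])
  moreover have "star B E (?f x) \<one>\<^bsub>T\<^esub> = ?f x"
    by (rule diff_series_eq[OF diff_series_star(1)[OF scale one(2)] scale *(2) x(1)])
  ultimately show "star B E \<one>\<^bsub>T\<^esub> F = F" "star B E F \<one>\<^bsub>T\<^esub> = F" by (simp_all only: x(3))
qed

text \<open>Both sides are differential in either argument and agree on numerators; rigidity is
  applied to the second argument and then to the first.\<close>

lemma E_0: "\<lbrakk>x \<in> carrier B; y \<in> carrier B\<rbrakk> \<Longrightarrow> E 0 x y = x \<otimes>\<^bsub>B\<^esub> y"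
proof -
  assume xy: "x \<in> carrier B" "y \<in> carrier B"
  obtain k where k: "\<And>b. b \<in> carrier B \<Longrightarrow> endo.D k (\<lambda>a. E 0 a b)" "\<And>a. a \<in> carrier B \<Longrightarrow> endo.D k (E 0 a)"
    using E_diff by blast
  have mult_D: "endo.D 1 (\<lambda>x. x \<otimes>\<^bsub>B\<^esub> c)" "endo.D 1 (\<lambda>x. c \<otimes>\<^bsub>B\<^esub> x)" if "c \<in> carrier B" for c
    using that by (simp_all add: ad_along_def B.m_ac)
  have "E 0 (g a) y = g a \<otimes>\<^bsub>B\<^esub> y" if a: "a \<in> carrier A" for a
  proof (rule eq_if_eq_on_image[OF k(2) mult_D(2) _ _ _ xy(2)])
    show "E 0 (g a) (g b) = g a \<otimes>\<^bsub>B\<^esub> g b" if "b \<in> carrier A" for b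
      using a that by (simp add: E_compat[symmetric] C_0 g_mult)
  qed (use a g_closed E_closed in auto)
  then show ?thesis
    by (intro eq_if_eq_on_image[OF k(1) mult_D(1) _ _ _ xy(1), of y y]) (use xy E_closed in auto)
qed

lemma star_product_E: "star_product K B E"
proof (intro star_product.intro star_product_axioms.intro B.algebra_axioms)
  have "star B E \<one>\<^bsub>T\<^esub> f = f \<and> star B E f \<one>\<^bsub>T\<^esub> = f" if "f \<in> UNIV \<rightarrow> carrier B" for f
    using starB_one[OF that] by simp
  then show "diff_star_product K B E"
    unfolding diff_star_product_def Let_def star_algebra_simps(1,5)
    using E_bidiff E_0 starB_assoc by simp
qed

sublocale E: star_product K B E
  by (rule star_product_E)

lemma eta_hom: "\<eta> \<in> alg_hom (ps_ring K) R T"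
proof -
  have closed: "\<eta> f \<in> carrier T" if "f \<in> carrier R" for f
    using that eta_closed by (simp add: star_algebra_simps)
  have mult: "\<eta> (f \<otimes>\<^bsub>R\<^esub> h) = \<eta> f \<otimes>\<^bsub>T\<^esub> \<eta> h" if "f \<in> carrier R" "h \<in> carrier R" for f h
    using that eta_star by (simp add: star_algebra_simps)
  have add: "\<eta> (f \<oplus>\<^bsub>R\<^esub> h) = \<eta> f \<oplus>\<^bsub>T\<^esub> \<eta> h" if "f \<in> carrier R" "h \<in> carrier R" for f h
    using that by (auto simp: star_algebra_simps g_add Pi_def)
  have smult: "\<eta> (c \<odot>\<^bsub>R\<^esub> f) = c \<odot>\<^bsub>T\<^esub> \<eta> f" if "c \<in> carrier (ps_ring K)" "f \<in> carrier R" for c f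
    unfolding star_algebra_simps
  proof
    fix n
    have cl: "f i \<in> carrier A" "c i \<in> carrier K" for i
      using that by (auto simp: star_algebra_simps ps_ring_simps)
    show "g (\<Oplus>\<^bsub>A\<^esub>i\<in>{..n}. c i \<odot>\<^bsub>A\<^esub> f (n - i)) = (\<Oplus>\<^bsub>B\<^esub>i\<in>{..n}. c i \<odot>\<^bsub>B\<^esub> g (f (n - i)))"
      by (subst linear_map_finsum[OF A.algebra_axioms B.algebra_axioms g_linear]) (auto simp: cl g_smult)
  qed
  show ?thesis
    unfolding alg_hom_def ring_hom_def
    by (intro CollectI conjI ballI allI impI funcsetI closed mult add smult eta_one) auto
qed

section \<open>Constant series that annihilate or clear denominators\<close>

definition const_series
  where "const_series w = (\<lambda>n :: nat. if n = 0 then w else \<zero>\<^bsub>A\<^esub>)"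

lemma const_series_closed: "w \<in> S \<Longrightarrow> const_series w \<in> ps_lift_set A S"
  using S_closed by (auto simp: const_series_def ps_lift_set_def)

lemma star_0: "\<lbrakk>f \<in> UNIV \<rightarrow> carrier A; h \<in> UNIV \<rightarrow> carrier A\<rbrakk> \<Longrightarrow> star A C f h 0 = f 0 \<otimes>\<^bsub>A\<^esub> h 0"
proof -
  assume fh: "f \<in> UNIV \<rightarrow> carrier A" "h \<in> UNIV \<rightarrow> carrier A"
  have "triples 0 = {(0, 0, 0)}" by auto
  then show ?thesis
    using fh unfolding star_def by (subst A.M.finsum_single[of _ "(0, 0, 0)"]) (auto simp: C_0 Pi_def)
qed

lemma submonoid_lift: "submonoid (ps_lift_set A S) R"
proof
  show "ps_lift_set A S \<subseteq> carrier R" by (auto simp: ps_lift_set_def star_algebra_simps)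
  show "\<one>\<^bsub>R\<^esub> \<in> ps_lift_set A S" using S_one by (auto simp: ps_lift_set_def star_algebra_simps)
  fix f h assume "f \<in> ps_lift_set A S" "h \<in> ps_lift_set A S"
  then show "f \<otimes>\<^bsub>R\<^esub> h \<in> ps_lift_set A S"
    using star_closed[of f h] S_mult by (auto simp: ps_lift_set_def star_algebra_simps star_0)
qed

text \<open>The exponents \<open>k l\<close> may be unbounded in l, so in general no single power of
  s is a multiple of all these powers. Here the sigma CM property is applied to the powers of one
  element.\<close>

lemma ex_common_pow_multiple:
  assumes "s \<in> S"
  shows "\<exists>w\<in>S. \<forall>l :: nat. \<exists>b\<in>carrier A. w = s [^]\<^bsub>A\<^esub> (k l :: nat) \<otimes>\<^bsub>A\<^esub> b"
proof -
  have "s [^]\<^bsub>A\<^esub> (n :: nat) \<in> S" for n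
    using assms by (induction n) (auto simp: S_one S_mult)
  then obtain b w where "w \<in> S" "\<And>l. b l \<in> carrier A" "\<And>l. s [^]\<^bsub>A\<^esub> k l \<otimes>\<^bsub>A\<^esub> b l = w"
    using sigma_CM[unfolded sigma_CM_def, rule_format, of "\<lambda>l. s [^]\<^bsub>A\<^esub> k l"] by blast
  then show ?thesis by (intro bexI[of _ w]) (metis)+
qed

lemma ex_annihilator_if_eta_zero:
  assumes r: "r \<in> carrier R" and eta: "\<eta> r = \<zero>\<^bsub>T\<^esub>"
  shows "\<exists>s\<in>ps_lift_set A S. r \<otimes>\<^bsub>R\<^esub> s = \<zero>\<^bsub>R\<^esub>"
proof -
  interpret A_id: algebra_map K A A "\<lambda>x. x" by (rule A.algebra_map_id)
  have cl: "r n \<in> carrier A" for n using r by (auto simp: star_algebra_simps)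
  have "g (r n) = \<zero>\<^bsub>B\<^esub>" for n using fun_cong[OF eta, of n] by (simp add: star_algebra_simps)
  then have "\<forall>n. \<exists>u\<in>S. u \<otimes>\<^bsub>A\<^esub> r n = \<zero>\<^bsub>A\<^esub>" using ker cl by blast
  then obtain u where u: "\<And>n. u n \<in> S" "\<And>n. u n \<otimes>\<^bsub>A\<^esub> r n = \<zero>\<^bsub>A\<^esub>" by metis
  \<comment> \<open>Each coefficient of r has its own annihilator \<open>u n\<close>; a common
    multiple t annihilates all coefficients.\<close>
  obtain t b where t: "t \<in> S" and b: "\<And>n. b n \<in> carrier A" "\<And>n. u n \<otimes>\<^bsub>A\<^esub> b n = t"
    using sigma_CM u(1) unfolding sigma_CM_def by blast
  have tc: "t \<in> carrier A" using t S_closed by simp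
  have tr: "t \<otimes>\<^bsub>A\<^esub> c \<otimes>\<^bsub>A\<^esub> r n = \<zero>\<^bsub>A\<^esub>" if c: "c \<in> carrier A" for c n
  proof -
    have "t \<otimes>\<^bsub>A\<^esub> c \<otimes>\<^bsub>A\<^esub> r n = b n \<otimes>\<^bsub>A\<^esub> c \<otimes>\<^bsub>A\<^esub> (u n \<otimes>\<^bsub>A\<^esub> r n)"
      unfolding b(2)[of n, symmetric] using c cl b(1) S_closed[OF u(1)] by (simp add: A.m_ac)
    then show ?thesis using c b(1) u(2) by simp
  qed
  have zero: "C l \<zero>\<^bsub>A\<^esub> x = \<zero>\<^bsub>A\<^esub>" "C l x \<zero>\<^bsub>A\<^esub> = \<zero>\<^bsub>A\<^esub>" if "x \<in> carrier A" for l x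
    using A_id.lin_zero[OF C_linear(1)[OF that]] A_id.lin_zero[OF C_linear(2)[OF that]] by auto
  \<comment> \<open>The case N = 0 for the identity of A: one exponent for each l, valid for all
    coefficients of r.\<close>
  have "\<exists>k. \<forall>x\<in>carrier A. (\<forall>c\<in>carrier A. \<forall>b\<in>carrier A. C l (t \<otimes>\<^bsub>A\<^esub> c \<otimes>\<^bsub>A\<^esub> x) b \<in> {\<zero>\<^bsub>A\<^esub>}) \<longrightarrow>
      (\<forall>b\<in>carrier A. C l x (t [^]\<^bsub>A\<^esub> (k :: nat) \<otimes>\<^bsub>A\<^esub> b) \<in> {\<zero>\<^bsub>A\<^esub>})" for l
  proof -
    obtain k where "\<And>b. b \<in> carrier A \<Longrightarrow> A_id.D k (\<lambda>a. C l a b)" "\<And>a. a \<in> carrier A \<Longrightarrow> A_id.D k (C l a)"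
      using C_diff by blast
    then show ?thesis
      by (intro A_id.ex_pow_bidiff_mem[of "{\<zero>\<^bsub>A\<^esub>}" t k "C l" k]) (auto simp: tc A.M.minus_eq)
  qed
  then obtain k where k: "\<And>l x b. \<lbrakk>x \<in> carrier A; b \<in> carrier A;
      \<And>c b. \<lbrakk>c \<in> carrier A; b \<in> carrier A\<rbrakk> \<Longrightarrow> C l (t \<otimes>\<^bsub>A\<^esub> c \<otimes>\<^bsub>A\<^esub> x) b = \<zero>\<^bsub>A\<^esub>\<rbrakk> \<Longrightarrow>
      C l x (t [^]\<^bsub>A\<^esub> (k l :: nat) \<otimes>\<^bsub>A\<^esub> b) = \<zero>\<^bsub>A\<^esub>"
    unfolding singleton_iff by metis
  obtain w where w: "w \<in> S" "\<And>l. \<exists>b\<in>carrier A. w = t [^]\<^bsub>A\<^esub> k l \<otimes>\<^bsub>A\<^esub> b"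
    using ex_common_pow_multiple[OF t, of k] by blast
  \<comment> \<open>For every l the element w is a multiple of the power of t that belongs to l, so
    each term of the product with the constant series vanishes separately.\<close>
  have Cw: "C l (r p) w = \<zero>\<^bsub>A\<^esub>" for l p
  proof -
    obtain b where b: "b \<in> carrier A" "w = t [^]\<^bsub>A\<^esub> k l \<otimes>\<^bsub>A\<^esub> b" using w(2) by blast
    show ?thesis unfolding b(2) by (rule k[OF cl b(1)]) (simp add: tr zero)
  qed
  have "star A C r (const_series w) = (\<lambda>n. \<zero>\<^bsub>A\<^esub>)"
  proof
    fix n show "star A C r (const_series w) n = \<zero>\<^bsub>A\<^esub>"
      unfolding star_def by (rule A.M.add.finprod_one_eqI) (auto simp: const_series_def Cw zero cl)
  qed
  then show ?thesis
    using const_series_closed[OF w(1)] by (intro bexI[of _ "const_series w"]) (simp_all add: star_algebra_simps)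
qed

lemma ex_fraction_series:
  assumes F: "F \<in> carrier T"
  shows "\<exists>s\<in>ps_lift_set A S. \<exists>r\<in>carrier R. F \<otimes>\<^bsub>T\<^esub> \<eta> s = \<eta> r"
proof -
  have F': "F \<in> UNIV \<rightarrow> carrier B" "F n \<in> carrier B" for n using F by (auto simp: star_algebra_simps)
  obtain s a where s: "s \<in> S" and a: "a \<in> UNIV \<rightarrow> carrier A" "\<And>n. g s \<otimes>\<^bsub>B\<^esub> F n = g (a n)"
    using ex_common_denominator[OF F'(1)] by blast
  have sc: "s \<in> carrier A" "g s \<in> carrier B" using s S_closed g_closed by auto
  have an: "a n \<in> carrier A" for n using a(1) by auto
  let ?N = "g ` carrier A"
  have N_add: "x \<oplus>\<^bsub>B\<^esub> y \<in> ?N" if "x \<in> ?N" "y \<in> ?N" for x y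
    using that by (auto simp: g_add[symmetric])
  have N_minus: "x \<ominus>\<^bsub>B\<^esub> y \<in> ?N" if "x \<in> ?N" "y \<in> ?N" for x y
    using that by (auto simp: lin_diff[OF g_linear, symmetric])
  have N_mult: "g c \<otimes>\<^bsub>B\<^esub> x \<in> ?N" if "c \<in> carrier A" "x \<in> ?N" for c x
    using that by (auto simp: g_mult[symmetric])
  have N_zero: "\<zero>\<^bsub>B\<^esub> \<in> ?N" using g_zero by (metis A.M.zero_closed imageI)
  have N_sub: "?N \<subseteq> carrier B" using g_closed by auto
  have fin: "finsum B \<phi> I \<in> ?N" if "finite I" "\<And>i. i \<in> I \<Longrightarrow> \<phi> i \<in> ?N" for I and \<phi> :: "nat \<times> nat \<times> nat \<Rightarrow> _"
    using that
  proof (induction I)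
    case (insert i I)
    then have "\<phi> i \<in> ?N" "finsum B \<phi> I \<in> ?N" "\<phi> \<in> I \<rightarrow> carrier B" using N_sub by auto
    then show ?case using insert.hyps N_sub by (subst B.M.finsum_insert) (auto intro: N_add)
  qed (simp add: N_zero)
  \<comment> \<open>Multiples of s turn \<open>F n\<close> into a numerator, and on numerators
    \<open>E l\<close> restricts to \<open>C l\<close>. This is the hypothesis of
    \<open>ex_pow_bidiff_mem\<close> for the set of numerators.\<close>
  have val: "E l (g (s \<otimes>\<^bsub>A\<^esub> c) \<otimes>\<^bsub>B\<^esub> F n) (g b) \<in> ?N" if "c \<in> carrier A" "b \<in> carrier A" for c b l n
  proof -
    have "g (s \<otimes>\<^bsub>A\<^esub> c) \<otimes>\<^bsub>B\<^esub> F n = g (c \<otimes>\<^bsub>A\<^esub> a n)"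
      using that sc an F' g_closed by (simp add: g_mult a(2)[symmetric] B.m_ac)
    then show ?thesis using that an by (simp add: E_compat[symmetric])
  qed
  \<comment> \<open>The exponent is uniform in n, which leaves for
    \<open>ex_common_pow_multiple\<close> a family indexed by l alone.\<close>
  have "\<exists>k. \<forall>n. \<forall>b\<in>carrier A. E l (F n) (g (s [^]\<^bsub>A\<^esub> (k :: nat) \<otimes>\<^bsub>A\<^esub> b)) \<in> ?N" for l
  proof -
    obtain k where k: "\<And>b. b \<in> carrier B \<Longrightarrow> endo.D k (\<lambda>a. E l a b)" "\<And>a. a \<in> carrier B \<Longrightarrow> endo.D k (E l a)"
      using E_diff by blast
    have "\<exists>k. \<forall>x\<in>carrier B. (\<forall>c\<in>carrier A. \<forall>b\<in>carrier A. E l (g (s \<otimes>\<^bsub>A\<^esub> c) \<otimes>\<^bsub>B\<^esub> x) (g b) \<in> ?N) \<longrightarrow>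
        (\<forall>b\<in>carrier A. E l x (g (s [^]\<^bsub>A\<^esub> (k :: nat) \<otimes>\<^bsub>A\<^esub> b)) \<in> ?N)"
      by (rule ex_pow_bidiff_mem[OF N_sub N_zero N_add N_minus N_mult sc(1), of k "\<lambda>x b. E l x (g b)" k])
        (assumption | rule k g_closed E_closed D_comp_along)+
    then obtain j where "\<forall>x\<in>carrier B. (\<forall>c\<in>carrier A. \<forall>b\<in>carrier A. E l (g (s \<otimes>\<^bsub>A\<^esub> c) \<otimes>\<^bsub>B\<^esub> x) (g b) \<in> ?N) \<longrightarrow>
        (\<forall>b\<in>carrier A. E l x (g (s [^]\<^bsub>A\<^esub> (j :: nat) \<otimes>\<^bsub>A\<^esub> b)) \<in> ?N)" ..
    note bspec[OF this F'(2), THEN mp, OF ballI[OF ballI[OF val]]]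
    then show ?thesis by blast
  qed
  then have "\<forall>l. \<exists>k. \<forall>n. \<forall>b\<in>carrier A. E l (F n) (g (s [^]\<^bsub>A\<^esub> (k :: nat) \<otimes>\<^bsub>A\<^esub> b)) \<in> ?N" ..
  from choice[OF this] obtain k where
    k: "\<forall>l n. \<forall>b\<in>carrier A. E l (F n) (g (s [^]\<^bsub>A\<^esub> (k l :: nat) \<otimes>\<^bsub>A\<^esub> b)) \<in> ?N" ..
  obtain w where w: "w \<in> S" "\<And>l. \<exists>b\<in>carrier A. w = s [^]\<^bsub>A\<^esub> k l \<otimes>\<^bsub>A\<^esub> b"
    using ex_common_pow_multiple[OF s, of k] by blast
  have Ew: "E l (F p) (g w) \<in> ?N" for l p using w(2)[of l] k by blast
  have zero: "E l x \<zero>\<^bsub>B\<^esub> = \<zero>\<^bsub>B\<^esub>" if "x \<in> carrier B" for l x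
    using endo.lin_zero[OF E_linear(2)[OF that]] .
  \<comment> \<open>Terms with q > 0 vanish, and those with q = 0 are values
    \<open>E l (F p) (g w)\<close>, which are numerators; so is their finite sum.\<close>
  have "star B E F (\<eta> (const_series w)) n \<in> ?N" for n
    unfolding star_def by (rule fin) (auto simp: const_series_def g_zero zero F' N_zero Ew)
  then have "\<forall>n. \<exists>c. c \<in> carrier A \<and> star B E F (\<eta> (const_series w)) n = g c" by blast
  from choice[OF this] obtain r where "\<And>n. r n \<in> carrier A" "\<And>n. star B E F (\<eta> (const_series w)) n = g (r n)" by blast
  then show ?thesis
    using const_series_closed[OF w(1)]
    by (intro bexI[of _ "const_series w"] bexI[of _ r]) (auto simp: star_algebra_simps)
qed

sublocale fractions: fraction_algebra "ps_ring K" R T "ps_lift_set A S" \<eta>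
proof (intro fraction_algebra.intro fraction_algebra_axioms.intro nc_algebra_star E.nc_algebra_star
    submonoid_lift eta_hom ex_annihilator_if_eta_zero ex_fraction_series)
  fix f assume f: "f \<in> ps_lift_set A S"
  \<comment> \<open>The constant term of \<open>\<eta> f\<close> is the image of an element of S,
    hence a unit, and a series with unit constant term is invertible.\<close>
  show "\<eta> f \<in> Units T"
    by (rule E.Units_star) (use f S_unit g_closed in \<open>auto simp: ps_lift_set_def star_algebra_simps Pi_def\<close>)
qed

lemma left_denominator_set: "left_denominator_set R (ps_lift_set A S)"
proof -
  let ?C = "\<lambda>l a b. C l b a" and ?E = "\<lambda>l a b. E l b a"
  have "star_localization K A B g S ?C ?E"
  proof (intro star_localization.intro star_localization_axioms.intro localization_map_axioms
      star_product_swap sigma_CM)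
    fix l
    obtain k1 k2 where "bidiff_op K B k1 k2 (E l)" using E_bidiff by blast
    then have "bidiff_op K B k2 k1 (\<lambda>a b. E l b a)" by (simp add: bidiff_op_def)
    then show "\<exists>k1 k2. bidiff_op K B k1 k2 (?E l)" by blast
  qed (rule E_compat)
  then interpret swap: star_localization K A B g S ?C ?E .
  have sub: "f \<in> carrier R" if "f \<in> ps_lift_set A S" for f
    using that by (auto simp: ps_lift_set_def star_algebra_simps)
  have mult: "f \<otimes>\<^bsub>star_algebra A ?C\<^esub> h = h \<otimes>\<^bsub>R\<^esub> f" if "f \<in> carrier R" "h \<in> carrier R" for f h
    using that by (simp add: star_algebra_simps star_swap)
  have carrier: "carrier (star_algebra A ?C) = carrier R" and zero: "\<zero>\<^bsub>star_algebra A ?C\<^esub> = \<zero>\<^bsub>R\<^esub>"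
    by (simp_all add: star_algebra_simps)
  \<comment> \<open>Multiplication in the exchanged algebra is the opposite one, so its right
    denominator conditions are the left ones here.\<close>
  from swap.fractions.right_denominator_set show ?thesis
    unfolding right_denominator_set_def left_denominator_set_def carrier zero
    using submonoid_lift by (simp add: mult sub cong: ball_cong bex_cong)
qed

end

section \<open>The localization of A at \<open>S\<^sub>0\<close> and of the series at the lifted
  set\<close>

theorem proposition4p7:
  fixes K :: "('k, 'm) ring_scheme"
    and A :: "('k, 'a, 'n) module_scheme"
    and C :: "nat \<Rightarrow> 'a \<Rightarrow> 'a \<Rightarrow> 'a"
    and S\<^sub>0 :: "'a set"
  assumes "algebra K A"
    and "diff_star_product K A C"
    and "submonoid S\<^sub>0 A"
    and "sigma_CM A S\<^sub>0"
  shows "let R = star_algebra A C;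
             S = ps_lift_set A S\<^sub>0;
             R\<^sub>S = nc_loc (ps_ring K) R S;
             T = star_algebra (comm_loc A S\<^sub>0) (\<lambda>i. loc_bidiff K A S\<^sub>0 (C i));
             canonical = induced_morphism (ps_ring K) R S T (ps_numer A S\<^sub>0)
         in (\<exists>!\<Phi>. canonical \<Phi>) \<and>
            (\<forall>\<Phi>. canonical \<Phi> \<longrightarrow> \<Phi> \<in> alg_iso (ps_ring K) R\<^sub>S T) \<and>
            right_denominator_set R S \<and> left_denominator_set R S"
proof -
  let ?B = "comm_loc A S\<^sub>0" and ?E = "\<lambda>i. loc_bidiff K A S\<^sub>0 (C i)"
  interpret loc: commutative_localization K A S\<^sub>0
    using assms by (intro commutative_localization.intro commutative_localization_axioms.intro)
  interpret localization_map K A ?B "numer A S\<^sub>0" S\<^sub>0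
    by (rule loc.loc_localization_map)
  \<comment> \<open>\<open>ex_bidiff_extension\<close> provides a witness for the choice in
    \<open>loc_bidiff\<close>, so the chosen operators have the properties required of E in
    \<open>star_localization\<close>.\<close>
  have E: "(\<exists>k\<^sub>1 k\<^sub>2. bidiff_op K ?B k\<^sub>1 k\<^sub>2 (?E i)) \<and>
      (\<forall>a\<in>carrier A. \<forall>b\<in>carrier A. numer A S\<^sub>0 (C i a b) = ?E i (numer A S\<^sub>0 a) (numer A S\<^sub>0 b))" for i
  proof -
    obtain k1 k2 where "bidiff_op K A k1 k2 (C i)"
      using assms(2) unfolding diff_star_product_def by blast
    then obtain E where "bidiff_op K ?B k1 k2 E"
        "\<forall>a\<in>carrier A. \<forall>b\<in>carrier A. numer A S\<^sub>0 (C i a b) = E (numer A S\<^sub>0 a) (numer A S\<^sub>0 b)"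
      using ex_bidiff_extension by blast
    then have "\<exists>E. (\<exists>k\<^sub>1 k\<^sub>2. bidiff_op K ?B k\<^sub>1 k\<^sub>2 E) \<and>
        (\<forall>a\<in>carrier A. \<forall>b\<in>carrier A. numer A S\<^sub>0 (C i a b) = E (numer A S\<^sub>0 a) (numer A S\<^sub>0 b))"
      by (intro exI conjI)
    then show ?thesis unfolding loc_bidiff_def by (rule someI_ex)
  qed
  interpret star_localization K A ?B "numer A S\<^sub>0" S\<^sub>0 C ?E
    by (intro star_localization.intro star_localization_axioms.intro localization_map_axioms
        star_product.intro star_product_axioms.intro assms) (use E in blast)+
  have eta: "ps_numer A S\<^sub>0 = (\<lambda>f n. numer A S\<^sub>0 (f n))"
    by (simp add: ps_numer_def fun_eq_iff)
  have ex: "\<exists>!\<Phi>. induced_morphism (ps_ring K) R (ps_lift_set A S\<^sub>0) T (\<lambda>f n. numer A S\<^sub>0 (f n)) \<Phi>"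
    using fractions.S_closed fractions.S_unit
    by (intro nc_loc_universal nc_algebra_star E.nc_algebra_star eta_hom) auto
  show ?thesis
    unfolding Let_def eta
    using ex fractions.induced_morphism_iso fractions.right_denominator_set left_denominator_set by blast
qed

end
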